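(* For each $n\ge2$ let $X=X^{(n)}$ be a random variable with values in $\{2,\dots,n\}$, let $Y$ be its size-biased version, $\mu=\mathbb E[\log Y]$, $\sigma^2=\mathrm{Var}(\log Y)$ ($\sigma\ge0$), and $\varrho=\sigma/\mu$. Assume that one of the following two scenarios holds. Scenario 1: $\mu/\log n\to0$ as $n\to\infty$, and $\sigma=0$ for all $n$. Scenario 2: $\mu/\log n\to0$ and $\sigma^2/(\mu\log n)\to0$ as $n\to\infty$, $\sigma\ne0$ for all $n$, and, with $Y_1,Y_2,\dots$ i.i.d. copies of $Y$, $$\lim_{n\to\infty}\mathbb P\bigg(\sqrt{\frac{\mu}{\log n}}\sum_{s=1}^{\lfloor\mu^{-1}\log n\rfloor}\frac{\log Y_s-\mu}{\sigma}>\beta\bigg)=\Phi(-\beta)\qquad\text{for all }\beta\in\mathbb R.$$ Let $$t_{\rm ent}=\frac{n\log n}{\mathbb E[X]\,\mu},\qquad t_{\rm w}=\Big(1+\frac\sigma\mu\Big)\frac{n\sqrt{\log n}}{\mathbb E[X]\sqrt\mu}.$$ Then, for the $X$-Block Average process started from a Dirac mass, for every $\beta\in\mathbb R$, $$d_{\rm TV}\big(\lfloor t_{\rm ent}+\beta t_{\rm w}\rfloor\big)-\Phi\bigg(-\beta\,\frac{1+\varrho}{\sqrt{1+\varrho^2}}\bigg)\longrightarrow0\quad\text{in probability as }n\to\infty.$$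
   Context: Let $V=\{1,\dots,n\}$ and let $\Delta$ be the set of probability vectors on $V$. For $A\subset V$ and $\eta\in\Delta$, let $\varPsi_A\eta(x)=\frac1{|A|}\sum_{y\in A}\eta(y)$ if $x\in A$ and $\varPsi_A\eta(x)=\eta(x)$ if $x\notin A$. Given the law of $X$ (which may depend on $n$), let $X_1,X_2,\dots$ be i.i.d. copies of $X$ and, independently for each $t$, given $X_t$ let $A_t$ be a uniformly random subset of $V$ with $|A_t|=X_t$. The $X$-Block Average process started from $\eta_0$ is $\eta_t=\varPsi_{A_t}\cdots\varPsi_{A_1}\eta_0$; here $\eta_0$ is the Dirac mass at some $x_0\in V$. Let $\pi(x)\equiv 1/n$, $\|v\|_{\rm TV}=\frac12\sum_{x\in V}|v(x)|$, and $d_{\rm TV}(t)=\|\eta_t-\pi\|_{\rm TV}$ (a random variable). The size-biased version $Y$ of $X$ has law $\mathbb P(Y=k)=k\,\mathbb P(X=k)/\mathbb E[X]$, $k\in\{2,\dots,n\}$, so that $\mu=\mathbb E[X\log X]/\mathbb E[X]$ and $\sigma^2=\mathbb E[X(\log X)^2]/\mathbb E[X]-\mu^2$. $\Phi$ is the CDF of the standard Gaussian. Logarithms are natural; $X,Y,\mu,\sigma,\varrho$ may all depend on $n$, and no convergence of $\varrho$ is assumed. Under the assumptions $t_{\rm w}/t_{\rm ent}\to 0$, so the time above is positive for $n$ large. *)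

theory Defs
  imports "HOL-Probability.Probability"
begin

section \<open>Size-biased law and the associated parameters\<close>

text \<open>A random variable with values in a set of natural numbers enters only through its law, a
  \<^typ>\<open>nat pmf\<close>. The function below is a probability mass function whenever \<open>p\<close> has finite positive
  mean; see \<open>pmf_size_biased\<close>.\<close>

definition size_biased :: "nat pmf \<Rightarrow> nat pmf" where
  "size_biased p = embed_pmf (\<lambda>k. real k * pmf p k / measure_pmf.expectation p real)"

definition log_mean :: "nat pmf \<Rightarrow> real" where
  "log_mean p = measure_pmf.expectation (size_biased p) (\<lambda>y. ln (real y))"

definition log_sd :: "nat pmf \<Rightarrow> real" where
  "log_sd p = sqrt (measure_pmf.variance (size_biased p) (\<lambda>y. ln (real y)))"

definition t_ent :: "nat \<Rightarrow> nat pmf \<Rightarrow> real" where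
  "t_ent n p = real n * ln (real n) / (measure_pmf.expectation p real * log_mean p)"

definition t_w :: "nat \<Rightarrow> nat pmf \<Rightarrow> real" where
  "t_w n p = (1 + log_sd p / log_mean p) *
     (real n * sqrt (ln (real n)) / (measure_pmf.expectation p real * sqrt (log_mean p)))"

text \<open>The law of an i.i.d. sequence \<open>(Y s)\<close>, \<open>s \<ge> 1\<close>, of copies of the size-biased variable.\<close>

definition iid_size_biased :: "nat pmf \<Rightarrow> (nat \<Rightarrow> nat) measure" where
  "iid_size_biased p = (\<Pi>\<^sub>M s\<in>{1..}. measure_pmf (size_biased p))"

definition std_normal_cdf :: "real \<Rightarrow> real" where
  "std_normal_cdf = cdf std_normal_distribution"

definition scenario1 :: "(nat \<Rightarrow> nat pmf) \<Rightarrow> bool" where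
  "scenario1 p \<longleftrightarrow>
     (\<lambda>n. log_mean (p n) / ln (real n)) \<longlonglongrightarrow> 0 \<and>
     (\<forall>n\<ge>2. log_sd (p n) = 0)"

text \<open>A law on \<open>{2..n}\<close> is degenerate for \<open>n = 2\<close> (lemma \<open>log_sd_2\<close>), so the requirement that the
  standard deviation be nonzero is only satisfiable, and only imposed, for \<open>n \<ge> 3\<close>.\<close>

definition scenario2 :: "(nat \<Rightarrow> nat pmf) \<Rightarrow> bool" where
  "scenario2 p \<longleftrightarrow>
     (\<lambda>n. log_mean (p n) / ln (real n)) \<longlonglongrightarrow> 0 \<and>
     (\<lambda>n. (log_sd (p n))\<^sup>2 / (log_mean (p n) * ln (real n))) \<longlonglongrightarrow> 0 \<and>
     (\<forall>n\<ge>3. log_sd (p n) \<noteq> 0) \<and>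
     (\<forall>b::real.
        (\<lambda>n. measure (iid_size_biased (p n))
           {Y \<in> space (iid_size_biased (p n)).
              sqrt (log_mean (p n) / ln (real n)) *
              (\<Sum>s = 1..nat \<lfloor>ln (real n) / log_mean (p n)\<rfloor>.
                 (ln (real (Y s)) - log_mean (p n)) / log_sd (p n)) > b})
        \<longlonglongrightarrow> std_normal_cdf (- b))"


section \<open>The block average process on \<open>V = {1..n}\<close>\<close>

definition block_average :: "nat set \<Rightarrow> (nat \<Rightarrow> real) \<Rightarrow> nat \<Rightarrow> real" where
  "block_average A \<eta> x = (if x \<in> A then (\<Sum>y\<in>A. \<eta> y) / real (card A) else \<eta> x)"

primrec block_average_process :: "(nat \<Rightarrow> nat set) \<Rightarrow> (nat \<Rightarrow> real) \<Rightarrow> nat \<Rightarrow> nat \<Rightarrow> real" where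
  "block_average_process A \<eta>0 0 = \<eta>0"
| "block_average_process A \<eta>0 (Suc t) = block_average (A (Suc t)) (block_average_process A \<eta>0 t)"

definition dirac_mass :: "nat \<Rightarrow> nat \<Rightarrow> real" where
  "dirac_mass x0 x = (if x = x0 then 1 else 0)"

definition tv_norm :: "nat \<Rightarrow> (nat \<Rightarrow> real) \<Rightarrow> real" where
  "tv_norm n v = (1 / 2) * (\<Sum>x\<in>{1..n}. \<bar>v x\<bar>)"

definition d_TV :: "nat \<Rightarrow> nat \<Rightarrow> (nat \<Rightarrow> nat set) \<Rightarrow> nat \<Rightarrow> real" where
  "d_TV n x0 A t = tv_norm n (\<lambda>x. block_average_process A (dirac_mass x0) t x - 1 / real n)"

text \<open>Joint law of one pair consisting of a block size with law \<open>p\<close> and, given this size \<open>k\<close>, a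
  uniformly random \<open>k\<close>-element subset of \<open>{1..n}\<close>.\<close>

definition block_law :: "nat \<Rightarrow> nat pmf \<Rightarrow> (nat \<times> nat set) pmf" where
  "block_law n p =
     bind_pmf p (\<lambda>k. map_pmf (Pair k) (pmf_of_set {A. A \<subseteq> {1..n} \<and> card A = k}))"

text \<open>\<open>X t\<close> are the block sizes and \<open>A t\<close> the blocks, \<open>t \<ge> 1\<close>, on the probability space \<open>M\<close>.\<close>

definition random_blocks ::
  "'a measure \<Rightarrow> nat \<Rightarrow> nat pmf \<Rightarrow> (nat \<Rightarrow> 'a \<Rightarrow> nat) \<Rightarrow> (nat \<Rightarrow> 'a \<Rightarrow> nat set) \<Rightarrow> bool" where
  "random_blocks M n p X A \<longleftrightarrow>
     prob_space M \<and>
     prob_space.indep_vars M (\<lambda>_. count_space UNIV) (\<lambda>t \<omega>. (X t \<omega>, A t \<omega>)) {1..} \<and>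
     (\<forall>t\<ge>1. distr M (count_space UNIV) (\<lambda>\<omega>. (X t \<omega>, A t \<omega>)) = measure_pmf (block_law n p))"


section \<open>Well-definedness of the size-biased law\<close>

lemma mean_ge_2:
  assumes "set_pmf p \<subseteq> {2..n}"
  shows "measure_pmf.expectation p real \<ge> 2"
proof -
  have fin: "finite (set_pmf p)" using assms finite_subset by blast
  have "measure_pmf.expectation p (\<lambda>_. 2) \<le> measure_pmf.expectation p real"
    by (rule integral_mono_AE)
       (use assms fin in \<open>auto simp: integrable_measure_pmf_finite AE_measure_pmf_iff\<close>)
  then show ?thesis by simp
qed

lemma pmf_size_biased:
  assumes "set_pmf p \<subseteq> {2..n}"
  shows "pmf (size_biased p) k = real k * pmf p k / measure_pmf.expectation p real"
proof -
  define m where "m = measure_pmf.expectation p real"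
  have m: "m \<ge> 2" using mean_ge_2[OF assms] by (simp add: m_def)
  have fin: "finite (set_pmf p)" using assms finite_subset by blast
  have "(\<integral>\<^sup>+k. ennreal (real k * pmf p k / m) \<partial>count_space UNIV) =
        (\<integral>\<^sup>+k. ennreal (pmf p k) * ennreal (real k / m) \<partial>count_space UNIV)"
    using m by (intro nn_integral_cong) (simp add: ennreal_mult[symmetric] mult.commute)
  also have "\<dots> = (\<integral>\<^sup>+k. ennreal (real k / m) \<partial>measure_pmf p)"
    by (rule nn_integral_measure_pmf[symmetric])
  also have "\<dots> = ennreal (measure_pmf.expectation p (\<lambda>k. real k / m))"
    using m fin by (intro nn_integral_eq_integral integrable_measure_pmf_finite) auto
  also have "\<dots> = 1" using m by (simp add: m_def[symmetric])
  finally have "(\<integral>\<^sup>+k. ennreal (real k * pmf p k / m) \<partial>count_space UNIV) = 1" .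
  then show ?thesis
    unfolding size_biased_def m_def[symmetric] using m by (subst pmf_embed_pmf) auto
qed

lemma log_mean_eq:
  assumes "set_pmf p \<subseteq> {2..n}"
  shows "log_mean p =
    measure_pmf.expectation p (\<lambda>k. real k * ln (real k)) / measure_pmf.expectation p real"
proof -
  have "set_pmf (size_biased p) \<subseteq> {2..n}"
    using assms by (auto simp: set_pmf_eq pmf_size_biased[OF assms])
  then have "log_mean p = (\<Sum>k\<in>{2..n}. ln (real k) * pmf (size_biased p) k)"
    unfolding log_mean_def by (intro integral_measure_pmf_real) auto
  also have "\<dots> = (\<Sum>k\<in>{2..n}. real k * ln (real k) * pmf p k) / measure_pmf.expectation p real"
    by (simp add: pmf_size_biased[OF assms] sum_divide_distrib mult_ac)
  also have "(\<Sum>k\<in>{2..n}. real k * ln (real k) * pmf p k) =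
      measure_pmf.expectation p (\<lambda>k. real k * ln (real k))"
    using assms by (intro integral_measure_pmf_real[symmetric]) auto
  finally show ?thesis .
qed

lemma log_sd_2:
  assumes "set_pmf p \<subseteq> {2..2}"
  shows "log_sd p = 0"
proof -
  have "set_pmf (size_biased p) \<subseteq> {2}"
    using assms by (auto simp: set_pmf_eq pmf_size_biased[OF assms])
  then have "size_biased p = return_pmf 2"
    by (simp add: set_pmf_subset_singleton)
  then show ?thesis by (simp add: log_sd_def)
qed

end

theory Submission
  imports Defs
begin

text \<open>Follow the unit mass started at \<open>x0\<close> as a collection of chunks: a block \<open>A\<close> splits each chunk that it meets into
  \<open>card A\<close> equal pieces, one per site of \<open>A\<close>. Let \<open>G\<close> be the total mass of the chunks of weight at least of order
  \<open>1 / n\<close>. These chunks sit on few sites, so \<open>d_TV\<close> is at least \<open>G\<close> up to a small error. Conversely, the light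
  chunks have bounded \<open>n\<close>-normalised second moment: the off-diagonal part of the squared mass has expectation
  at most \<open>1 / n\<close>, since two walkers in the same environment relax to the uniform law. A few further blocks then
  flatten the light part in mean square, so that \<open>d_TV\<close> is at most \<open>G\<close> at a slightly earlier time.

  \<open>G\<close> is concentrated: a martingale argument bounds its variance by the sum of the expected squared masses met by
  the successive blocks, after a burn-in during which the mass spreads over many sites. Its mean is the probability that a
  compound binomial sum of logarithms of size-biased block sizes stays below \<open>ln n\<close>. The binomial number of terms
  and the logarithms contribute two independent Gaussian fluctuations with variances in ratio \<open>1 : \<rho>\<^sup>2\<close>, hence the
  factor \<open>sqrt (1 + \<rho>\<^sup>2)\<close>. Since \<open>\<rho>\<close> need not converge, limits are taken at moving points, by passing to
  subsequences.\<close>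

section \<open>Uniformly random subsets\<close>

text \<open>The mass at one site mixes pieces with many histories and has no product structure.
  Chunks are never merged: the weight of a chunk is a product of factors \<open>1 / card A\<close>
  over the blocks that met it, and a chunk chosen with probability equal to its weight is a random
  walker whose logarithmic loss is a sum of i.i.d. steps. The price is the coincidence of chunks at
  a site, which is what the off-diagonal part of the squared mass counts. A plain second-moment
  bound fails. The expected sum of squared chunk weights is \<open>(1 - a) ^ t\<close>, which around
  the time \<open>t_ent\<close> exceeds \<open>1 / n\<close> by a power of \<open>n\<close>, owing
  to atypically heavy chunks. Hence the cut at weights of order \<open>1 / n\<close>, with the
  off-diagonal part bounded before the cut is made. The assumed limit theorem has a fixed number of
  summands, whereas the walker is hit a binomial number of times and the laws vary with
  \<open>n\<close>. Characteristic functions bridge the two; apart from the smallness of \<mu> and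
  \<sigma>, both scenarios enter only through the limit of powers of \<open>cchar\<close>.\<close>

lemma expectation_bind_finite:
  fixes h :: "'b \<Rightarrow> 'c::{banach, second_countable_topology}"
  assumes "finite (set_pmf p)" "\<And>x. x \<in> set_pmf p \<Longrightarrow> finite (set_pmf (f x))"
  shows "measure_pmf.expectation (bind_pmf p f) h =
    measure_pmf.expectation p (\<lambda>x. measure_pmf.expectation (f x) h)"
  by (subst pmf_expectation_bind[of "set_pmf p"], use assms in \<open>simp_all add: integral_measure_pmf[OF assms(1)]\<close>)

lemma expectation_mono_finite:
  fixes f g :: "'a \<Rightarrow> real"
  assumes "finite (set_pmf p)" "\<And>x. x \<in> set_pmf p \<Longrightarrow> f x \<le> g x"
  shows "measure_pmf.expectation p f \<le> measure_pmf.expectation p g"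
  by (rule integral_mono_AE) (use assms in \<open>auto simp: integrable_measure_pmf_finite AE_measure_pmf_iff\<close>)

lemma expectation_cong:
  assumes "\<And>x. x \<in> set_pmf p \<Longrightarrow> f x = g x"
  shows "measure_pmf.expectation p f = measure_pmf.expectation p g"
  by (rule integral_cong_AE) (use assms in \<open>auto simp: AE_measure_pmf_iff\<close>)

lemma expectation_sum_list:
  fixes f :: "'b \<Rightarrow> 'a \<Rightarrow> real"
  assumes "finite (set_pmf p)"
  shows "measure_pmf.expectation p (\<lambda>x. \<Sum>c\<leftarrow>cs. f c x) = (\<Sum>c\<leftarrow>cs. measure_pmf.expectation p (f c))"
  using assms by (induction cs) (simp_all add: integrable_measure_pmf_finite)

lemma card_subsets_containing:
  assumes "finite V" "T \<subseteq> V" "card T \<le> k"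
  shows "card {A. T \<subseteq> A \<and> A \<subseteq> V \<and> card A = k} = (card V - card T) choose (k - card T)"
proof -
  have finT: "finite T" using assms finite_subset by blast
  have "bij_betw (\<lambda>B. B \<union> T) {B. B \<subseteq> V - T \<and> card B = k - card T} {A. T \<subseteq> A \<and> A \<subseteq> V \<and> card A = k}"
  proof (rule bij_betw_byWitness[where f' = "\<lambda>A. A - T"])
    show "(\<lambda>B. B \<union> T) ` {B. B \<subseteq> V - T \<and> card B = k - card T} \<subseteq> {A. T \<subseteq> A \<and> A \<subseteq> V \<and> card A = k}"
    proof safe
      fix B assume B: "B \<subseteq> V - T" "card B = k - card T"
      then have "finite B" using assms(1) finite_subset by blast
      then show "card (B \<union> T) = k" using B finT assms(3) by (subst card_Un_disjoint) auto
    qed (use assms in auto)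
    show "(\<lambda>A. A - T) ` {A. T \<subseteq> A \<and> A \<subseteq> V \<and> card A = k} \<subseteq> {B. B \<subseteq> V - T \<and> card B = k - card T}"
      using finT by (auto simp: card_Diff_subset)
  qed auto
  then have "card {A. T \<subseteq> A \<and> A \<subseteq> V \<and> card A = k} = card {B. B \<subseteq> V - T \<and> card B = k - card T}"
    by (rule bij_betw_same_card[symmetric])
  also have "\<dots> = (card V - card T) choose (k - card T)"
    using assms finT by (subst n_subsets) (auto simp: card_Diff_subset)
  finally show ?thesis .
qed

definition ksubsets :: "nat \<Rightarrow> nat \<Rightarrow> nat set set" where
  "ksubsets n k = {A. A \<subseteq> {1..n} \<and> card A = k}"

lemma mem_ksubsets: "A \<in> ksubsets n k \<longleftrightarrow> A \<subseteq> {1..n} \<and> card A = k"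
  by (simp add: ksubsets_def)

lemma finite_ksubsets: "finite (ksubsets n k)"
  unfolding ksubsets_def by (rule finite_subset[of _ "Pow {1..n}"]) auto

lemma card_ksubsets: "card (ksubsets n k) = n choose k"
  unfolding ksubsets_def by (subst n_subsets) auto

lemma ksubsets_nonempty: "k \<le> n \<Longrightarrow> ksubsets n k \<noteq> {}"
  using card_ksubsets[of n k] by (metis binomial_eq_0_iff card.empty linorder_not_less)

lemma expectation_ksubset:
  fixes f :: "nat set \<Rightarrow> real"
  assumes "k \<le> n"
  shows "measure_pmf.expectation (pmf_of_set (ksubsets n k)) f = sum f (ksubsets n k) / real (n choose k)"
  using integral_pmf_of_set[OF ksubsets_nonempty[OF assms] finite_ksubsets] card_ksubsets by simp

lemma prob_mem_ksubset:
  assumes "1 \<le> k" "k \<le> n" "x \<in> {1..n}"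
  shows "measure_pmf.expectation (pmf_of_set (ksubsets n k)) (\<lambda>A. of_bool (x \<in> A)) = real k / real n"
proof -
  have "(\<Sum>A\<in>ksubsets n k. of_bool (x \<in> A)) = real (card {A. {x} \<subseteq> A \<and> A \<subseteq> {1..n} \<and> card A = k})"
    by (simp add: finite_ksubsets ksubsets_def Int_def conj_ac)
  also have "\<dots> = real ((n - 1) choose (k - 1))"
    using assms by (subst card_subsets_containing) auto
  finally have *: "(\<Sum>A\<in>ksubsets n k. of_bool (x \<in> A)) = real ((n - 1) choose (k - 1))" .
  have "real k * real (n choose k) = real n * real ((n - 1) choose (k - 1))"
    using times_binomial_minus1_eq[of k n] assms by (metis One_nat_def Suc_le_eq of_nat_mult)
  moreover have "real (n choose k) > 0" using assms by simp
  ultimately show ?thesis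
    using assms(1,2) by (subst expectation_ksubset[OF assms(2)], subst *) (simp add: field_simps)
qed

lemma prob_mem2_ksubset:
  assumes "2 \<le> k" "k \<le> n" "x \<in> {1..n}" "y \<in> {1..n}" "x \<noteq> y"
  shows "measure_pmf.expectation (pmf_of_set (ksubsets n k)) (\<lambda>A. of_bool (x \<in> A \<and> y \<in> A)) =
    real k * (real k - 1) / (real n * (real n - 1))"
proof -
  have "(\<Sum>A\<in>ksubsets n k. of_bool (x \<in> A \<and> y \<in> A)) = real (card {A. {x,y} \<subseteq> A \<and> A \<subseteq> {1..n} \<and> card A = k})"
    by (simp add: finite_ksubsets ksubsets_def Int_def conj_ac)
  also have "\<dots> = real ((n - 2) choose (k - 2))"
    using assms by (subst card_subsets_containing) (auto simp: numeral_2_eq_2)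
  finally have *: "(\<Sum>A\<in>ksubsets n k. of_bool (x \<in> A \<and> y \<in> A)) = real ((n - 2) choose (k - 2))" .
  have 1: "real k * real (n choose k) = real n * real ((n - 1) choose (k - 1))"
    using times_binomial_minus1_eq[of k n] assms by (metis One_nat_def Suc_le_eq less_trans of_nat_mult one_less_numeral_iff numeral_2_eq_2 zero_less_Suc)
  have "(k - 1) * ((n - 1) choose (k - 1)) = (n - 1) * ((n - 1 - 1) choose (k - 1 - 1))"
    using assms by (intro times_binomial_minus1_eq) auto
  then have "real (k - 1) * real ((n - 1) choose (k - 1)) = real (n - 1) * real ((n - 2) choose (k - 2))"
    by (metis diff_diff_left of_nat_mult one_add_one)
  then have 2: "(real k - 1) * real ((n - 1) choose (k - 1)) = (real n - 1) * real ((n - 2) choose (k - 2))"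
    using assms by (simp add: of_nat_diff)
  have "real k * (real k - 1) * real (n choose k) = (real k * real (n choose k)) * (real k - 1)" by simp
  also have "\<dots> = real n * ((real k - 1) * real ((n - 1) choose (k - 1)))" unfolding 1 by simp
  also have "\<dots> = real n * (real n - 1) * real ((n - 2) choose (k - 2))" unfolding 2 by simp
  finally have 3: "real k * (real k - 1) * real (n choose k) = real n * (real n - 1) * real ((n - 2) choose (k - 2))" .
  have "real (n choose k) > 0" "real n * (real n - 1) > 0" using assms by auto
  then have "real ((n - 2) choose (k - 2)) / real (n choose k) = real k * (real k - 1) / (real n * (real n - 1))"
    using 3 by (metis frac_eq_eq less_irrefl mult.commute)
  then show ?thesis
    by (subst expectation_ksubset[OF assms(2)], subst *)
qed

lemma expectation_sum_ksubset:
  assumes "1 \<le> k" "k \<le> n"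
  shows "measure_pmf.expectation (pmf_of_set (ksubsets n k)) (\<lambda>A. \<Sum>x\<in>A. v x) =
    real k / real n * (\<Sum>x\<in>{1..n}. v x)"
proof -
  let ?U = "pmf_of_set (ksubsets n k)"
  have fin: "finite (set_pmf ?U)" and sup: "set_pmf ?U = ksubsets n k"
    using ksubsets_nonempty[OF assms(2)] finite_ksubsets by auto
  have "measure_pmf.expectation ?U (\<lambda>A. \<Sum>x\<in>A. v x) =
    measure_pmf.expectation ?U (\<lambda>A. \<Sum>x\<in>{1..n}. v x * of_bool (x \<in> A))"
  proof (rule expectation_cong)
    fix A assume "A \<in> set_pmf ?U"
    then have "A \<subseteq> {1..n}" unfolding sup by (simp add: mem_ksubsets)
    then show "(\<Sum>x\<in>A. v x) = (\<Sum>x\<in>{1..n}. v x * of_bool (x \<in> A))"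
      by (intro sum.mono_neutral_cong_left) auto
  qed
  also have "\<dots> = (\<Sum>x\<in>{1..n}. v x * measure_pmf.expectation ?U (\<lambda>A. of_bool (x \<in> A)))"
    using fin by (subst Bochner_Integration.integral_sum) (auto simp: integrable_measure_pmf_finite)
  also have "\<dots> = (\<Sum>x\<in>{1..n}. v x * (real k / real n))"
    using prob_mem_ksubset[OF assms] by simp
  also have "\<dots> = real k / real n * (\<Sum>x\<in>{1..n}. v x)"
    by (simp add: sum_distrib_left sum_distrib_right mult.commute)
  finally show ?thesis .
qed

lemma expectation_square_sum_ksubset:
  fixes v :: "nat \<Rightarrow> real"
  assumes "2 \<le> k" "k \<le> n"
  shows "measure_pmf.expectation (pmf_of_set (ksubsets n k)) (\<lambda>A. (\<Sum>x\<in>A. v x)\<^sup>2) =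
    real k / real n * (\<Sum>x\<in>{1..n}. (v x)\<^sup>2) +
    real k * (real k - 1) / (real n * (real n - 1)) * ((\<Sum>x\<in>{1..n}. v x)\<^sup>2 - (\<Sum>x\<in>{1..n}. (v x)\<^sup>2))"
proof -
  let ?U = "pmf_of_set (ksubsets n k)" and ?r = "real k * (real k - 1) / (real n * (real n - 1))"
  have fin: "finite (set_pmf ?U)" and sup: "set_pmf ?U = ksubsets n k"
    using ksubsets_nonempty[OF assms(2)] finite_ksubsets by auto
  have pair: "measure_pmf.expectation ?U (\<lambda>A. of_bool (x \<in> A \<and> y \<in> A)) =
      (if x = y then real k / real n else ?r)" if "x \<in> {1..n}" "y \<in> {1..n}" for x y
    using prob_mem_ksubset[of k n x] prob_mem2_ksubset[of k n x y] that assms by auto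
  have "measure_pmf.expectation ?U (\<lambda>A. (\<Sum>x\<in>A. v x)\<^sup>2) =
    measure_pmf.expectation ?U (\<lambda>A. \<Sum>x\<in>{1..n}. \<Sum>y\<in>{1..n}. v x * v y * of_bool (x \<in> A \<and> y \<in> A))"
  proof (rule expectation_cong)
    fix A assume "A \<in> set_pmf ?U"
    then have "A \<subseteq> {1..n}" unfolding sup by (simp add: mem_ksubsets)
    then have "(\<Sum>x\<in>A. v x) = (\<Sum>x\<in>{1..n}. v x * of_bool (x \<in> A))"
      by (intro sum.mono_neutral_cong_left) auto
    then show "(\<Sum>x\<in>A. v x)\<^sup>2 = (\<Sum>x\<in>{1..n}. \<Sum>y\<in>{1..n}. v x * v y * of_bool (x \<in> A \<and> y \<in> A))"
      by (simp only: power2_eq_square sum_product of_bool_conj mult_ac)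
  qed
  also have "\<dots> = (\<Sum>x\<in>{1..n}. \<Sum>y\<in>{1..n}. v x * v y * measure_pmf.expectation ?U (\<lambda>A. of_bool (x \<in> A \<and> y \<in> A)))"
    using fin by (simp add: Bochner_Integration.integral_sum integrable_measure_pmf_finite del: sum_mult_of_bool_eq)
  also have "\<dots> = (\<Sum>x\<in>{1..n}. \<Sum>y\<in>{1..n}. ?r * (v x * v y) + (if x = y then (real k / real n - ?r) * (v x * v y) else 0))"
    by (intro sum.cong refl, subst pair) (auto simp: algebra_simps)
  also have "\<dots> = ?r * (\<Sum>x\<in>{1..n}. v x)\<^sup>2 + (real k / real n - ?r) * (\<Sum>x\<in>{1..n}. (v x)\<^sup>2)"
  proof -
    have "(\<Sum>x\<in>{1..n}. \<Sum>y\<in>{1..n}. r * (v x * v y) + (if x = y then s * (v x * v y) else 0)) =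
      r * (\<Sum>x\<in>{1..n}. v x)\<^sup>2 + s * (\<Sum>x\<in>{1..n}. (v x)\<^sup>2)" for r s
    proof -
      have "r * (\<Sum>x\<in>{1..n}. v x)\<^sup>2 = (\<Sum>x\<in>{1..n}. \<Sum>y\<in>{1..n}. r * (v x * v y))"
        unfolding power2_eq_square sum_product by (simp only: sum_distrib_left)
      then show ?thesis by (simp add: sum.distrib power2_eq_square sum_distrib_left)
    qed
    then show ?thesis .
  qed
  finally show ?thesis by (simp add: algebra_simps)
qed

text \<open>The second marginal of \<open>block_law\<close>. The process depends on the blocks
  alone, and each size is the cardinality of its block.\<close>

definition block_set_law :: "nat \<Rightarrow> nat pmf \<Rightarrow> nat set pmf" where
  "block_set_law n p = bind_pmf p (\<lambda>k. pmf_of_set (ksubsets n k))"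

lemma map_snd_block_law: "map_pmf snd (block_law n p) = block_set_law n p"
  by (simp add: block_law_def block_set_law_def ksubsets_def map_bind_pmf pmf.map_comp o_def)

section \<open>Moments of functionals of a single random block\<close>

locale block_sizes =
  fixes n :: nat and p :: "nat pmf"
  assumes n: "n \<ge> 2" and p: "set_pmf p \<subseteq> {2..n}"
begin

abbreviation mean :: real where "mean \<equiv> measure_pmf.expectation p real"
text \<open>\<open>q\<close> is the probability that a block meets a given site; \<open>1 - a\<close> is the mean decay of the sum of squared chunk
  weights, and \<open>1 - b\<close> that of the squared norm of a mean-zero vector.\<close>

definition q :: real where "q = mean / real n"
definition a :: real where "a = (mean - 1) / real n"
definition b :: real where "b = (mean - 1) / (real n - 1)"

lemma finite_sizes: "finite (set_pmf p)"
  using p finite_subset by blast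

lemma size_bounds: "k \<in> set_pmf p \<Longrightarrow> 2 \<le> k \<and> k \<le> n"
  using p by auto

lemma integrable_p [simp]: "integrable (measure_pmf p) (f :: nat \<Rightarrow> real)"
  by (simp add: integrable_measure_pmf_finite finite_sizes)

lemma set_block_set_law: "set_pmf (block_set_law n p) \<subseteq> {A. A \<subseteq> {1..n} \<and> 2 \<le> card A}"
proof -
  have "set_pmf (pmf_of_set (ksubsets n k)) = ksubsets n k" if "k \<in> set_pmf p" for k
    using ksubsets_nonempty[of k n] finite_ksubsets[of n k] size_bounds[OF that] by auto
  then show ?thesis unfolding block_set_law_def set_bind_pmf using size_bounds mem_ksubsets by fastforce
qed

lemma finite_block_set_law: "finite (set_pmf (block_set_law n p))"
  by (rule finite_subset[OF set_block_set_law], rule finite_subset[of _ "Pow {1..n}"]) auto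

lemma block_setD:
  assumes "A \<in> set_pmf (block_set_law n p)"
  shows "A \<subseteq> {1..n}" "finite A" "card A \<ge> 2" "A \<noteq> {}"
  using assms set_block_set_law finite_subset[of A "{1..n}"] by auto

lemma integrable_block_set [simp]: "integrable (measure_pmf (block_set_law n p)) (f :: nat set \<Rightarrow> real)"
  by (simp add: integrable_measure_pmf_finite finite_block_set_law)

lemma expectation_block_set:
  fixes f :: "nat set \<Rightarrow> real"
  shows "measure_pmf.expectation (block_set_law n p) f =
    measure_pmf.expectation p (\<lambda>k. measure_pmf.expectation (pmf_of_set (ksubsets n k)) f)"
  unfolding block_set_law_def using finite_sizes
proof (rule expectation_bind_finite)
  fix k assume "k \<in> set_pmf p"
  then show "finite (set_pmf (pmf_of_set (ksubsets n k)))"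
    using ksubsets_nonempty[of k n] finite_ksubsets size_bounds by auto
qed

lemma mean_bounds: "2 \<le> mean" "mean \<le> real n"
proof -
  show "2 \<le> mean" using mean_ge_2[OF p] .
  have "mean \<le> measure_pmf.expectation p (\<lambda>_. real n)"
    by (rule expectation_mono_finite[OF finite_sizes]) (use size_bounds in auto)
  then show "mean \<le> real n" by simp
qed

lemma q_bounds: "0 < q" "q \<le> 1" using mean_bounds n by (auto simp: q_def)
lemma a_bounds: "q / 2 \<le> a" "0 < a" "a \<le> b" "b \<le> 1"
  using mean_bounds n by (auto simp: q_def a_def b_def field_simps)

text \<open>A fixed site lies in a block of size \<open>k\<close> with probability
  \<open>k / n\<close>, so the size of a block, given that it contains the site, is size-biased.
  This is how the law of \<open>Y\<close> enters.\<close>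

lemma expectation_block_mem:
  assumes "z \<in> {1..n}"
  shows "measure_pmf.expectation (block_set_law n p) (\<lambda>A. if z \<in> A then f (card A) else c) =
    measure_pmf.expectation p (\<lambda>k. real k / real n * f k + (1 - real k / real n) * c)"
  unfolding expectation_block_set
proof (rule expectation_cong)
  fix k assume k: "k \<in> set_pmf p"
  let ?U = "pmf_of_set (ksubsets n k)"
  have kb: "2 \<le> k" "k \<le> n" using size_bounds[OF k] by auto
  have fin: "finite (set_pmf ?U)" and sup: "set_pmf ?U = ksubsets n k"
    using ksubsets_nonempty[OF kb(2)] finite_ksubsets by auto
  have "measure_pmf.expectation ?U (\<lambda>A. if z \<in> A then f (card A) else c) =
    measure_pmf.expectation ?U (\<lambda>A. (f k - c) * of_bool (z \<in> A) + c)"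
    by (rule expectation_cong) (auto simp: sup mem_ksubsets)
  also have "\<dots> = (f k - c) * (real k / real n) + c"
    using kb assms fin by (simp add: integrable_measure_pmf_finite prob_mem_ksubset)
  finally show "measure_pmf.expectation ?U (\<lambda>A. if z \<in> A then f (card A) else c) =
    real k / real n * f k + (1 - real k / real n) * c" by (simp add: algebra_simps diff_divide_distrib)
qed

text \<open>Averaging replaces the squares on \<open>A\<close> by the square of their sum over
  \<open>A\<close> divided by \<open>k\<close>. Since \<open>v\<close> sums to zero, its
  off-diagonal products sum to minus the squared norm, so the expectation is an exact multiple of
  that norm.\<close>

lemma expectation_block_average_sq:
  fixes v :: "nat \<Rightarrow> real"
  assumes "(\<Sum>x\<in>{1..n}. v x) = 0"
  shows "measure_pmf.expectation (block_set_law n p) (\<lambda>A. \<Sum>x\<in>{1..n}. (block_average A v x)\<^sup>2) =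
    (1 - b) * (\<Sum>x\<in>{1..n}. (v x)\<^sup>2)"
proof -
  let ?N = "\<Sum>x\<in>{1..n}. (v x)\<^sup>2"
  have "measure_pmf.expectation (block_set_law n p) (\<lambda>A. \<Sum>x\<in>{1..n}. (block_average A v x)\<^sup>2) =
    measure_pmf.expectation p (\<lambda>k. ?N - (real k - 1) / (real n - 1) * ?N)"
    unfolding expectation_block_set
  proof (rule expectation_cong)
    fix k assume k: "k \<in> set_pmf p"
    let ?U = "pmf_of_set (ksubsets n k)"
    have kb: "2 \<le> k" "k \<le> n" using size_bounds[OF k] by auto
    have fin: "finite (set_pmf ?U)" and sup: "set_pmf ?U = ksubsets n k"
      using ksubsets_nonempty[OF kb(2)] finite_ksubsets by auto
    have "measure_pmf.expectation ?U (\<lambda>A. \<Sum>x\<in>{1..n}. (block_average A v x)\<^sup>2) =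
      measure_pmf.expectation ?U (\<lambda>A. ?N - (\<Sum>x\<in>A. (v x)\<^sup>2) + (\<Sum>x\<in>A. v x)\<^sup>2 / real k)"
    proof (rule expectation_cong)
      fix A assume "A \<in> set_pmf ?U"
      then have A: "A \<subseteq> {1..n}" "card A = k" unfolding sup by (auto simp: mem_ksubsets)
      then have "finite A" using finite_subset by blast
      have split: "(\<Sum>x\<in>{1..n}. h x) = (\<Sum>x\<in>A. h x) + (\<Sum>x\<in>{1..n} - A. h x)" for h :: "nat \<Rightarrow> real"
        using A by (metis add.commute finite_atLeastAtMost sum.subset_diff)
      have "(\<Sum>x\<in>A. (block_average A v x)\<^sup>2) = real k * ((\<Sum>x\<in>A. v x) / real k)\<^sup>2"
        using A by (simp add: block_average_def)
      also have "\<dots> = (\<Sum>x\<in>A. v x)\<^sup>2 / real k" using kb by (simp add: power2_eq_square field_simps)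
      finally have "(\<Sum>x\<in>A. (block_average A v x)\<^sup>2) = (\<Sum>x\<in>A. v x)\<^sup>2 / real k" .
      moreover have "(\<Sum>x\<in>{1..n} - A. (block_average A v x)\<^sup>2) = ?N - (\<Sum>x\<in>A. (v x)\<^sup>2)"
        by (subst split[of "\<lambda>x. (v x)\<^sup>2"]) (auto simp: block_average_def intro!: sum.cong)
      ultimately show "(\<Sum>x\<in>{1..n}. (block_average A v x)\<^sup>2) = ?N - (\<Sum>x\<in>A. (v x)\<^sup>2) + (\<Sum>x\<in>A. v x)\<^sup>2 / real k"
        by (subst split) simp
    qed
    also have "\<dots> = ?N - real k / real n * ?N +
       (real k / real n * ?N - real k * (real k - 1) / (real n * (real n - 1)) * ?N) / real k"
      using kb assms fin
      by (simp add: integrable_measure_pmf_finite expectation_sum_ksubset expectation_square_sum_ksubset)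
    also have "\<dots> = ?N - (real k - 1) / (real n - 1) * ?N"
    proof -
      have "real n > 1" "real k > 0" using n kb by auto
      then have "N - K / M * N + (K / M * N - K * (K - 1) / (M * (M - 1)) * N) / K = N - (K - 1) / (M - 1) * N"
        if "K > 0" "M > 1" for K M N :: real
        using that by (simp add: divide_simps) (simp add: algebra_simps)
      then show ?thesis using \<open>real n > 1\<close> \<open>real k > 0\<close> by blast
    qed
    finally show "measure_pmf.expectation ?U (\<lambda>A. \<Sum>x\<in>{1..n}. (block_average A v x)\<^sup>2) =
      ?N - (real k - 1) / (real n - 1) * ?N" .
  qed
  also have "\<dots> = (1 - b) * ?N"
    by (simp add: b_def algebra_simps diff_divide_distrib add_divide_distrib)
  finally show ?thesis .
qed

text \<open>For sizes at most \<open>K\<close> the expected square is computed: the diagonal gives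
  the first term and pairs of distinct sites give \<open>K / n\<close>. For larger sizes the mass
  met is at most one, so its square is at most itself, with mean \<open>k / n\<close>. The choice of
  \<open>K\<close> near the square root of \<open>n\<close> is made later.\<close>

lemma expectation_block_mass_sq_le:
  fixes v :: "nat \<Rightarrow> real"
  assumes nonneg: "\<And>x. 0 \<le> v x" and tot: "(\<Sum>x\<in>{1..n}. v x) = 1"
  shows "measure_pmf.expectation (block_set_law n p) (\<lambda>A. (\<Sum>x\<in>A. v x)\<^sup>2) \<le>
    q * ((\<Sum>x\<in>{1..n}. (v x)\<^sup>2) + real K / real n) +
    measure_pmf.expectation p (\<lambda>k. if K < k then real k / real n else 0)"
proof -
  let ?N = "\<Sum>x\<in>{1..n}. (v x)\<^sup>2"
  have N0: "0 \<le> ?N" by (simp add: sum_nonneg)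
  have "measure_pmf.expectation (block_set_law n p) (\<lambda>A. (\<Sum>x\<in>A. v x)\<^sup>2) \<le>
    measure_pmf.expectation p (\<lambda>k. (?N + real K / real n) / real n * real k + (if K < k then real k / real n else 0))"
    unfolding expectation_block_set
  proof (rule expectation_mono_finite[OF finite_sizes])
    fix k assume k: "k \<in> set_pmf p"
    let ?U = "pmf_of_set (ksubsets n k)"
    have kb: "2 \<le> k" "k \<le> n" using size_bounds[OF k] by auto
    have fin: "finite (set_pmf ?U)" and sup: "set_pmf ?U = ksubsets n k"
      using ksubsets_nonempty[OF kb(2)] finite_ksubsets by auto
    show "measure_pmf.expectation ?U (\<lambda>A. (\<Sum>x\<in>A. v x)\<^sup>2) \<le>
      (?N + real K / real n) / real n * real k + (if K < k then real k / real n else 0)"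
    proof (cases "K < k")
      case True
      have "measure_pmf.expectation ?U (\<lambda>A. (\<Sum>x\<in>A. v x)\<^sup>2) \<le> measure_pmf.expectation ?U (\<lambda>A. \<Sum>x\<in>A. v x)"
      proof (rule expectation_mono_finite[OF fin])
        fix A assume "A \<in> set_pmf ?U"
        then have "A \<subseteq> {1..n}" unfolding sup by (simp add: mem_ksubsets)
        then have "(\<Sum>x\<in>A. v x) \<le> 1" using sum_mono2[of "{1..n}" A v] nonneg tot by auto
        moreover have "0 \<le> (\<Sum>x\<in>A. v x)" using nonneg by (simp add: sum_nonneg)
        ultimately show "(\<Sum>x\<in>A. v x)\<^sup>2 \<le> (\<Sum>x\<in>A. v x)" by (simp add: power2_eq_square mult_left_le)
      qed
      also have "\<dots> = real k / real n" using kb tot by (subst expectation_sum_ksubset) auto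
      finally show ?thesis using True N0 by (simp add: add_increasing)
    next
      case False
      have "real k * (real k - 1) / (real n * (real n - 1)) * (1 - ?N) \<le> real k * (real k - 1) / (real n * (real n - 1))"
        using kb N0 by (intro mult_left_le) auto
      also have "\<dots> = real k / real n * ((real k - 1) / (real n - 1))" by simp
      also have "\<dots> \<le> real k / real n * (real K / real n)"
      proof (rule mult_left_mono)
        have "(real k - 1) / (real n - 1) \<le> real k / real n"
          using kb n by (simp add: field_simps)
        also have "\<dots> \<le> real K / real n" using False by (simp add: divide_right_mono)
        finally show "(real k - 1) / (real n - 1) \<le> real K / real n" .
      qed auto
      finally show ?thesis using False kb tot
        by (subst expectation_square_sum_ksubset) (auto simp: algebra_simps add_divide_distrib)
    qed
  qed
  also have "\<dots> = q * (?N + real K / real n) + measure_pmf.expectation p (\<lambda>k. if K < k then real k / real n else 0)"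
    by (simp add: q_def)
  finally show ?thesis .
qed

end

section \<open>Chunks of mass\<close>

text \<open>Both sides are sums of \<open>2 * w c * w d\<close> over pairs of distinct positions;
  filtering only drops nonnegative terms.\<close>

lemma sum_list_filter_sq_le:
  fixes w :: "'b \<Rightarrow> real"
  assumes "\<And>c. c \<in> set cs \<Longrightarrow> 0 \<le> w c"
  shows "(\<Sum>c\<leftarrow>cs. if P c then w c else 0)\<^sup>2 - (\<Sum>c\<leftarrow>cs. if P c then (w c)\<^sup>2 else 0) \<le>
    (\<Sum>c\<leftarrow>cs. w c)\<^sup>2 - (\<Sum>c\<leftarrow>cs. (w c)\<^sup>2)"
  using assms
proof (induction cs)
  case (Cons c cs)
  let ?s = "\<Sum>c\<leftarrow>cs. if P c then w c else 0" and ?t = "\<Sum>c\<leftarrow>cs. w c"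
  have "0 \<le> ?s" by (rule sum_list_nonneg) (use Cons.prems in auto)
  have "?s \<le> ?t" by (rule sum_list_mono) (use Cons.prems in auto)
  have "0 \<le> w c" using Cons.prems by simp
  then have "(if P c then 2 * w c * ?s else 0) \<le> 2 * w c * ?t"
    using \<open>0 \<le> ?s\<close> \<open>?s \<le> ?t\<close> by (auto intro!: mult_left_mono mult_nonneg_nonneg)
  moreover have "?s\<^sup>2 - (\<Sum>c\<leftarrow>cs. if P c then (w c)\<^sup>2 else 0) \<le> ?t\<^sup>2 - (\<Sum>c\<leftarrow>cs. (w c)\<^sup>2)"
    by (rule Cons.IH) (use Cons.prems in auto)
  ultimately show ?case by (auto simp: power2_eq_square algebra_simps)
qed simp

lemma sum_sum_list:
  fixes f :: "'a \<Rightarrow> 'b \<Rightarrow> real"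
  shows "(\<Sum>x\<in>S. \<Sum>c\<leftarrow>cs. f x c) = (\<Sum>c\<leftarrow>cs. \<Sum>x\<in>S. f x c)"
  by (induction cs) (simp_all add: sum.distrib)

lemma sum_list_concat_map:
  fixes f :: "'a \<Rightarrow> 'c::comm_monoid_add"
  shows "(\<Sum>x\<leftarrow>concat xss. f x) = (\<Sum>xs\<leftarrow>xss. \<Sum>x\<leftarrow>xs. f x)"
  by (induction xss) simp_all

lemma mult_length_filter:
  fixes u :: real
  shows "u * real (length (filter P cs)) = (\<Sum>c\<leftarrow>cs. if P c then u else 0)"
  by (induction cs) (simp_all add: algebra_simps)

lemma block_average_add: "block_average A (\<lambda>x. f x + g x) x = block_average A f x + block_average A g x"
  by (simp add: block_average_def sum.distrib add_divide_distrib)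

lemma block_average_const: "finite A \<Longrightarrow> block_average A (\<lambda>_. c) x = c"
  by (cases "A = {}") (auto simp: block_average_def)

lemma block_average_nonneg: "(\<And>x. 0 \<le> f x) \<Longrightarrow> 0 \<le> block_average A f x"
  by (simp add: block_average_def sum_nonneg)

lemma sum_block_average:
  assumes "A \<subseteq> V" "finite V"
  shows "(\<Sum>x\<in>V. block_average A f x) = (\<Sum>x\<in>V. f x)"
proof -
  have split: "(\<Sum>x\<in>V. h x) = (\<Sum>x\<in>A. h x) + (\<Sum>x\<in>V - A. h x)" for h :: "nat \<Rightarrow> real"
    using assms by (metis add.commute sum.subset_diff)
  have "(\<Sum>x\<in>A. block_average A f x) = (\<Sum>x\<in>A. f x)"
    using assms finite_subset[of A V] by (cases "A = {}") (auto simp: block_average_def)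
  moreover have "(\<Sum>x\<in>V - A. block_average A f x) = (\<Sum>x\<in>V - A. f x)"
    by (rule sum.cong) (auto simp: block_average_def)
  ultimately show ?thesis by (simp add: split)
qed

text \<open>Lists of blocks are in reverse chronological order: the head is the most recent block.\<close>

primrec mass :: "nat \<Rightarrow> nat set list \<Rightarrow> nat \<Rightarrow> real" where
  "mass x0 [] = dirac_mass x0"
| "mass x0 (A # l) = block_average A (mass x0 l)"

text \<open>Freezes a decomposition of the mass as it was \<open>r\<close> blocks ago and transports
  each part by the \<open>r\<close> latest averagings. Linearity keeps the parts adding up to the
  mass.\<close>

primrec evolve :: "(nat set list \<Rightarrow> nat \<Rightarrow> real) \<Rightarrow> nat \<Rightarrow> nat set list \<Rightarrow> nat \<Rightarrow> real" where
  "evolve f 0 l = f l"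
| "evolve f (Suc r) l = block_average (hd l) (evolve f r (tl l))"

text \<open>A list and not a set, because distinct chunks may share both site and weight.\<close>

primrec chunks :: "nat \<Rightarrow> nat set list \<Rightarrow> (nat \<times> real) list" where
  "chunks x0 [] = [(x0, 1)]"
| "chunks x0 (A # l) = concat (map (\<lambda>(z, w).
     if z \<in> A then map (\<lambda>y. (y, w / real (card A))) (sorted_list_of_set A) else [(z, w)]) (chunks x0 l))"

lemma block_average_process_eq_mass:
  "block_average_process A (dirac_mass x0) t = mass x0 (map A (rev [1..<Suc t]))"
  by (induction t) auto

lemma evolve_mass: "r \<le> length l \<Longrightarrow> evolve (mass x0) r l = mass x0 l"
proof (induction r arbitrary: l)
  case (Suc r)
  then obtain A l' where "l = A # l'" by (cases l) auto
  then show ?case using Suc by simp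
qed simp

lemma evolve_add: "evolve (\<lambda>l x. f l x + g l x) r l x = evolve f r l x + evolve g r l x"
proof (induction r arbitrary: l x)
  case (Suc r)
  then have "evolve (\<lambda>l x. f l x + g l x) r (tl l) = (\<lambda>x. evolve f r (tl l) x + evolve g r (tl l) x)"
    by (intro ext)
  then show ?case by (simp add: block_average_add)
qed simp

lemma sum_chunks_Cons:
  fixes f :: "nat \<Rightarrow> real \<Rightarrow> real"
  assumes "finite A"
  shows "(\<Sum>(z, w)\<leftarrow>chunks x0 (A # l). f z w) =
    (\<Sum>(z, w)\<leftarrow>chunks x0 l. if z \<in> A then \<Sum>y\<in>A. f y (w / real (card A)) else f z w)"
proof -
  have *: "(\<Sum>(z, w)\<leftarrow>(case c of (z, w) \<Rightarrow> if z \<in> A then map (\<lambda>y. (y, w / real (card A))) (sorted_list_of_set A) else [(z, w)]). f z w) =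
    (case c of (z, w) \<Rightarrow> if z \<in> A then \<Sum>y\<in>A. f y (w / real (card A)) else f z w)" for c
    using assms by (auto simp: o_def sum_list_distinct_conv_sum_set split: prod.split)
  show ?thesis
    by (simp add: sum_list_concat_map o_def *)
qed

section \<open>Deterministic estimates along a fixed list of blocks\<close>

locale fragmentation =
  fixes n :: nat and x0 :: nat
  assumes x0: "x0 \<in> {1..n}"
begin

definition valid :: "nat set list \<Rightarrow> bool" where
  "valid l \<longleftrightarrow> (\<forall>A\<in>set l. A \<subseteq> {1..n} \<and> A \<noteq> {})"

lemma valid_simps [simp]: "valid []" "valid (A # l) \<longleftrightarrow> A \<subseteq> {1..n} \<and> A \<noteq> {} \<and> valid l"
  by (auto simp: valid_def)

lemma valid_drop: "valid l \<Longrightarrow> valid (drop r l)"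
  by (auto simp: valid_def dest: in_set_dropD)

lemma n_pos: "0 < n" using x0 by auto

abbreviation csum :: "(nat \<Rightarrow> real \<Rightarrow> real) \<Rightarrow> nat set list \<Rightarrow> real" where
  "csum f l \<equiv> (\<Sum>(z, w)\<leftarrow>chunks x0 l. f z w)"

lemma csum_mono:
  assumes "\<And>z w. (z, w) \<in> set (chunks x0 l) \<Longrightarrow> f z w \<le> g z w"
  shows "csum f l \<le> csum g l"
  by (rule sum_list_mono) (use assms in auto)

lemma csum_cong:
  assumes "\<And>z w. (z, w) \<in> set (chunks x0 l) \<Longrightarrow> f z w = g z w"
  shows "csum f l = csum g l"
  by (rule arg_cong[where f = sum_list], rule map_cong) (use assms in auto)

lemma chunk_bounds:
  assumes "valid l" "(z, w) \<in> set (chunks x0 l)"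
  shows "z \<in> {1..n}" "0 < w"
proof -
  have "z \<in> {1..n} \<and> 0 < w"
    using assms
  proof (induction l arbitrary: z w)
    case Nil
    then show ?case using x0 by simp
  next
    case (Cons A l)
    then have A: "finite A" "A \<subseteq> {1..n}" "0 < card A"
      using finite_subset[of A "{1..n}"] by (auto simp: card_gt_0_iff)
    obtain z' w' where zw: "(z', w') \<in> set (chunks x0 l)"
      "(z, w) \<in> set (if z' \<in> A then map (\<lambda>y. (y, w' / real (card A))) (sorted_list_of_set A) else [(z', w')])"
      using Cons.prems by auto
    show ?case using Cons.IH[OF _ zw(1)] Cons.prems zw(2) A by (auto split: if_splits)
  qed
  then show "z \<in> {1..n}" "0 < w" by auto
qed

lemma csum_weight:
  assumes "valid l"
  shows "csum (\<lambda>z w. w) l = 1"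
  using assms
proof (induction l)
  case (Cons A l)
  then have "finite A" "card A \<noteq> 0" using finite_subset[of A "{1..n}"] by auto
  moreover from this have "(\<Sum>y\<in>A. w / real (card A)) = w" for w by simp
  ultimately have "csum (\<lambda>z w. w) (A # l) = csum (\<lambda>z w. w) l"
    by (subst sum_chunks_Cons) (simp_all add: if_distrib cong: if_cong)
  then show ?case using Cons by simp
qed simp

text \<open>Splitting every chunk over \<open>A\<close> and averaging over \<open>A\<close> agree
  once the chunks at each site are added up, so the chunks refine the mass.\<close>

lemma mass_eq_csum:
  assumes "valid l"
  shows "mass x0 l x = csum (\<lambda>z w. if z = x then w else 0) l"
  using assms
proof (induction l arbitrary: x)
  case (Cons A l)
  then have fin: "finite A" "card A \<noteq> 0" using finite_subset[of A "{1..n}"] by auto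
  have IH: "mass x0 l y = csum (\<lambda>z w. if z = y then w else 0) l" for y using Cons by simp
  have "(\<Sum>y\<in>A. mass x0 l y) = csum (\<lambda>z w. \<Sum>y\<in>A. if z = y then w else 0) l"
    unfolding IH by (simp add: sum_sum_list case_prod_beta')
  also have "\<dots> = csum (\<lambda>z w. if z \<in> A then w else 0) l"
    using fin by (intro csum_cong) (simp add: sum.delta')
  finally have "(\<Sum>y\<in>A. mass x0 l y) / real (card A) = csum (\<lambda>z w. if z \<in> A then w else 0) l / real (card A)"
    by simp
  also have "\<dots> = csum (\<lambda>z w. (if z \<in> A then w else 0) / real (card A)) l"
    by (simp add: divide_inverse case_prod_beta' flip: sum_list_mult_const)
  finally have *: "(\<Sum>y\<in>A. mass x0 l y) / real (card A) = csum (\<lambda>z w. (if z \<in> A then w else 0) / real (card A)) l" .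
  show ?case
    unfolding sum_chunks_Cons[OF fin(1)] mass.simps block_average_def * IH
    using fin by (auto intro!: csum_cong simp: sum.delta)
qed (simp add: dirac_mass_def)

lemma sum_csum_pos:
  assumes "valid l"
  shows "(\<Sum>x\<in>{1..n}. csum (\<lambda>z w. if z = x \<and> P w then f w else 0) l) = csum (\<lambda>z w. if P w then f w else 0) l"
proof -
  have "(\<Sum>x\<in>{1..n}. csum (\<lambda>z w. if z = x \<and> P w then f w else 0) l) =
    csum (\<lambda>z w. \<Sum>x\<in>{1..n}. if z = x \<and> P w then f w else 0) l"
    by (simp add: sum_sum_list case_prod_beta')
  also have "\<dots> = csum (\<lambda>z w. if P w then f w else 0) l"
  proof (rule csum_cong)
    fix z w assume "(z, w) \<in> set (chunks x0 l)"
    then have "z \<in> {1..n}" using chunk_bounds assms by blast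
    then show "(\<Sum>x\<in>{1..n}. if z = x \<and> P w then f w else 0) = (if P w then f w else 0)"
      by (cases "P w") (auto simp: sum.delta')
  qed
  finally show ?thesis .
qed

lemma sum_mass:
  assumes "valid l"
  shows "(\<Sum>x\<in>{1..n}. mass x0 l x) = 1"
  using sum_csum_pos[OF assms, of "\<lambda>_. True" "\<lambda>w. w"] mass_eq_csum[OF assms] csum_weight[OF assms] by simp

lemma mass_nonneg: "0 \<le> mass x0 l x"
  by (induction l arbitrary: x) (auto simp: dirac_mass_def intro: block_average_nonneg)

section \<open>Heavy and light parts of the mass\<close>

definition heavy :: "real \<Rightarrow> nat set list \<Rightarrow> real" where
  "heavy u l = csum (\<lambda>z w. if u \<le> w then w else 0) l"

definition heavy_mass :: "real \<Rightarrow> nat set list \<Rightarrow> nat \<Rightarrow> real" where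
  "heavy_mass u l x = csum (\<lambda>z w. if z = x \<and> u \<le> w then w else 0) l"

definition light_mass :: "real \<Rightarrow> nat set list \<Rightarrow> nat \<Rightarrow> real" where
  "light_mass u l x = csum (\<lambda>z w. if z = x \<and> w < u then w else 0) l"

lemma csum_add: "csum f l + csum g l = csum (\<lambda>z w. f z w + g z w) l"
  by (simp add: sum_list_addf case_prod_beta')

lemma mass_split:
  assumes "valid l"
  shows "mass x0 l x = light_mass u l x + heavy_mass u l x"
  unfolding mass_eq_csum[OF assms] light_mass_def heavy_mass_def csum_add
  by (rule csum_cong) auto

lemma sum_heavy_mass: "valid l \<Longrightarrow> (\<Sum>x\<in>{1..n}. heavy_mass u l x) = heavy u l"
  unfolding heavy_mass_def heavy_def by (rule sum_csum_pos)

lemma sum_light_mass: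
  assumes "valid l"
  shows "(\<Sum>x\<in>{1..n}. light_mass u l x) = 1 - heavy u l"
  using sum_mass[OF assms] sum_heavy_mass[OF assms, of u] mass_split[OF assms, of _ u] by (simp add: sum.distrib)

lemma heavy_mass_nonneg: "valid l \<Longrightarrow> 0 \<le> heavy_mass u l x"
  unfolding heavy_mass_def by (rule sum_list_nonneg) (auto dest: chunk_bounds less_imp_le)

lemma heavy_nonneg: "valid l \<Longrightarrow> 0 \<le> heavy u l"
  unfolding heavy_def by (rule sum_list_nonneg) (auto dest: chunk_bounds less_imp_le)

text \<open>The weights sum to one, so there are at most \<open>1 / u\<close> chunks of weight at least \<open>u\<close>, and the heavy mass
  is carried by that many sites.\<close>

lemma heavy_le_tv:
  assumes l: "valid l" and u: "0 < u"
  shows "heavy u l \<le> tv_norm n (\<lambda>x. mass x0 l x - 1 / real n) + 1 / (u * real n)"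
proof -
  define S where "S = fst ` {c \<in> set (chunks x0 l). u \<le> snd c}"
  have S: "S \<subseteq> {1..n}" using chunk_bounds[OF l] by (auto simp: S_def)
  then have finS: "finite S" using finite_subset by blast
  have "u * real (card S) \<le> u * real (length (filter (\<lambda>c. u \<le> snd c) (chunks x0 l)))"
  proof -
    have "card S \<le> card {c \<in> set (chunks x0 l). u \<le> snd c}" unfolding S_def by (rule card_image_le) simp
    also have "\<dots> \<le> length (filter (\<lambda>c. u \<le> snd c) (chunks x0 l))"
      by (metis card_length set_filter)
    finally show ?thesis using u by simp
  qed
  also have "\<dots> = csum (\<lambda>z w. if u \<le> w then u else 0) l"
    by (simp add: mult_length_filter case_prod_beta')
  also have "\<dots> \<le> csum (\<lambda>z w. w) l" using chunk_bounds[OF l] by (intro csum_mono) (auto intro: less_imp_le)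
  finally have card: "real (card S) \<le> 1 / u" using u csum_weight[OF l] by (simp add: field_simps)
  have "heavy u l = (\<Sum>x\<in>{1..n}. heavy_mass u l x)" using sum_heavy_mass[OF l] by simp
  also have "\<dots> = (\<Sum>x\<in>S. heavy_mass u l x)"
  proof (rule sum.mono_neutral_right)
    show "\<forall>x\<in>{1..n} - S. heavy_mass u l x = 0"
    proof
      fix x assume "x \<in> {1..n} - S"
      then have "heavy_mass u l x = csum (\<lambda>z w. 0) l"
        unfolding heavy_mass_def by (intro csum_cong) (force simp: S_def)
      then show "heavy_mass u l x = 0" by (simp add: case_prod_beta')
    qed
  qed (use S in auto)
  also have "\<dots> \<le> (\<Sum>x\<in>S. mass x0 l x)"
  proof (rule sum_mono)
    fix x
    have "0 \<le> light_mass u l x" unfolding light_mass_def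
      by (rule sum_list_nonneg) (auto dest!: chunk_bounds(2)[OF l])
    then show "heavy_mass u l x \<le> mass x0 l x" using mass_split[OF l, of x u] by simp
  qed
  also have "\<dots> = (\<Sum>x\<in>S. mass x0 l x - 1 / real n) + real (card S) / real n"
    by (simp add: sum_subtractf)
  also have "real (card S) / real n \<le> 1 / (u * real n)"
    using card n_pos u by (simp add: field_simps)
  also have "(\<Sum>x\<in>S. mass x0 l x - 1 / real n) \<le> tv_norm n (\<lambda>x. mass x0 l x - 1 / real n)"
  proof -
    let ?v = "\<lambda>x. mass x0 l x - 1 / real n"
    \<comment> \<open>The deviations sum to zero, so the excess on \<open>S\<close> equals the
      deficit off \<open>S\<close>, and each is at most half of the absolute sum.\<close>
    have "(\<Sum>x\<in>{1..n}. ?v x) = 0" using sum_mass[OF l] n_pos by (simp add: sum_subtractf)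
    moreover have split: "(\<Sum>x\<in>{1..n}. h x) = (\<Sum>x\<in>S. h x) + (\<Sum>x\<in>{1..n} - S. h x)" for h :: "nat \<Rightarrow> real"
      using S by (metis add.commute finite_atLeastAtMost sum.subset_diff)
    ultimately have "2 * (\<Sum>x\<in>S. ?v x) = (\<Sum>x\<in>S. ?v x) - (\<Sum>x\<in>{1..n} - S. ?v x)" by simp
    also have "\<dots> \<le> (\<Sum>x\<in>S. \<bar>?v x\<bar>) + (\<Sum>x\<in>{1..n} - S. \<bar>?v x\<bar>)"
      using sum_abs[of ?v S] sum_abs[of ?v "{1..n} - S"] by linarith
    also have "\<dots> = 2 * tv_norm n ?v" using split by (simp add: tv_norm_def)
    finally show ?thesis by simp
  qed
  finally show ?thesis by simp
qed

text \<open>The off-diagonal part of the squared light mass is at most that of the whole mass, which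
  is its square minus the sum of squared chunk weights. On the diagonal each light chunk has
  \<open>w\<^sup>2 \<le> u * w\<close>, and the weights sum to one.\<close>

lemma light_mass_sq_le:
  assumes l: "valid l" and u: "0 \<le> u"
  shows "(\<Sum>x\<in>{1..n}. (light_mass u l x)\<^sup>2) \<le> (\<Sum>x\<in>{1..n}. (mass x0 l x)\<^sup>2) - csum (\<lambda>z w. w\<^sup>2) l + u"
proof -
  have *: "(light_mass u l x)\<^sup>2 \<le> (mass x0 l x)\<^sup>2 - csum (\<lambda>z w. if z = x \<and> True then w\<^sup>2 else 0) l +
    csum (\<lambda>z w. if z = x \<and> w < u then w\<^sup>2 else 0) l" for x
  proof -
    have sq: "csum (\<lambda>z w. (if z = x then w else 0)\<^sup>2) l = csum (\<lambda>z w. if z = x \<and> True then w\<^sup>2 else 0) l"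
      by (rule csum_cong) auto
    have lt: "csum (\<lambda>z w. if w < u then (if z = x then w else 0) else 0) l = light_mass u l x"
      "csum (\<lambda>z w. if w < u then (if z = x then w else 0)\<^sup>2 else 0) l = csum (\<lambda>z w. if z = x \<and> w < u then w\<^sup>2 else 0) l"
      unfolding light_mass_def by (auto intro: csum_cong)
    have "(csum (\<lambda>z w. if w < u then (if z = x then w else 0) else 0) l)\<^sup>2 -
        csum (\<lambda>z w. if w < u then (if z = x then w else 0)\<^sup>2 else 0) l \<le>
      (csum (\<lambda>z w. if z = x then w else 0) l)\<^sup>2 - csum (\<lambda>z w. (if z = x then w else 0)\<^sup>2) l"
      unfolding case_prod_beta' using chunk_bounds[OF l]
      by (intro sum_list_filter_sq_le) (auto intro: less_imp_le)
    then show ?thesis unfolding lt sq mass_eq_csum[OF l, symmetric] by simp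
  qed
  have "(\<Sum>x\<in>{1..n}. (light_mass u l x)\<^sup>2) \<le> (\<Sum>x\<in>{1..n}. (mass x0 l x)\<^sup>2) -
    (\<Sum>x\<in>{1..n}. csum (\<lambda>z w. if z = x \<and> True then w\<^sup>2 else 0) l) +
    (\<Sum>x\<in>{1..n}. csum (\<lambda>z w. if z = x \<and> w < u then w\<^sup>2 else 0) l)"
    using sum_mono[of "{1..n}", OF *] by (simp add: sum.distrib sum_subtractf)
  also have "\<dots> = (\<Sum>x\<in>{1..n}. (mass x0 l x)\<^sup>2) - csum (\<lambda>z w. w\<^sup>2) l + csum (\<lambda>z w. if w < u then w\<^sup>2 else 0) l"
    unfolding sum_csum_pos[OF l] by simp
  also have "csum (\<lambda>z w. if w < u then w\<^sup>2 else 0) l \<le> csum (\<lambda>z w. u * w) l"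
    using chunk_bounds[OF l] u by (intro csum_mono) (force simp: power2_eq_square intro: mult_right_mono mult_nonneg_nonneg)
  also have "csum (\<lambda>z w. u * w) l = u * csum (\<lambda>z w. w) l"
    by (simp add: case_prod_beta' sum_list_const_mult)
  also have "\<dots> = u" using csum_weight[OF l] by simp
  finally show ?thesis by simp
qed

lemma evolve_cong:
  assumes "valid l" "r \<le> length l" "\<And>l x. valid l \<Longrightarrow> f l x = g l x"
  shows "evolve f r l = evolve g r l"
  using assms(1,2)
proof (induction r arbitrary: l)
  case (Suc r)
  then obtain A l' where "l = A # l'" by (cases l) auto
  then show ?case using Suc by simp
qed (use assms(3) in auto)

lemma evolve_nonneg:
  assumes "valid l" "r \<le> length l" "\<And>l x. valid l \<Longrightarrow> 0 \<le> f l x"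
  shows "0 \<le> evolve f r l x"
  using assms(1,2)
proof (induction r arbitrary: l x)
  case (Suc r)
  then obtain A l' where "l = A # l'" by (cases l) auto
  then show ?case using Suc by (auto intro: block_average_nonneg)
qed (use assms(3) in auto)

lemma sum_evolve:
  assumes "valid l" "r \<le> length l"
  shows "(\<Sum>x\<in>{1..n}. evolve f r l x) = (\<Sum>x\<in>{1..n}. f (drop r l) x)"
  using assms
proof (induction r arbitrary: l)
  case (Suc r)
  then obtain A l' where "l = A # l'" by (cases l) auto
  then show ?case using Suc by (simp add: sum_block_average)
qed simp

lemma evolve_const:
  assumes "valid l" "r \<le> length l"
  shows "evolve (\<lambda>l x. c l) r l x = c (drop r l)"
  using assms
proof (induction r arbitrary: l x)
  case (Suc r)
  then obtain A l' where l: "l = A # l'" by (cases l) auto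
  then have "evolve (\<lambda>l x. c l) r l' = (\<lambda>x. c (drop r l'))" using Suc by auto
  moreover have "finite A" using Suc.prems l finite_subset[of A "{1..n}"] by auto
  ultimately show ?case using l by (simp add: block_average_const)
qed simp

text \<open>The uniform part is subtracted so that the result sums to zero, as the mean-square
  contraction under random blocks requires.\<close>

definition light_dev :: "real \<Rightarrow> nat set list \<Rightarrow> nat \<Rightarrow> real" where
  "light_dev u l x = light_mass u l x - (1 - heavy u l) / real n"

lemma sum_light_dev: "valid l \<Longrightarrow> (\<Sum>x\<in>{1..n}. light_dev u l x) = 0"
  using n_pos by (simp add: light_dev_def sum_subtractf sum_light_mass del: One_nat_def)

lemma light_dev_sq_le:
  assumes l: "valid l"
  shows "(\<Sum>x\<in>{1..n}. (light_dev u l x)\<^sup>2) \<le> (\<Sum>x\<in>{1..n}. (light_mass u l x)\<^sup>2)"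
proof -
  let ?m = "1 - heavy u l"
  have "(\<Sum>x\<in>{1..n}. (light_dev u l x)\<^sup>2) =
    (\<Sum>x\<in>{1..n}. (light_mass u l x)\<^sup>2 - 2 * (?m / real n) * light_mass u l x + (?m / real n)\<^sup>2)"
    by (rule sum.cong) (simp_all add: light_dev_def power2_diff)
  also have "\<dots> = (\<Sum>x\<in>{1..n}. (light_mass u l x)\<^sup>2) - 2 * (?m / real n) * ?m + real n * (?m / real n)\<^sup>2"
    by (simp add: sum.distrib sum_subtractf sum_light_mass[OF l] sum_divide_distrib[symmetric] del: One_nat_def flip: sum_distrib_left)
  also have "\<dots> = (\<Sum>x\<in>{1..n}. (light_mass u l x)\<^sup>2) - ?m\<^sup>2 / real n"
    using n_pos by (simp add: power2_eq_square field_simps)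
  also have "\<dots> \<le> (\<Sum>x\<in>{1..n}. (light_mass u l x)\<^sup>2)" by simp
  finally show ?thesis .
qed

text \<open>The mass is split \<open>r\<close> blocks before the end. The heavy part and the uniform
  mass that it lacks contribute at most the heavy total each to the absolute sum, whence the
  coefficient one after halving. The light deviation, flattened by the \<open>r\<close> later
  blocks, is passed to mean square by Cauchy-Schwarz.\<close>

lemma tv_le_heavy:
  assumes l: "valid l" and r: "r \<le> length l"
  shows "tv_norm n (\<lambda>x. mass x0 l x - 1 / real n) \<le>
    heavy u (drop r l) + (1/2) * sqrt (real n * (\<Sum>x\<in>{1..n}. (evolve (light_dev u) r l x)\<^sup>2))"
proof -
  let ?h = "heavy u (drop r l)" and ?e = "evolve (light_dev u) r l" and ?f = "evolve (heavy_mass u) r l"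
  have eq: "mass x0 l x - 1 / real n = ?e x + (?f x - ?h / real n)" for x
  proof -
    have "mass x0 l x = evolve (mass x0) r l x" using evolve_mass[OF r] by simp
    also have "evolve (mass x0) r l = evolve (\<lambda>l x. (light_dev u l x + (1 - heavy u l) / real n) + heavy_mass u l x) r l"
      by (rule evolve_cong[OF l r]) (use mass_split[of _ _ u] in \<open>simp add: light_dev_def\<close>)
    also have "\<dots> x = ?e x + (1 - ?h) / real n + ?f x"
      by (simp only: evolve_add evolve_const[OF l r, of "\<lambda>l. (1 - heavy u l) / real n"])
    finally show ?thesis by (simp add: diff_divide_distrib)
  qed
  have "(\<Sum>x\<in>{1..n}. \<bar>mass x0 l x - 1 / real n\<bar>) \<le> (\<Sum>x\<in>{1..n}. \<bar>?e x\<bar> + (?f x + ?h / real n))"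
  proof (rule sum_mono)
    fix x
    have "0 \<le> ?f x" by (rule evolve_nonneg[OF l r heavy_mass_nonneg])
    moreover have "0 \<le> ?h / real n" using heavy_nonneg[OF valid_drop[OF l]] by simp
    ultimately show "\<bar>mass x0 l x - 1 / real n\<bar> \<le> \<bar>?e x\<bar> + (?f x + ?h / real n)"
      unfolding eq by linarith
  qed
  also have "\<dots> = (\<Sum>x\<in>{1..n}. \<bar>?e x\<bar>) + 2 * ?h"
    using n_pos by (simp add: sum.distrib sum_evolve[OF l r] sum_heavy_mass[OF valid_drop[OF l]] del: One_nat_def)
  also have "(\<Sum>x\<in>{1..n}. \<bar>?e x\<bar>) \<le> sqrt (real n * (\<Sum>x\<in>{1..n}. (?e x)\<^sup>2))"
  proof (rule real_le_rsqrt)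
    show "(\<Sum>x\<in>{1..n}. \<bar>?e x\<bar>)\<^sup>2 \<le> real n * (\<Sum>x\<in>{1..n}. (?e x)\<^sup>2)"
      using Cauchy_Schwarz_ineq_sum[of "\<lambda>_. 1" "\<lambda>x. \<bar>?e x\<bar>" "{1..n}"] by simp
  qed
  finally show ?thesis by (simp add: tv_norm_def)
qed

end

section \<open>Moments under i.i.d. blocks\<close>

primrec blocks_law :: "nat \<Rightarrow> nat pmf \<Rightarrow> nat \<Rightarrow> nat set list pmf" where
  "blocks_law n p 0 = return_pmf []"
| "blocks_law n p (Suc t) = bind_pmf (blocks_law n p t) (\<lambda>l. map_pmf (\<lambda>A. A # l) (block_set_law n p))"

definition log_step_law :: "nat \<Rightarrow> nat pmf \<Rightarrow> real pmf" where
  "log_step_law n p =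
     bind_pmf p (\<lambda>k. map_pmf (\<lambda>hit. if hit then ln (real k) else 0) (bernoulli_pmf (real k / real n)))"

primrec log_size_law :: "nat \<Rightarrow> nat pmf \<Rightarrow> nat \<Rightarrow> real pmf" where
  "log_size_law n p 0 = return_pmf 0"
| "log_size_law n p (Suc r) = bind_pmf (log_step_law n p) (\<lambda>y. map_pmf ((+) y) (log_size_law n p r))"

text \<open>\<open>log_size_law n p r\<close> is the law of the logarithmic loss of weight, over \<open>r\<close> blocks, along the trajectory of a
  random walker; \<open>survival n p u r w\<close> is the probability that a chunk of weight \<open>w\<close> ends with weight at least \<open>u\<close>.\<close>

definition survival :: "nat \<Rightarrow> nat pmf \<Rightarrow> real \<Rightarrow> nat \<Rightarrow> real \<Rightarrow> real" where
  "survival n p u r w = measure_pmf.prob (log_size_law n p r) {x. u \<le> w * exp (- x)}"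

lemma survival_bounds: "0 \<le> survival n p u r w" "survival n p u r w \<le> 1"
  by (simp_all add: survival_def)

lemma survival_mono: "w \<le> w' \<Longrightarrow> survival n p u r w \<le> survival n p u r w'"
  unfolding survival_def
  by (rule measure_pmf.finite_measure_mono) (auto intro: order_trans mult_right_mono)

lemma survival_0: "survival n p u 0 w = (if u \<le> w then 1 else 0)"
  by (simp add: survival_def indicator_def)

context block_sizes
begin

lemma finite_log_step_law: "finite (set_pmf (log_step_law n p))"
  by (auto simp: log_step_law_def finite_sizes)

lemma finite_log_size_law: "finite (set_pmf (log_size_law n p r))"
  by (induction r) (auto simp: finite_log_step_law)

lemma expectation_log_step:
  fixes h :: "real \<Rightarrow> 'c::{banach, second_countable_topology}"
  shows "measure_pmf.expectation (log_step_law n p) h =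
    measure_pmf.expectation p (\<lambda>k. (real k / real n) *\<^sub>R h (ln (real k)) + (1 - real k / real n) *\<^sub>R h 0)"
proof -
  have "measure_pmf.expectation (log_step_law n p) h = measure_pmf.expectation p (\<lambda>k. measure_pmf.expectation
    (map_pmf (\<lambda>hit. if hit then ln (real k) else 0) (bernoulli_pmf (real k / real n))) h)"
    unfolding log_step_law_def by (rule expectation_bind_finite) (auto simp: finite_sizes)
  also have "\<dots> = measure_pmf.expectation p (\<lambda>k. (real k / real n) *\<^sub>R h (ln (real k)) + (1 - real k / real n) *\<^sub>R h 0)"
  proof (rule integral_cong_AE)
    have "measure_pmf.expectation (map_pmf (\<lambda>hit. if hit then ln (real k) else 0) (bernoulli_pmf (real k / real n))) h =
      (real k / real n) *\<^sub>R h (ln (real k)) + (1 - real k / real n) *\<^sub>R h 0" if "k \<in> set_pmf p" for k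
      using size_bounds[OF that] by (subst integral_map_pmf, subst integral_measure_pmf[of UNIV]) (auto simp: UNIV_bool)
    then show "AE k in measure_pmf p. measure_pmf.expectation
       (map_pmf (\<lambda>hit. if hit then ln (real k) else 0) (bernoulli_pmf (real k / real n))) h =
      (real k / real n) *\<^sub>R h (ln (real k)) + (1 - real k / real n) *\<^sub>R h 0"
      by (simp add: AE_measure_pmf_iff)
  qed auto
  finally show ?thesis .
qed

text \<open>First-step analysis: a loss \<open>ln k\<close> amounts to dividing the initial weight
  by \<open>k\<close>. The recursion has the same kernel as \<open>EB_csum\<close>, which makes
  \<open>heavy_forecast\<close> a martingale.\<close>

lemma survival_Suc:
  "survival n p u (Suc r) w = measure_pmf.expectation p
     (\<lambda>k. real k / real n * survival n p u r (w / real k) + (1 - real k / real n) * survival n p u r w)"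
proof -
  have "survival n p u (Suc r) w = measure_pmf.expectation (log_size_law n p (Suc r)) (indicator {x. u \<le> w * exp (- x)})"
    by (simp add: survival_def)
  also have "\<dots> = measure_pmf.expectation (log_step_law n p)
      (\<lambda>y. measure_pmf.expectation (map_pmf ((+) y) (log_size_law n p r)) (indicator {x. u \<le> w * exp (- x)}))"
    unfolding log_size_law.simps
    by (rule expectation_bind_finite) (auto simp: finite_log_step_law finite_log_size_law)
  also have "\<dots> = measure_pmf.expectation (log_step_law n p) (\<lambda>y. survival n p u r (w * exp (- y)))"
  proof (rule arg_cong[where f = "measure_pmf.expectation (log_step_law n p)"], rule ext)
    fix y
    have "(indicator {x. u \<le> w * exp (- x)} (y + x) :: real) = indicator {x. u \<le> w * exp (- y) * exp (- x)} x" for x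
      by (simp add: indicator_def mult.assoc flip: exp_add)
    then have "measure_pmf.expectation (map_pmf ((+) y) (log_size_law n p r)) (indicator {x. u \<le> w * exp (- x)}) =
      measure_pmf.expectation (log_size_law n p r) (indicator {x. u \<le> w * exp (- y) * exp (- x)} :: real \<Rightarrow> real)"
      by (simp only: integral_map_pmf)
    then show "measure_pmf.expectation (map_pmf ((+) y) (log_size_law n p r)) (indicator {x. u \<le> w * exp (- x)}) =
      survival n p u r (w * exp (- y))" by (simp add: survival_def)
  qed
  also have "\<dots> = measure_pmf.expectation p
     (\<lambda>k. real k / real n * survival n p u r (w / real k) + (1 - real k / real n) * survival n p u r w)"
    unfolding expectation_log_step
    by (rule expectation_cong) (use size_bounds in \<open>force simp: exp_minus divide_inverse\<close>)
  finally show ?thesis .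
qed

end

section \<open>Mean squares and concentration for the random chunks\<close>

locale block_process = block_sizes n p + fragmentation n x0 for n p x0
begin

abbreviation EL :: "nat \<Rightarrow> (nat set list \<Rightarrow> real) \<Rightarrow> real" where
  "EL t \<equiv> measure_pmf.expectation (blocks_law n p t)"
abbreviation EB :: "(nat set \<Rightarrow> real) \<Rightarrow> real" where
  "EB \<equiv> measure_pmf.expectation (block_set_law n p)"

lemma finite_blocks_law: "finite (set_pmf (blocks_law n p t))"
  by (induction t) (auto simp: finite_block_set_law)

lemma integrable_blocks [simp]: "integrable (measure_pmf (blocks_law n p t)) (f :: nat set list \<Rightarrow> real)"
  by (simp add: integrable_measure_pmf_finite finite_blocks_law)

lemma blocks_lawD: "l \<in> set_pmf (blocks_law n p t) \<Longrightarrow> valid l \<and> length l = t"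
  using block_setD by (induction t arbitrary: l) auto

lemma EL_Suc: "EL (Suc t) h = EL t (\<lambda>l. EB (\<lambda>A. h (A # l)))"
proof -
  have "EL (Suc t) h = EL t (\<lambda>l. measure_pmf.expectation (map_pmf (\<lambda>A. A # l) (block_set_law n p)) h)"
    unfolding blocks_law.simps by (rule expectation_bind_finite) (auto simp: finite_blocks_law finite_block_set_law)
  then show ?thesis by simp
qed

lemma EL_cong: "(\<And>l. valid l \<Longrightarrow> length l = t \<Longrightarrow> f l = g l) \<Longrightarrow> EL t f = EL t g"
  using blocks_lawD by (intro expectation_cong) auto

lemma EL_mono: "(\<And>l. valid l \<Longrightarrow> length l = t \<Longrightarrow> f l \<le> g l) \<Longrightarrow> EL t f \<le> EL t g"
  using blocks_lawD finite_blocks_law by (intro expectation_mono_finite) auto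

lemma EL_drop: "EL (t + r) (\<lambda>l. h (drop r l)) = EL t h"
  by (induction r) (simp_all add: EL_Suc del: blocks_law.simps(2))

text \<open>A many-to-one formula: a chunk met by a block of size \<open>k\<close> becomes
  \<open>k\<close> chunks of weight \<open>w / k\<close>, whose total contribution to a
  weight-biased sum is that of a single chunk of weight \<open>w\<close> with \<open>f\<close>
  evaluated at \<open>w / k\<close>.\<close>

lemma EB_csum:
  assumes l: "valid l"
  shows "EB (\<lambda>A. csum (\<lambda>z w. w * f w) (A # l)) =
    csum (\<lambda>z w. w * measure_pmf.expectation p (\<lambda>k. real k / real n * f (w / real k) + (1 - real k / real n) * f w)) l"
proof -
  have "EB (\<lambda>A. csum (\<lambda>z w. w * f w) (A # l)) =
    EB (\<lambda>A. \<Sum>(z, w)\<leftarrow>chunks x0 l. if z \<in> A then w * f (w / real (card A)) else w * f w)"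
  proof (rule expectation_cong)
    fix A assume "A \<in> set_pmf (block_set_law n p)"
    then have A: "finite A" "card A \<noteq> 0" using block_setD by auto
    then have *: "(\<Sum>y\<in>A. w / real (card A) * f (w / real (card A))) = w * f (w / real (card A))" for w
      by simp
    show "csum (\<lambda>z w. w * f w) (A # l) = (\<Sum>(z, w)\<leftarrow>chunks x0 l. if z \<in> A then w * f (w / real (card A)) else w * f w)"
      by (simp only: sum_chunks_Cons[OF A(1)] *)
  qed
  also have "\<dots> = csum (\<lambda>z w. EB (\<lambda>A. if z \<in> A then w * f (w / real (card A)) else w * f w)) l"
    by (simp add: case_prod_beta' expectation_sum_list finite_block_set_law)
  also have "\<dots> = csum (\<lambda>z w. w * measure_pmf.expectation p (\<lambda>k. real k / real n * f (w / real k) + (1 - real k / real n) * f w)) l"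
  proof (rule csum_cong)
    fix z w assume "(z, w) \<in> set (chunks x0 l)"
    then have "z \<in> {1..n}" using chunk_bounds l by blast
    then have "EB (\<lambda>A. if z \<in> A then w * f (w / real (card A)) else w * f w) =
       measure_pmf.expectation p (\<lambda>k. real k / real n * (w * f (w / real k)) + (1 - real k / real n) * (w * f w))"
      by (rule expectation_block_mem)
    also have "\<dots> = measure_pmf.expectation p (\<lambda>k. w * (real k / real n * f (w / real k) + (1 - real k / real n) * f w))"
      by (simp add: algebra_simps)
    finally show "EB (\<lambda>A. if z \<in> A then w * f (w / real (card A)) else w * f w) =
      w * measure_pmf.expectation p (\<lambda>k. real k / real n * f (w / real k) + (1 - real k / real n) * f w)"
      by simp
  qed
  finally show ?thesis .
qed

text \<open>With \<open>f w = w\<close> in the many-to-one formula, a block of size \<open>k\<close>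
  multiplies the mean by \<open>1 - (k - 1) / n\<close>; averaging over \<open>k\<close> gives
  \<open>1 - a\<close>.\<close>

lemma EL_csum_sq: "EL t (csum (\<lambda>z w. w\<^sup>2)) = (1 - a) ^ t"
proof (induction t)
  case (Suc t)
  have step: "measure_pmf.expectation p (\<lambda>k. real k / real n * (w / real k) + (1 - real k / real n) * w) = w * (1 - a)" for w
  proof -
    have "measure_pmf.expectation p (\<lambda>k. real k / real n * (w / real k) + (1 - real k / real n) * w) =
      measure_pmf.expectation p (\<lambda>k. (w / real n + w) - w / real n * real k)"
      by (rule expectation_cong) (use size_bounds in \<open>force simp: field_simps\<close>)
    also have "\<dots> = w * (1 - a)" by (simp add: a_def diff_divide_distrib algebra_simps)
    finally show ?thesis .
  qed
  have "EL (Suc t) (csum (\<lambda>z w. w\<^sup>2)) = EL t (\<lambda>l. EB (\<lambda>A. csum (\<lambda>z w. w * w) (A # l)))"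
    unfolding EL_Suc power2_eq_square ..
  also have "\<dots> = EL t (\<lambda>l. csum (\<lambda>z w. w\<^sup>2) l * (1 - a))"
  proof (rule EL_cong)
    fix l assume "valid l"
    from EB_csum[OF this, of "\<lambda>w. w"]
    have "EB (\<lambda>A. csum (\<lambda>z w. w * w) (A # l)) = csum (\<lambda>z w. w * (w * (1 - a))) l"
      by (simp only: step)
    also have "\<dots> = csum (\<lambda>z w. w\<^sup>2) l * (1 - a)"
      by (simp add: case_prod_beta' power2_eq_square mult.assoc flip: sum_list_mult_const)
    finally show "EB (\<lambda>A. csum (\<lambda>z w. w * w) (A # l)) = csum (\<lambda>z w. w\<^sup>2) l * (1 - a)" .
  qed
  also have "\<dots> = (1 - a) ^ Suc t" using Suc by simp
  finally show ?case .
qed simp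

lemma EL_evolve_sq:
  assumes "\<And>l. valid l \<Longrightarrow> (\<Sum>x\<in>{1..n}. f l x) = 0"
  shows "EL (t + r) (\<lambda>l. \<Sum>x\<in>{1..n}. (evolve f r l x)\<^sup>2) = (1 - b) ^ r * EL t (\<lambda>l. \<Sum>x\<in>{1..n}. (f l x)\<^sup>2)"
proof (induction r)
  case (Suc r)
  have "EL (t + Suc r) (\<lambda>l. \<Sum>x\<in>{1..n}. (evolve f (Suc r) l x)\<^sup>2) =
    EL (t + r) (\<lambda>l. EB (\<lambda>A. \<Sum>x\<in>{1..n}. (block_average A (evolve f r l) x)\<^sup>2))"
    unfolding add_Suc_right EL_Suc by simp
  also have "\<dots> = EL (t + r) (\<lambda>l. (1 - b) * (\<Sum>x\<in>{1..n}. (evolve f r l x)\<^sup>2))"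
  proof (rule EL_cong)
    fix l :: "nat set list" assume l: "valid l" "length l = t + r"
    then have "(\<Sum>x\<in>{1..n}. evolve f r l x) = 0"
      using assms by (subst sum_evolve) (auto simp del: One_nat_def intro: valid_drop)
    then show "EB (\<lambda>A. \<Sum>x\<in>{1..n}. (block_average A (evolve f r l) x)\<^sup>2) = (1 - b) * (\<Sum>x\<in>{1..n}. (evolve f r l x)\<^sup>2)"
      by (rule expectation_block_average_sq)
  qed
  also have "\<dots> = (1 - b) ^ Suc r * EL t (\<lambda>l. \<Sum>x\<in>{1..n}. (f l x)\<^sup>2)"
    using Suc by simp
  finally show ?case .
qed simp

text \<open>The centred mass contracts at rate \<open>b\<close> from a norm at most one. The rate is
  weakened to \<open>a\<close> on purpose: the transient term then equals the expected diagonal part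
  \<open>(1 - a) ^ t\<close> of \<open>EL_csum_sq\<close>, and the two cancel in the off-diagonal
  bound.\<close>

lemma EL_mass_sq: "EL t (\<lambda>l. \<Sum>x\<in>{1..n}. (mass x0 l x)\<^sup>2) \<le> 1 / real n + (1 - a) ^ t"
proof -
  define v where "v l x = mass x0 l x - 1 / real n" for l :: "nat set list" and x
  have sum_v: "(\<Sum>x\<in>{1..n}. v l x) = 0" if "valid l" for l
    using sum_mass[OF that] n_pos by (simp add: v_def sum_subtractf)
  have sq: "(\<Sum>x\<in>{1..n}. (v l x)\<^sup>2) = (\<Sum>x\<in>{1..n}. (mass x0 l x)\<^sup>2) - 1 / real n" if "valid l" for l
  proof -
    have "(\<Sum>x\<in>{1..n}. (v l x)\<^sup>2) = (\<Sum>x\<in>{1..n}. (mass x0 l x)\<^sup>2 - 2 / real n * mass x0 l x + (1 / real n)\<^sup>2)"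
      by (rule sum.cong) (simp_all add: v_def power2_diff)
    also have "\<dots> = (\<Sum>x\<in>{1..n}. (mass x0 l x)\<^sup>2) - 2 / real n * (\<Sum>x\<in>{1..n}. mass x0 l x) + real n * (1 / real n)\<^sup>2"
      by (simp add: sum.distrib sum_subtractf sum_distrib_left)
    also have "\<dots> = (\<Sum>x\<in>{1..n}. (mass x0 l x)\<^sup>2) - 1 / real n"
      unfolding sum_mass[OF that] using n_pos by (simp add: power2_eq_square)
    finally show ?thesis .
  qed
  \<comment> \<open>Averaging is linear and fixes constants, so the centred mass evolves by itself
    from the centred Dirac mass.\<close>
  have v_evolve: "evolve v r l x = v l x" if "valid l" "length l = r" for r l x
    using that
  proof (induction r arbitrary: l x)
    case (Suc r)
    then obtain A l' where l: "l = A # l'" by (cases l) auto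
    then have A: "finite A" using Suc.prems finite_subset[of A "{1..n}"] by auto
    have "evolve v r l' = v l'" using Suc l by auto
    moreover have "mass x0 l' = (\<lambda>x. v l' x + 1 / real n)" by (simp add: v_def)
    then have "mass x0 l x = block_average A (v l') x + 1 / real n"
      using l by (simp only: mass.simps block_average_add block_average_const[OF A])
    ultimately show ?case using l v_def[of l x] by simp
  qed simp
  have "EL t (\<lambda>l. \<Sum>x\<in>{1..n}. (v l x)\<^sup>2) = EL (0 + t) (\<lambda>l. \<Sum>x\<in>{1..n}. (evolve v t l x)\<^sup>2)"
    unfolding add_0 by (rule EL_cong) (simp add: v_evolve)
  also have "\<dots> = (1 - b) ^ t * (\<Sum>x\<in>{1..n}. (v [] x)\<^sup>2)"
    by (subst EL_evolve_sq[OF sum_v]) simp_all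
  also have "(\<Sum>x\<in>{1..n}. (v [] x)\<^sup>2) \<le> 1"
  proof -
    have "(\<Sum>x\<in>{1..n}. (mass x0 [] x)\<^sup>2) = (\<Sum>x\<in>{1..n}. if x = x0 then 1 else 0)"
      by (rule sum.cong) (simp_all add: dirac_mass_def)
    also have "\<dots> = 1" using x0 by simp
    finally show ?thesis using sq[of "[]"] by simp
  qed
  also have "(1 - b) ^ t * 1 \<le> (1 - a) ^ t"
    using a_bounds q_bounds by (simp add: power_mono)
  finally have "EL t (\<lambda>l. \<Sum>x\<in>{1..n}. (v l x)\<^sup>2) \<le> (1 - a) ^ t"
    using a_bounds by (simp add: mult_left_mono)
  moreover have "EL t (\<lambda>l. \<Sum>x\<in>{1..n}. (v l x)\<^sup>2) = EL t (\<lambda>l. \<Sum>x\<in>{1..n}. (mass x0 l x)\<^sup>2) - 1 / real n"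
  proof -
    have "EL t (\<lambda>l. \<Sum>x\<in>{1..n}. (v l x)\<^sup>2) = EL t (\<lambda>l. (\<Sum>x\<in>{1..n}. (mass x0 l x)\<^sup>2) - 1 / real n)"
      by (rule EL_cong) (rule sq)
    then show ?thesis by (simp add: del: One_nat_def)
  qed
  ultimately show ?thesis by simp
qed

text \<open>The terms \<open>(1 - a) ^ t\<close> cancel, so the light part has mean square at most
  \<open>1 / n + u\<close> whatever the time \<open>t\<close> of the split; the later
  \<open>r\<close> blocks contract it.\<close>

lemma EL_evolve_light_dev:
  assumes "0 \<le> u"
  shows "EL (t + r) (\<lambda>l. \<Sum>x\<in>{1..n}. (evolve (light_dev u) r l x)\<^sup>2) \<le> (1 - b) ^ r * (1 / real n + u)"
proof -
  have "EL t (\<lambda>l. \<Sum>x\<in>{1..n}. (light_dev u l x)\<^sup>2) \<le>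
    EL t (\<lambda>l. (\<Sum>x\<in>{1..n}. (mass x0 l x)\<^sup>2) - csum (\<lambda>z w. w\<^sup>2) l + u)"
    by (rule EL_mono) (rule order_trans[OF light_dev_sq_le light_mass_sq_le[OF _ assms]])
  also have "\<dots> = EL t (\<lambda>l. \<Sum>x\<in>{1..n}. (mass x0 l x)\<^sup>2) - EL t (csum (\<lambda>z w. w\<^sup>2)) + u"
    by simp
  also have "\<dots> \<le> 1 / real n + u" using EL_mass_sq[of t] EL_csum_sq[of t] by simp
  finally have "EL t (\<lambda>l. \<Sum>x\<in>{1..n}. (light_dev u l x)\<^sup>2) \<le> 1 / real n + u" .
  then show ?thesis
    using a_bounds by (subst EL_evolve_sq[OF sum_light_dev]) (auto intro: mult_left_mono)
qed

lemma abs_csum_le: "\<bar>csum f l\<bar> \<le> csum (\<lambda>z w. \<bar>f z w\<bar>) l"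
  using sum_list_abs[of "map (\<lambda>(z, w). f z w) (chunks x0 l)"] by (simp add: case_prod_beta' o_def)

lemma csum_diff: "csum f l - csum g l = csum (\<lambda>z w. f z w - g z w) l"
  by (simp add: sum_list_subtractf case_prod_beta')

text \<open>The conditional expectation of \<open>heavy u\<close> after \<open>r\<close> more blocks, given the blocks \<open>l\<close>.\<close>

definition heavy_forecast :: "real \<Rightarrow> nat \<Rightarrow> nat set list \<Rightarrow> real" where
  "heavy_forecast u r l = csum (\<lambda>z w. w * survival n p u r w) l"

lemma heavy_forecast_0: "heavy_forecast u 0 l = heavy u l"
  unfolding heavy_forecast_def heavy_def by (rule csum_cong) (simp add: survival_0)

lemma heavy_forecast_Nil: "heavy_forecast u r [] = survival n p u r 1"
  by (simp add: heavy_forecast_def)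

lemma EB_heavy_forecast: "valid l \<Longrightarrow> EB (\<lambda>A. heavy_forecast u r (A # l)) = heavy_forecast u (Suc r) l"
  unfolding heavy_forecast_def by (subst EB_csum) (simp_all add: survival_Suc del: chunks.simps)

lemma EL_heavy: "EL t (heavy u) = survival n p u t 1"
proof -
  have "EL t (heavy_forecast u r) = survival n p u (t + r) 1" for r
  proof (induction t arbitrary: r)
    case (Suc t)
    have "EL (Suc t) (heavy_forecast u r) = EL t (heavy_forecast u (Suc r))"
      unfolding EL_Suc by (rule EL_cong) (rule EB_heavy_forecast)
    then show ?case using Suc by simp
  qed (simp add: heavy_forecast_Nil)
  moreover have "heavy_forecast u 0 = heavy u" by (rule ext) (rule heavy_forecast_0)
  ultimately show ?thesis by (metis add_0_right)
qed

text \<open>No chunk outweighs the initial one, and survival is monotone in the weight. This bounds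
  the random forecast at the end of the burn-in by a deterministic value, so that no variance has to
  be estimated before that time.\<close>

lemma heavy_forecast_le:
  assumes l: "valid l"
  shows "0 \<le> heavy_forecast u r l" "heavy_forecast u r l \<le> survival n p u r 1"
proof -
  have w: "0 < w" "w \<le> 1" if zw: "(z, w) \<in> set (chunks x0 l)" for z w
  proof -
    show "0 < w" using chunk_bounds[OF l zw] by simp
    have "w \<le> sum_list (map snd (chunks x0 l))"
      using zw chunk_bounds[OF l] by (intro member_le_sum_list) (force intro: less_imp_le)+
    then show "w \<le> 1" using csum_weight[OF l] by (simp add: case_prod_beta')
  qed
  show "0 \<le> heavy_forecast u r l"
    unfolding heavy_forecast_def by (rule sum_list_nonneg) (auto dest!: w(1) simp: survival_bounds)
  have "heavy_forecast u r l \<le> csum (\<lambda>z w. w * survival n p u r 1) l"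
    unfolding heavy_forecast_def using w by (intro csum_mono mult_left_mono survival_mono) (auto intro: less_imp_le)
  also have "\<dots> = csum (\<lambda>z w. w) l * survival n p u r 1" by (simp add: case_prod_beta' sum_list_mult_const)
  finally show "heavy_forecast u r l \<le> survival n p u r 1" using csum_weight[OF l] by simp
qed

text \<open>Given the past, a new block \<open>A\<close> changes the forecast by at most the mass it meets, so this mass
  controls the conditional variance.\<close>

lemma EB_heavy_forecast_sq:
  assumes l: "valid l"
  shows "EB (\<lambda>A. (heavy_forecast u r (A # l))\<^sup>2) \<le>
    (heavy_forecast u (Suc r) l)\<^sup>2 + EB (\<lambda>A. (\<Sum>x\<in>A. mass x0 l x)\<^sup>2)"
proof -
  let ?Z = "\<lambda>A. heavy_forecast u r (A # l)" and ?c = "heavy_forecast u r l"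
  have diff: "\<bar>?Z A - ?c\<bar> \<le> (\<Sum>x\<in>A. mass x0 l x)" if "A \<in> set_pmf (block_set_law n p)" for A
  proof -
    have A: "finite A" "card A \<noteq> 0" using block_setD[OF that] by auto
    let ?g = "survival n p u r"
    have *: "(\<Sum>y\<in>A. w / real (card A) * ?g (w / real (card A))) = w * ?g (w / real (card A))" for w
      using A by simp
    have "?Z A - ?c = csum (\<lambda>z w. (if z \<in> A then w * ?g (w / real (card A)) else w * ?g w) - w * ?g w) l"
      unfolding heavy_forecast_def sum_chunks_Cons[OF A(1)] *
      by (rule csum_diff)
    then have "\<bar>?Z A - ?c\<bar> \<le> csum (\<lambda>z w. \<bar>(if z \<in> A then w * ?g (w / real (card A)) else w * ?g w) - w * ?g w\<bar>) l"
      by (simp only: abs_csum_le)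
    also have "\<dots> \<le> csum (\<lambda>z w. if z \<in> A then w else 0) l"
    proof (rule csum_mono)
      fix z w assume "(z, w) \<in> set (chunks x0 l)"
      then have "0 < w" using chunk_bounds[OF l] by blast
      moreover have "\<bar>?g x - ?g y\<bar> \<le> 1" for x y
        using survival_bounds[of n p u r x] survival_bounds[of n p u r y] by linarith
      ultimately have "w * \<bar>?g x - ?g y\<bar> \<le> w" for x y by (intro mult_left_le) auto
      then show "\<bar>(if z \<in> A then w * ?g (w / real (card A)) else w * ?g w) - w * ?g w\<bar> \<le> (if z \<in> A then w else 0)"
        using \<open>0 < w\<close> by (auto simp: abs_mult simp flip: right_diff_distrib)
    qed
    also have "\<dots> = csum (\<lambda>z w. \<Sum>x\<in>A. if z = x then w else 0) l"
      using A by (intro csum_cong) (simp add: sum.delta')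
    also have "\<dots> = (\<Sum>x\<in>A. mass x0 l x)"
      unfolding mass_eq_csum[OF l] by (simp add: sum_sum_list case_prod_beta')
    finally show ?thesis .
  qed
  have "EB (\<lambda>A. (?Z A)\<^sup>2) - 2 * ?c * EB ?Z + ?c\<^sup>2 = EB (\<lambda>A. (?Z A - ?c)\<^sup>2)"
    by (simp add: power2_diff)
  also have "\<dots> \<le> EB (\<lambda>A. (\<Sum>x\<in>A. mass x0 l x)\<^sup>2)"
    by (rule expectation_mono_finite[OF finite_block_set_law]) (metis diff abs_ge_zero power2_abs power_mono)
  finally have "EB (\<lambda>A. (?Z A)\<^sup>2) \<le> 2 * ?c * EB ?Z - ?c\<^sup>2 + EB (\<lambda>A. (\<Sum>x\<in>A. mass x0 l x)\<^sup>2)" by simp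
  \<comment> \<open>The square is expanded about the forecast made when the block misses everything,
    which need not be the conditional mean; \<open>2 * c * e - c\<^sup>2 \<le> e\<^sup>2\<close>
    restores the mean.\<close>
  also have "2 * ?c * EB ?Z - ?c\<^sup>2 \<le> (EB ?Z)\<^sup>2"
    using zero_le_power2[of "EB ?Z - ?c"] by (simp add: power2_diff mult_ac)
  finally show ?thesis by (simp add: EB_heavy_forecast[OF l])
qed

text \<open>The one-block bound is iterated over the last \<open>j\<close> blocks, the first
  \<open>s\<close> being the burn-in. Each block adds a stationary error \<open>e\<close> and a
  transient \<open>q * (1 - a) ^ t\<close>; as \<open>q \<le> 2 * a\<close>, the geometric sum from
  \<open>s\<close> on is at most \<open>2 * (1 - a) ^ s\<close>.\<close>

lemma EL_heavy_sq:
  defines "\<And>K. tail K \<equiv> measure_pmf.expectation p (\<lambda>k. if K < k then real k / real n else 0)"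
  shows "EL (s + j) (\<lambda>l. (heavy u l)\<^sup>2) \<le>
    (survival n p u j 1)\<^sup>2 + real j * (q * (real K + 1) / real n + tail K) + 2 * (1 - a) ^ s"
proof -
  define e where "e = q * (real K + 1) / real n + tail K"
  have step: "EL (Suc t) (\<lambda>l. (heavy_forecast u r l)\<^sup>2) \<le>
    EL t (\<lambda>l. (heavy_forecast u (Suc r) l)\<^sup>2) + (e + q * (1 - a) ^ t)" for t r
  proof -
    have "EL (Suc t) (\<lambda>l. (heavy_forecast u r l)\<^sup>2) \<le>
      EL t (\<lambda>l. (heavy_forecast u (Suc r) l)\<^sup>2 + (q * ((\<Sum>x\<in>{1..n}. (mass x0 l x)\<^sup>2) + real K / real n) + tail K))"
      unfolding EL_Suc tail_def
      by (rule EL_mono, rule order_trans[OF EB_heavy_forecast_sq], assumption, rule add_left_mono,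
          rule expectation_block_mass_sq_le[OF mass_nonneg sum_mass])
    also have "\<dots> = EL t (\<lambda>l. (heavy_forecast u (Suc r) l)\<^sup>2) +
      (q * (EL t (\<lambda>l. \<Sum>x\<in>{1..n}. (mass x0 l x)\<^sup>2) + real K / real n) + tail K)"
      by (simp del: One_nat_def)
    also have "q * (EL t (\<lambda>l. \<Sum>x\<in>{1..n}. (mass x0 l x)\<^sup>2) + real K / real n) + tail K \<le>
      q * ((1 / real n + (1 - a) ^ t) + real K / real n) + tail K"
      using EL_mass_sq[of t] q_bounds by (intro add_right_mono mult_left_mono) auto
    also have "\<dots> = e + q * (1 - a) ^ t" by (simp add: e_def algebra_simps add_divide_distrib)
    finally show ?thesis by simp
  qed
  have "EL (s + j) (\<lambda>l. (heavy_forecast u r l)\<^sup>2) \<le>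
    EL s (\<lambda>l. (heavy_forecast u (r + j) l)\<^sup>2) + real j * e + q * (\<Sum>i<j. (1 - a) ^ (s + i))" for r
  proof (induction j arbitrary: r)
    case (Suc j)
    show ?case using step[of "s + j" r] Suc[of "Suc r"] by (simp add: algebra_simps)
  qed simp
  from this[of 0] have "EL (s + j) (\<lambda>l. (heavy u l)\<^sup>2) \<le>
    EL s (\<lambda>l. (heavy_forecast u j l)\<^sup>2) + real j * e + q * (\<Sum>i<j. (1 - a) ^ (s + i))"
    by (simp add: heavy_forecast_0)
  also have "EL s (\<lambda>l. (heavy_forecast u j l)\<^sup>2) \<le> EL s (\<lambda>l. (survival n p u j 1)\<^sup>2)"
    using heavy_forecast_le by (intro EL_mono power_mono) auto
  also have "\<dots> = (survival n p u j 1)\<^sup>2" by simp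
  also have "q * (\<Sum>i<j. (1 - a) ^ (s + i)) \<le> 2 * (1 - a) ^ s"
  proof -
    have "q * (\<Sum>i<j. (1 - a) ^ (s + i)) \<le> 2 * a * ((1 - a) ^ s * (\<Sum>i<j. (1 - a) ^ i))"
    proof -
      have "(\<Sum>i<j. (1 - a) ^ (s + i)) = (1 - a) ^ s * (\<Sum>i<j. (1 - a) ^ i)"
        by (simp add: power_add sum_distrib_left)
      moreover have "0 \<le> (1 - a) ^ s * (\<Sum>i<j. (1 - a) ^ i)"
        using a_bounds by (intro mult_nonneg_nonneg sum_nonneg) auto
      ultimately show ?thesis using a_bounds(1) by (metis (no_types) field_sum_of_halves mult_right_mono mult_2 add_mono)
    qed
    also have "\<dots> = 2 * (1 - a) ^ s * (1 - (1 - a) ^ j)"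
      using one_diff_power_eq[of "1 - a" j] by simp
    also have "\<dots> \<le> 2 * (1 - a) ^ s"
      using a_bounds by (intro mult_left_le) auto
    finally show ?thesis .
  qed
  finally show ?thesis by (simp add: e_def)
qed

end

section \<open>Transfer from the given probability space\<close>

text \<open>The index \<open>t - s\<close> reflects the reversed order: block number
  \<open>s\<close> stands at that position.\<close>

lemma (in block_sizes) pmf_blocks_law:
  "length l = t \<Longrightarrow> pmf (blocks_law n p t) l = (\<Prod>s\<in>{1..t}. pmf (block_set_law n p) (l ! (t - s)))"
proof (induction t arbitrary: l)
  case (Suc t)
  then obtain A l' where l: "l = A # l'" "length l' = t" by (cases l) auto
  have *: "pmf (map_pmf (\<lambda>B. B # l'') (block_set_law n p)) l =
      pmf (block_set_law n p) A * indicator {l'} l''" for l''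
  proof (cases "l'' = l'")
    case True
    have "pmf (map_pmf (\<lambda>B. B # l') (block_set_law n p)) ((\<lambda>B. B # l') A) = pmf (block_set_law n p) A"
      by (rule pmf_map_inj') (simp add: inj_def)
    then show ?thesis using True l by simp
  next
    case False
    then show ?thesis using l by (auto intro!: pmf_map_outside)
  qed
  have "pmf (blocks_law n p (Suc t)) l =
      measure_pmf.expectation (blocks_law n p t) (\<lambda>l''. pmf (block_set_law n p) A * indicator {l'} l'')"
    by (simp only: blocks_law.simps pmf_bind *)
  also have "\<dots> = pmf (block_set_law n p) A * pmf (blocks_law n p t) l'"
    by (simp add: measure_pmf_single)
  also have "\<dots> = pmf (block_set_law n p) (l ! (Suc t - Suc t)) * (\<Prod>s\<in>{1..t}. pmf (block_set_law n p) (l ! (Suc t - s)))"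
    using l Suc.IH[OF l(2)] by (auto intro!: prod.cong simp: Suc_diff_le)
  also have "\<dots> = (\<Prod>s\<in>{1..Suc t}. pmf (block_set_law n p) (l ! (Suc t - s)))"
    by (simp add: prod.nat_ivl_Suc')
  finally show ?case .
qed simp

text \<open>Only an upper bound is claimed: off the null event that some block leaves the ground set the event need not be
  measurable, and a non-measurable set has \<open>measure\<close> zero.\<close>

lemma (in block_process) measure_random_blocks_le:
  assumes rb: "random_blocks M n p X A"
  shows "measure M {\<omega> \<in> space M. Q (map (\<lambda>s. A s \<omega>) (rev [1..<Suc t]))} \<le>
    measure_pmf.prob (blocks_law n p t) {l. Q l}"
proof -
  define L where "L \<omega> = map (\<lambda>s. A s \<omega>) (rev [1..<Suc t])" for \<omega>
  interpret M: prob_space M using rb by (simp add: random_blocks_def)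
  have indep: "M.indep_vars (\<lambda>_. count_space UNIV) (\<lambda>t \<omega>. (X t \<omega>, A t \<omega>)) {1..}"
    and law: "distr M (count_space UNIV) (\<lambda>\<omega>. (X s \<omega>, A s \<omega>)) = measure_pmf (block_law n p)" if "s \<ge> 1" for s
    using rb that by (auto simp: random_blocks_def)
  have meas: "(\<lambda>\<omega>. (X s \<omega>, A s \<omega>)) \<in> measurable M (count_space UNIV)" if "s \<ge> 1" for s
    using indep[OF that] that by (auto simp: M.indep_vars_def)
  have vimage: "(\<lambda>\<omega>. (X s \<omega>, A s \<omega>)) -` (snd -` {B}) \<inter> space M = {\<omega> \<in> space M. A s \<omega> = B}" for s B
    by auto
  have single: "M.prob {\<omega> \<in> space M. A s \<omega> = B} = pmf (block_set_law n p) B" if "s \<ge> 1" for s B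
  proof -
    have "M.prob {\<omega> \<in> space M. A s \<omega> = B} = measure (distr M (count_space UNIV) (\<lambda>\<omega>. (X s \<omega>, A s \<omega>))) (snd -` {B})"
      using meas[OF that] by (subst measure_distr) (simp_all add: vimage)
    also have "\<dots> = pmf (block_set_law n p) B"
      unfolding law[OF that] map_snd_block_law[symmetric] by (simp add: pmf_map)
    finally show ?thesis .
  qed
  have set_eq: "{\<omega> \<in> space M. L \<omega> = l} =
      space M \<inter> (\<Inter>s\<in>{1..t}. (\<lambda>\<omega>. (X s \<omega>, A s \<omega>)) -` (snd -` {l ! (t - s)}) \<inter> space M)"
    if "length l = t" for l
  proof -
    have nth: "rev [Suc 0..<Suc t] ! i = t - i" if "i < t" for i
      using that by (subst rev_nth) (auto simp: nth_append simp del: upt_Suc)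
    have "L \<omega> = l \<longleftrightarrow> (\<forall>s\<in>{1..t}. A s \<omega> = l ! (t - s))" for \<omega>
    proof
      assume "L \<omega> = l"
      then have "A s \<omega> = l ! (t - s)" if "s \<in> {1..t}" for s
        using that nth[of "t - s"] by (auto simp: L_def simp del: upt_Suc)
      then show "\<forall>s\<in>{1..t}. A s \<omega> = l ! (t - s)" by blast
    next
      assume *: "\<forall>s\<in>{1..t}. A s \<omega> = l ! (t - s)"
      show "L \<omega> = l"
      proof (rule nth_equalityI)
        show "length (L \<omega>) = length l" using that by (simp add: L_def)
        fix i assume "i < length (L \<omega>)"
        then have i: "i < t" by (simp add: L_def del: upt_Suc)
        then have "L \<omega> ! i = A (t - i) \<omega>" using nth[OF i] by (simp add: L_def del: upt_Suc)
        also have "\<dots> = l ! i" using * i by (auto simp: Suc_le_eq)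
        finally show "L \<omega> ! i = l ! i" .
      qed
    qed
    then show ?thesis by auto
  qed
  have atom: "{\<omega> \<in> space M. L \<omega> = l} \<in> sets M \<and> M.prob {\<omega> \<in> space M. L \<omega> = l} = pmf (blocks_law n p t) l"
    if "length l = t" for l
  \<comment> \<open>With no blocks the intersection below is over the empty set and is not
    \<open>space M\<close>.\<close>
  proof (cases "t = 0")
    case True
    then show ?thesis using that by (simp add: L_def M.prob_space)
  next
    case False
    let ?E = "\<lambda>s. (\<lambda>\<omega>. (X s \<omega>, A s \<omega>)) -` (snd -` {l ! (t - s)}) \<inter> space M"
    have E: "?E s \<in> sets M" if "s \<in> {1..t}" for s
      using meas[of s] that by (intro measurable_sets[of _ _ "count_space UNIV"]) auto
    have eq: "{\<omega> \<in> space M. L \<omega> = l} = (\<Inter>s\<in>{1..t}. ?E s)"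
      using set_eq[OF that] False by auto
    have "M.prob (\<Inter>s\<in>{1..t}. ?E s) = (\<Prod>s\<in>{1..t}. M.prob (?E s))"
      using indep[of 1] False by (intro M.indep_varsD[of _ _ "{1..}"]) auto
    also have "\<dots> = (\<Prod>s\<in>{1..t}. pmf (block_set_law n p) (l ! (t - s)))"
      by (rule prod.cong) (simp_all add: vimage single)
    also have "\<dots> = pmf (blocks_law n p t) l" using pmf_blocks_law[OF that] by simp
    finally have "M.prob (\<Inter>s\<in>{1..t}. ?E s) = pmf (blocks_law n p t) l" .
    moreover have "(\<Inter>s\<in>{1..t}. ?E s) \<in> sets M"
      using E False by (intro sets.finite_INT) auto
    ultimately show ?thesis unfolding eq by simp
  qed
  define F where "F = set_pmf (blocks_law n p t)"
  have F: "finite F" "\<And>l. l \<in> F \<Longrightarrow> length l = t"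
    using finite_blocks_law blocks_lawD by (auto simp: F_def)
  have union: "M.prob (\<Union>l\<in>S. {\<omega> \<in> space M. L \<omega> = l}) = measure_pmf.prob (blocks_law n p t) S"
    "(\<Union>l\<in>S. {\<omega> \<in> space M. L \<omega> = l}) \<in> sets M" if S: "S \<subseteq> F" for S
  proof -
    have finS: "finite S" using S F(1) finite_subset by blast
    have at: "{\<omega> \<in> space M. L \<omega> = l} \<in> sets M" "M.prob {\<omega> \<in> space M. L \<omega> = l} = pmf (blocks_law n p t) l"
      if "l \<in> S" for l using atom[of l] F(2) S that by auto
    show "(\<Union>l\<in>S. {\<omega> \<in> space M. L \<omega> = l}) \<in> sets M" using at finS by (intro sets.finite_UN) auto
    have "M.prob (\<Union>l\<in>S. {\<omega> \<in> space M. L \<omega> = l}) = (\<Sum>l\<in>S. M.prob {\<omega> \<in> space M. L \<omega> = l})"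
      using at finS by (intro M.finite_measure_finite_Union) (auto simp: disjoint_family_on_def)
    also have "\<dots> = measure_pmf.prob (blocks_law n p t) S"
      using at(2) finS by (simp add: measure_measure_pmf_finite)
    finally show "M.prob (\<Union>l\<in>S. {\<omega> \<in> space M. L \<omega> = l}) = measure_pmf.prob (blocks_law n p t) S" .
  qed
  let ?G = "\<Union>l\<in>F. {\<omega> \<in> space M. L \<omega> = l}"
  let ?G' = "\<Union>l\<in>F \<inter> {l. Q l}. {\<omega> \<in> space M. L \<omega> = l}"
  have full: "M.prob ?G = 1"
    using union(1)[of F] measure_pmf.prob_eq_1[of F "blocks_law n p t"] by (simp add: F_def AE_measure_pmf_iff)
  have "M.prob {\<omega> \<in> space M. Q (L \<omega>)} \<le> M.prob (?G' \<union> (space M - ?G))"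
    using union(2)[of F] union(2)[of "F \<inter> {l. Q l}"] by (intro M.finite_measure_mono) auto
  also have "\<dots> \<le> M.prob ?G' + M.prob (space M - ?G)"
    using union(2)[of F] union(2)[of "F \<inter> {l. Q l}"] by (intro measure_Un_le) auto
  also have "M.prob (space M - ?G) = 0" using union(2)[of F] full by (subst M.prob_compl) auto
  also have "M.prob ?G' = measure_pmf.prob (blocks_law n p t) (F \<inter> {l. Q l})" by (rule union(1)) simp
  also have "\<dots> \<le> measure_pmf.prob (blocks_law n p t) {l. Q l}"
    by (rule measure_pmf.finite_measure_mono) auto
  finally show ?thesis unfolding L_def by simp
qed

section \<open>Characteristic function of a compound binomial sum\<close>

text \<open>The left half-plane is convex and the derivative of \<open>exp\<close> has norm at most
  one there.\<close>

lemma norm_exp_diff_le: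
  fixes z w :: complex
  assumes "Re z \<le> 0" "Re w \<le> 0"
  shows "norm (exp z - exp w) \<le> norm (z - w)"
proof -
  have "norm (exp z - exp w) \<le> 1 * norm (z - w)"
  proof (rule field_differentiable_bound[of "{z. Re z \<le> 0}" exp exp])
    show "convex {z. Re z \<le> 0}" by (rule convex_halfspace_Re_le)
  qed (use assms in \<open>auto intro: DERIV_exp has_field_derivative_at_within\<close>)
  then show ?thesis by simp
qed

text \<open>Two is the largest distance between points of the unit disc, where the lemma is applied
  to differences; this is the origin of the constant \<open>exp 2\<close>.\<close>

lemma norm_exp_minus_affine_le:
  fixes z :: complex
  assumes "norm z \<le> 2"
  shows "norm (exp z - (1 + z)) \<le> exp 2 * (norm z)\<^sup>2"
proof -
  have "norm (exp z - (\<Sum>k\<le>1. z ^ k / fact k)) \<le> exp \<bar>Re z\<bar> * norm z ^ Suc 1 / fact 1"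
    by (rule Taylor_exp)
  also have "\<dots> \<le> exp 2 * (norm z)\<^sup>2"
    using abs_Re_le_cmod[of z] assms by (simp add: power2_eq_square mult_right_mono)
  finally show ?thesis by simp
qed

text \<open>Here \<open>q\<close> is a hit probability, \<open>y\<close> the phase per hit and
  \<psi> the characteristic function of the centred size; the number of hits and the sizes separate
  into a Gaussian factor and \<open>\<psi> ^ m\<close>. Step \<open>A\<close> exponentiates the
  \<open>T\<close>-th power (Poissonisation), \<open>B\<close> expands \<open>iexp y\<close>, whose
  linear term the centring cancels, \<open>C\<close> replaces \<open>T * q\<close> by the integer
  \<open>m\<close>, and \<open>D\<close> undoes the exponential. Bases in the unit disc and
  exponents in the left half-plane keep each error at most linear in the number of factors.\<close>

lemma compound_power_approx:
  fixes \<psi> :: complex and y q d :: real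
  assumes q: "0 \<le> q" "q \<le> 1" and \<psi>: "norm \<psi> \<le> 1" "norm (\<psi> - 1) \<le> d"
  shows "norm ((1 - q + q * iexp y * \<psi>) ^ T * iexp (- y * (T * q)) - exp (- (y\<^sup>2 / 2 * (T * q))) * \<psi> ^ m) \<le>
    exp 2 * (T * q * q) * (\<bar>y\<bar> + d)\<^sup>2 + T * q * (\<bar>y\<bar> ^ 3 + \<bar>y\<bar> * d) + \<bar>T * q - m\<bar> * d + exp 2 * m * d\<^sup>2"
proof -
  define z where "z = 1 - q + q * iexp y * \<psi>"
  have d0: "0 \<le> d" using \<psi>(2) norm_ge_zero order_trans by blast
  have iexp1: "norm (iexp y - 1) \<le> \<bar>y\<bar>" using iexp_approx1[of y 0] by simp
  have Re_le: "Re (w - 1) \<le> 0" if "norm w \<le> 1" for w :: complex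
    using complex_Re_le_cmod[of w] that by simp
  have e\<psi>: "norm (iexp y * \<psi>) \<le> 1" using \<psi>(1) by (simp add: norm_mult)
  have Re1: "Re (iexp y * \<psi> - 1) \<le> 0" "Re (\<psi> - 1) \<le> 0"
    using Re_le[OF e\<psi>] Re_le[OF \<psi>(1)] .
  have diff1: "norm (iexp y * \<psi> - 1) \<le> \<bar>y\<bar> + d"
  proof -
    have "iexp y * \<psi> - 1 = iexp y * (\<psi> - 1) + (iexp y - 1)" by (simp add: algebra_simps)
    also have "norm \<dots> \<le> norm (iexp y * (\<psi> - 1)) + norm (iexp y - 1)" by (rule norm_triangle_ineq)
    also have "\<dots> \<le> d + \<bar>y\<bar>" using iexp1 \<psi>(2) by (simp add: norm_mult)
    finally show ?thesis by simp
  qed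
  have z1: "z - 1 = q * (iexp y * \<psi> - 1)" by (simp add: z_def algebra_simps)
  have norm_z1: "norm (z - 1) \<le> q * (\<bar>y\<bar> + d)"
    unfolding z1 using diff1 q by (simp add: norm_mult mult_left_mono)
  have norm_z1_2: "norm (z - 1) \<le> 2"
  proof -
    have "norm (iexp y * \<psi> - 1) \<le> 2" using norm_triangle_ineq4[of "iexp y * \<psi>" 1] e\<psi> by simp
    then have "q * norm (iexp y * \<psi> - 1) \<le> 1 * 2" using q by (intro mult_mono) auto
    then show ?thesis unfolding z1 using q by (simp add: norm_mult)
  qed
  have norm_z: "norm z \<le> 1"
  proof -
    have "norm z \<le> norm (complex_of_real (1 - q)) + norm (q * (iexp y * \<psi>))"
      using norm_triangle_ineq[of "complex_of_real (1 - q)" "q * (iexp y * \<psi>)"] by (simp add: z_def mult.assoc)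
    also have "\<dots> = (1 - q) + q * norm (iexp y * \<psi>)"
      unfolding norm_mult[of "complex_of_real q"] norm_of_real using q by simp
    also have "\<dots> \<le> (1 - q) + q * 1"
      using q e\<psi> by (intro add_left_mono mult_left_mono) auto
    finally show ?thesis by simp
  qed
  have norm_ez: "norm (exp (z - 1)) \<le> 1"
    unfolding norm_exp_eq_Re z1 using Re1(1) q by (simp add: mult_nonneg_nonpos)
  have A: "norm (z ^ T * iexp (- y * (T * q)) - exp (z - 1) ^ T * iexp (- y * (T * q))) \<le> exp 2 * (T * q * q) * (\<bar>y\<bar> + d)\<^sup>2"
  proof -
    have "norm (z ^ T * iexp (- y * (T * q)) - exp (z - 1) ^ T * iexp (- y * (T * q))) = norm (z ^ T - exp (z - 1) ^ T)"
      by (simp flip: left_diff_distrib add: norm_mult)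
    also have "\<dots> \<le> T * norm (z - exp (z - 1))"
      by (rule norm_power_diff[OF norm_z norm_ez])
    also have "\<dots> \<le> T * (exp 2 * (q * (\<bar>y\<bar> + d))\<^sup>2)"
    proof (rule mult_left_mono)
      have "norm (z - exp (z - 1)) \<le> exp 2 * (norm (z - 1))\<^sup>2"
        using norm_exp_minus_affine_le[OF norm_z1_2] by (simp add: norm_minus_commute)
      also have "\<dots> \<le> exp 2 * (q * (\<bar>y\<bar> + d))\<^sup>2" using norm_z1 by (intro mult_left_mono power_mono) auto
      finally show "norm (z - exp (z - 1)) \<le> exp 2 * (q * (\<bar>y\<bar> + d))\<^sup>2" .
    qed simp
    also have "\<dots> = exp 2 * (T * q * q) * (\<bar>y\<bar> + d)\<^sup>2" by (simp add: power2_eq_square)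
    finally show ?thesis .
  qed
  \<comment> \<open>Exponents of the centred Poissonised power, of its form with the two factors
    decoupled, and of the size factor with exactly \<open>m\<close> terms.\<close>
  define e1 where "e1 = complex_of_real (T * q) * (iexp y * \<psi> - 1 - \<i> * y)"
  define e2 where "e2 = complex_of_real (T * q) * (\<psi> - 1 - complex_of_real (y\<^sup>2 / 2))"
  define e3 where "e3 = complex_of_real m * (\<psi> - 1)"
  have eq1: "exp (z - 1) ^ T * iexp (- y * (T * q)) = exp e1"
    unfolding z1 e1_def by (simp add: algebra_simps flip: exp_of_nat_mult exp_add)
  have Tq: "0 \<le> T * q" using q by simp
  have B: "norm (exp e1 - exp e2) \<le> T * q * (\<bar>y\<bar> ^ 3 + \<bar>y\<bar> * d)"
  proof -
    have "Re e1 = T * q * Re (iexp y * \<psi> - 1)" by (simp add: e1_def)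
    then have "Re e1 \<le> 0" using Re1(1) Tq by (simp add: mult_nonneg_nonpos)
    moreover have "Re e2 \<le> 0"
    proof -
      have "Re (\<psi> - 1) - y\<^sup>2 / 2 \<le> 0" using Re1(2) zero_le_power2[of y] by linarith
      with Tq have "T * q * (Re (\<psi> - 1) - y\<^sup>2 / 2) \<le> 0" by (rule mult_nonneg_nonpos)
      moreover have "Re e2 = T * q * (Re (\<psi> - 1) - y\<^sup>2 / 2)" by (simp add: e2_def)
      ultimately show ?thesis by (simp only:)
    qed
    ultimately have "norm (exp e1 - exp e2) \<le> norm (e1 - e2)" by (rule norm_exp_diff_le)
    also have "e1 - e2 = complex_of_real (T * q) * ((iexp y - (1 + \<i> * y - complex_of_real (y\<^sup>2 / 2))) + (iexp y - 1) * (\<psi> - 1))"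
      by (simp add: e1_def e2_def algebra_simps)
    also have "norm \<dots> \<le> T * q * (\<bar>y\<bar> ^ 3 + \<bar>y\<bar> * d)"
    proof -
      have "norm (iexp y - (1 + \<i> * y - complex_of_real (y\<^sup>2 / 2))) \<le> \<bar>y\<bar> ^ 3 / 6"
        using iexp_approx1[of y 2] by (simp add: eval_nat_numeral algebra_simps)
      also have "\<dots> \<le> \<bar>y\<bar> ^ 3" by simp
      finally have a: "norm (iexp y - (1 + \<i> * y - complex_of_real (y\<^sup>2 / 2))) \<le> \<bar>y\<bar> ^ 3" .
      have b: "norm ((iexp y - 1) * (\<psi> - 1)) \<le> \<bar>y\<bar> * d"
        unfolding norm_mult using iexp1 \<psi>(2) by (intro mult_mono) auto
      have "norm ((iexp y - (1 + \<i> * y - complex_of_real (y\<^sup>2 / 2))) + (iexp y - 1) * (\<psi> - 1)) \<le> \<bar>y\<bar> ^ 3 + \<bar>y\<bar> * d"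
        by (rule order_trans[OF norm_triangle_ineq add_mono[OF a b]])
      with Tq show ?thesis unfolding norm_mult[of "complex_of_real (T * q)"] norm_of_real abs_of_nonneg[OF Tq]
        by (intro mult_left_mono)
    qed
    finally show ?thesis .
  qed
  have eq2: "exp e2 = exp (- (y\<^sup>2 / 2 * (T * q))) * exp (complex_of_real (T * q) * (\<psi> - 1))"
    unfolding e2_def by (simp add: algebra_simps flip: exp_add exp_of_real)
  have damp: "norm (complex_of_real (exp (- (y\<^sup>2 / 2 * (T * q))))) \<le> 1" using Tq by simp
  have C: "norm (exp (complex_of_real (T * q) * (\<psi> - 1)) - exp e3) \<le> \<bar>T * q - m\<bar> * d"
  proof -
    have "norm (exp (complex_of_real (T * q) * (\<psi> - 1)) - exp e3) \<le> norm (complex_of_real (T * q) * (\<psi> - 1) - e3)"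
    proof (rule norm_exp_diff_le)
      have "Re (complex_of_real r * (\<psi> - 1)) \<le> 0" if "0 \<le> r" for r
        using Re1(2) that by (simp add: mult_nonneg_nonpos)
      from this[of "T * q"] this[of m] Tq
      show "Re (complex_of_real (T * q) * (\<psi> - 1)) \<le> 0" "Re e3 \<le> 0" unfolding e3_def by auto
    qed
    also have "complex_of_real (T * q) * (\<psi> - 1) - e3 = complex_of_real (T * q - m) * (\<psi> - 1)"
      by (simp add: e3_def algebra_simps)
    also have "norm \<dots> \<le> \<bar>T * q - m\<bar> * d"
      unfolding norm_mult norm_of_real using \<psi>(2) by (intro mult_left_mono) auto
    finally show ?thesis .
  qed
  have D: "norm (exp e3 - \<psi> ^ m) \<le> exp 2 * m * d\<^sup>2"
  proof -
    have "exp e3 = exp (\<psi> - 1) ^ m" by (simp add: e3_def exp_of_nat_mult)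
    moreover have "norm (exp (\<psi> - 1) ^ m - \<psi> ^ m) \<le> m * norm (exp (\<psi> - 1) - \<psi>)"
      using Re1(2) \<psi>(1) by (intro norm_power_diff) (auto simp: norm_exp_eq_Re)
    moreover have "norm (exp (\<psi> - 1) - \<psi>) \<le> exp 2 * d\<^sup>2"
    proof -
      have "norm (\<psi> - 1) \<le> 2" using norm_triangle_ineq4[of \<psi> 1] \<psi>(1) by simp
      then have "norm (exp (\<psi> - 1) - \<psi>) \<le> exp 2 * (norm (\<psi> - 1))\<^sup>2"
        using norm_exp_minus_affine_le by fastforce
      also have "\<dots> \<le> exp 2 * d\<^sup>2" using \<psi>(2) by (intro mult_left_mono power_mono) auto
      finally show ?thesis .
    qed
    then have "m * norm (exp (\<psi> - 1) - \<psi>) \<le> m * (exp 2 * d\<^sup>2)" by (intro mult_left_mono) auto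
    ultimately show ?thesis by (simp add: mult_ac)
  qed
  have CD: "norm (exp e2 - exp (- (y\<^sup>2 / 2 * (T * q))) * \<psi> ^ m) \<le> \<bar>T * q - m\<bar> * d + exp 2 * m * d\<^sup>2"
  proof -
    have "exp e2 - exp (- (y\<^sup>2 / 2 * (T * q))) * \<psi> ^ m =
      complex_of_real (exp (- (y\<^sup>2 / 2 * (T * q)))) * ((exp (complex_of_real (T * q) * (\<psi> - 1)) - exp e3) + (exp e3 - \<psi> ^ m))"
      unfolding eq2 by (simp add: algebra_simps)
    also have "norm \<dots> \<le> 1 * norm ((exp (complex_of_real (T * q) * (\<psi> - 1)) - exp e3) + (exp e3 - \<psi> ^ m))"
      unfolding norm_mult using damp by (intro mult_right_mono) auto
    also have "\<dots> \<le> \<bar>T * q - m\<bar> * d + exp 2 * m * d\<^sup>2"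
      using order_trans[OF norm_triangle_ineq add_mono[OF C D]] by simp
    finally show ?thesis .
  qed
  have "z ^ T * iexp (- y * (T * q)) - exp (- (y\<^sup>2 / 2 * (T * q))) * \<psi> ^ m =
    (z ^ T * iexp (- y * (T * q)) - exp (z - 1) ^ T * iexp (- y * (T * q))) + ((exp e1 - exp e2) +
    (exp e2 - exp (- (y\<^sup>2 / 2 * (T * q))) * \<psi> ^ m))"
    unfolding eq1 by simp
  also have "norm \<dots> \<le> exp 2 * (T * q * q) * (\<bar>y\<bar> + d)\<^sup>2 + (T * q * (\<bar>y\<bar> ^ 3 + \<bar>y\<bar> * d) + (\<bar>T * q - m\<bar> * d + exp 2 * m * d\<^sup>2))"
    by (intro order_trans[OF norm_triangle_ineq] add_mono A B CD)
  finally show ?thesis unfolding z_def by (simp add: add.assoc)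
qed


section \<open>Size-biased moments and the standardised logarithmic loss\<close>

context block_sizes
begin

abbreviation \<mu> :: real where "\<mu> \<equiv> log_mean p"
abbreviation \<sigma> :: real where "\<sigma> \<equiv> log_sd p"
abbreviation sb :: "nat pmf" where "sb \<equiv> size_biased p"

lemma set_size_biased: "set_pmf sb \<subseteq> set_pmf p"
  by (auto simp: set_pmf_eq pmf_size_biased[OF p])

lemma finite_size_biased: "finite (set_pmf sb)"
  using set_size_biased finite_sizes finite_subset by blast

lemma integrable_sb [simp]:
  fixes f :: "nat \<Rightarrow> 'c::{banach, second_countable_topology}"
  shows "integrable (measure_pmf sb) f"
  by (simp add: integrable_measure_pmf_finite finite_size_biased)

lemma size_biased_bounds: "k \<in> set_pmf sb \<Longrightarrow> 2 \<le> k \<and> k \<le> n"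
  using set_size_biased size_bounds by auto

lemma expectation_size_biased:
  fixes f :: "nat \<Rightarrow> 'c::{banach, second_countable_topology}"
  shows "measure_pmf.expectation p (\<lambda>k. real k *\<^sub>R f k) = mean *\<^sub>R measure_pmf.expectation sb f"
proof -
  have "mean > 0" using mean_bounds by simp
  have "measure_pmf.expectation sb f = (\<Sum>k\<in>set_pmf p. pmf sb k *\<^sub>R f k)"
    using finite_sizes set_size_biased by (intro integral_measure_pmf) auto
  then have "mean *\<^sub>R measure_pmf.expectation sb f = (\<Sum>k\<in>set_pmf p. mean *\<^sub>R pmf sb k *\<^sub>R f k)"
    by (simp add: scaleR_sum_right)
  also have "\<dots> = (\<Sum>k\<in>set_pmf p. pmf p k *\<^sub>R real k *\<^sub>R f k)"
    using \<open>mean > 0\<close> by (intro sum.cong) (auto simp: pmf_size_biased[OF p])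
  also have "\<dots> = measure_pmf.expectation p (\<lambda>k. real k *\<^sub>R f k)"
    using finite_sizes by (intro integral_measure_pmf[symmetric]) auto
  finally show ?thesis by simp
qed

lemma log_mean_ge: "ln 2 \<le> \<mu>"
proof -
  have "measure_pmf.expectation sb (\<lambda>_. ln 2) \<le> measure_pmf.expectation sb (\<lambda>k. ln (real k))"
    by (rule expectation_mono_finite[OF finite_size_biased]) (auto dest!: size_biased_bounds)
  then show ?thesis by (simp add: log_mean_def)
qed

lemma log_mean_pos: "0 < \<mu>"
  using log_mean_ge ln_gt_zero[of "2 :: real"] by linarith

lemma log_sd_sq: "\<sigma>\<^sup>2 = measure_pmf.expectation sb (\<lambda>k. (ln (real k) - \<mu>)\<^sup>2)"
  unfolding log_sd_def log_mean_def by (simp add: integral_nonneg)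

lemma log_sd_nonneg: "0 \<le> \<sigma>"
  by (simp add: log_sd_def integral_nonneg)

lemma second_moment: "measure_pmf.expectation sb (\<lambda>k. (ln (real k))\<^sup>2) = \<sigma>\<^sup>2 + \<mu>\<^sup>2"
  unfolding log_sd_sq by (simp add: power2_diff log_mean_def[symmetric]) (simp add: power2_eq_square)

text \<open>Jensen's inequality for \<open>x * ln x\<close> gives
  \<open>ln mean \<le> \<mu>\<close>; it is proved here by integrating
  \<open>ln x \<le> x - 1\<close> at \<open>x = mean / k\<close> against \<open>k\<close>. It turns
  the smallness of \<mu> into smallness of the hit probability.\<close>

lemma q_le: "q \<le> exp \<mu> / real n"
proof -
  have "mean > 0" using mean_bounds by simp
  have "mean * ln mean = measure_pmf.expectation p (\<lambda>k. real k * ln mean + real k - mean)"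
    by simp
  also have "\<dots> \<le> measure_pmf.expectation p (\<lambda>k. real k *\<^sub>R ln (real k))"
  proof (rule expectation_mono_finite[OF finite_sizes])
    fix k assume "k \<in> set_pmf p"
    then have k: "real k > 0" using size_bounds[of k] by simp
    have "ln (mean / real k) \<le> mean / real k - 1"
      using \<open>mean > 0\<close> k by (intro ln_le_minus_one) simp
    then have "real k * (ln mean - ln (real k)) \<le> real k * (mean / real k - 1)"
      using \<open>mean > 0\<close> k by (intro mult_left_mono) (auto simp: ln_div)
    also have "\<dots> = mean - real k" using k by (simp add: right_diff_distrib)
    finally show "real k * ln mean + real k - mean \<le> real k *\<^sub>R ln (real k)" by (simp add: algebra_simps)
  qed
  also have "\<dots> = mean * \<mu>" using expectation_size_biased[of "\<lambda>k. ln (real k)"] by (simp add: log_mean_def)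
  finally have "ln mean \<le> \<mu>" using \<open>mean > 0\<close> by simp
  then have "mean \<le> exp \<mu>" using \<open>mean > 0\<close> by (metis exp_le_cancel_iff exp_ln)
  then show ?thesis by (simp add: q_def divide_right_mono)
qed

text \<open>Chebyshev's inequality under the size-biased law: a size above the square root of
  \<open>n\<close> has logarithm at least half of \<open>ln n\<close>, so the indicator is at most
  \<open>4 * (ln k)\<^sup>2 / (ln n)\<^sup>2\<close>.\<close>

lemma tail_le:
  "measure_pmf.expectation p (\<lambda>k. if nat \<lfloor>sqrt (real n)\<rfloor> < k then real k / real n else 0) \<le>
    4 * q * (\<sigma>\<^sup>2 + \<mu>\<^sup>2) / (ln (real n))\<^sup>2"
proof -
  have ln_n: "ln (real n) > 0" using n by simp
  have "measure_pmf.expectation p (\<lambda>k. if nat \<lfloor>sqrt (real n)\<rfloor> < k then real k / real n else 0) \<le>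
    measure_pmf.expectation p (\<lambda>k. real k *\<^sub>R (4 / (real n * (ln (real n))\<^sup>2) * (ln (real k))\<^sup>2))"
  proof (rule expectation_mono_finite[OF finite_sizes])
    fix k assume "k \<in> set_pmf p"
    show "(if nat \<lfloor>sqrt (real n)\<rfloor> < k then real k / real n else 0) \<le>
      real k *\<^sub>R (4 / (real n * (ln (real n))\<^sup>2) * (ln (real k))\<^sup>2)"
    proof (cases "nat \<lfloor>sqrt (real n)\<rfloor> < k")
      case True
      then have "sqrt (real n) < real k" by linarith
      moreover from this have "0 < real k" by (meson le_less_trans of_nat_0_le_iff real_sqrt_ge_zero)
      ultimately have "ln (sqrt (real n)) \<le> ln (real k)"
        using n by (subst ln_le_cancel_iff) auto
      then have "ln (real n) \<le> 2 * ln (real k)" using n by (simp add: ln_sqrt)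
      then have "(ln (real n))\<^sup>2 \<le> (2 * ln (real k))\<^sup>2" using ln_n by (intro power_mono) auto
      then have "1 \<le> 4 * (ln (real k))\<^sup>2 / (ln (real n))\<^sup>2" using ln_n by (simp add: power_mult_distrib)
      then have "real k / real n * 1 \<le> real k / real n * (4 * (ln (real k))\<^sup>2 / (ln (real n))\<^sup>2)"
        by (intro mult_left_mono) auto
      then show ?thesis using True by simp
    qed simp
  qed
  also have "\<dots> = mean * (4 / (real n * (ln (real n))\<^sup>2) * (\<sigma>\<^sup>2 + \<mu>\<^sup>2))"
    unfolding expectation_size_biased second_moment[symmetric] by simp
  also have "\<dots> = 4 * q * (\<sigma>\<^sup>2 + \<mu>\<^sup>2) / (ln (real n))\<^sup>2" by (simp add: q_def)
  finally show ?thesis .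
qed

text \<open>The characteristic function of \<open>ln Y - \<mu>\<close>.\<close>

definition cchar :: "real \<Rightarrow> complex" where
  "cchar x = measure_pmf.expectation sb (\<lambda>k. iexp (x * (ln (real k) - \<mu>)))"

lemma norm_cchar: "norm (cchar x) \<le> 1"
proof -
  have "norm (cchar x) \<le> measure_pmf.expectation sb (\<lambda>k. norm (iexp (x * (ln (real k) - \<mu>))))"
    unfolding cchar_def by (rule integral_norm_bound)
  then show ?thesis by simp
qed

lemma norm_expectation_sb_le:
  fixes f :: "nat \<Rightarrow> complex"
  assumes "\<And>k. norm (f k) \<le> c * (ln (real k) - \<mu>)\<^sup>2"
  shows "norm (measure_pmf.expectation sb f) \<le> c * \<sigma>\<^sup>2"
proof -
  have "norm (measure_pmf.expectation sb f) \<le> measure_pmf.expectation sb (\<lambda>k. norm (f k))"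
    by (rule integral_norm_bound)
  also have "\<dots> \<le> measure_pmf.expectation sb (\<lambda>k. c * (ln (real k) - \<mu>)\<^sup>2)"
    by (rule expectation_mono_finite[OF finite_size_biased assms])
  also have "\<dots> = c * \<sigma>\<^sup>2" unfolding log_sd_sq by simp
  finally show ?thesis .
qed

lemma expectation_centred: "measure_pmf.expectation sb (\<lambda>k. complex_of_real (ln (real k) - \<mu>)) = 0"
  unfolding integral_complex_of_real by (simp add: log_mean_def[symmetric])

text \<open>Subtracting the linear term costs nothing because the variable is centred, and what
  remains is of second order. This order is needed: with arguments divided by a normalisation of
  order \<open>\<sigma> * sqrt m\<close>, the bound is still useful after multiplication by
  \<open>m\<close>, hence for \<open>m\<close>-th powers.\<close>

lemma cchar_lipschitz: "norm (cchar u - cchar v) \<le> ((u - v)\<^sup>2 / 2 + \<bar>u - v\<bar> * \<bar>v\<bar>) * \<sigma>\<^sup>2"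
proof -
  let ?f = "\<lambda>k. iexp (u * (ln (real k) - \<mu>)) - iexp (v * (ln (real k) - \<mu>)) - \<i> * (u - v) * complex_of_real (ln (real k) - \<mu>)"
  have "cchar u - cchar v = measure_pmf.expectation sb ?f"
    using expectation_centred by (simp add: cchar_def)
  also have "norm \<dots> \<le> ((u - v)\<^sup>2 / 2 + \<bar>u - v\<bar> * \<bar>v\<bar>) * \<sigma>\<^sup>2"
  proof (rule norm_expectation_sb_le)
    fix k
    define y where "y = ln (real k) - \<mu>"
    have "iexp (u * y) - iexp (v * y) - \<i> * (u - v) * y =
      iexp (v * y) * (iexp ((u - v) * y) - (1 + \<i> * ((u - v) * y))) + \<i> * (u - v) * y * (iexp (v * y) - 1)"
    proof -
      have "iexp (u * y) = iexp (v * y) * iexp ((u - v) * y)" by (simp add: algebra_simps flip: exp_add)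
      then show ?thesis by (simp add: algebra_simps)
    qed
    also have "norm \<dots> \<le> ((u - v) * y)\<^sup>2 / 2 + \<bar>u - v\<bar> * \<bar>y\<bar> * \<bar>v * y\<bar>"
    proof (rule order_trans[OF norm_triangle_ineq add_mono])
      show "norm (iexp (v * y) * (iexp ((u - v) * y) - (1 + \<i> * ((u - v) * y)))) \<le> ((u - v) * y)\<^sup>2 / 2"
        using iexp_approx1[of "(u - v) * y" 1] by (simp add: norm_mult power2_eq_square)
      show "norm (\<i> * (u - v) * y * (iexp (v * y) - 1)) \<le> \<bar>u - v\<bar> * \<bar>y\<bar> * \<bar>v * y\<bar>"
        using iexp_approx1[of "v * y" 0]
        by (simp add: norm_mult abs_mult flip: of_real_diff) (intro mult_left_mono, auto)
    qed
    also have "\<dots> = ((u - v)\<^sup>2 / 2 + \<bar>u - v\<bar> * \<bar>v\<bar>) * y\<^sup>2"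
    proof -
      have "\<bar>y\<bar> * \<bar>v * y\<bar> = \<bar>v\<bar> * y\<^sup>2"
      proof -
        have "\<bar>y\<bar> * \<bar>v * y\<bar> = \<bar>v\<bar> * (\<bar>y\<bar> * \<bar>y\<bar>)" by (simp only: abs_mult mult_ac)
        then show ?thesis by (simp only: abs_mult_self_eq power2_eq_square)
      qed
      then show ?thesis by (simp only: power_mult_distrib distrib_right mult.assoc times_divide_eq_left)
    qed
    finally show "norm (?f k) \<le> ((u - v)\<^sup>2 / 2 + \<bar>u - v\<bar> * \<bar>v\<bar>) * (ln (real k) - \<mu>)\<^sup>2"
      unfolding y_def .
  qed
  finally show ?thesis .
qed

lemma norm_cchar_minus_1: "norm (cchar x - 1) \<le> x\<^sup>2 * \<sigma>\<^sup>2 / 2"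
  using cchar_lipschitz[of x 0] by (simp add: cchar_def)

lemma expectation_log_step_iexp:
  "measure_pmf.expectation (log_step_law n p) (\<lambda>y. iexp (x * y)) = 1 - q + q * iexp (x * \<mu>) * cchar x"
proof -
  have "measure_pmf.expectation (log_step_law n p) (\<lambda>y. iexp (x * y)) =
    measure_pmf.expectation p (\<lambda>k. real k *\<^sub>R ((iexp (x * ln (real k)) - 1) /\<^sub>R real n) + 1)"
    unfolding expectation_log_step by (rule arg_cong[where f = "measure_pmf.expectation p"])
      (auto simp: algebra_simps scaleR_conv_of_real divide_inverse)
  also have "\<dots> = mean *\<^sub>R measure_pmf.expectation sb (\<lambda>k. (iexp (x * ln (real k)) - 1) /\<^sub>R real n) + 1"
    by (subst Bochner_Integration.integral_add)
       (simp_all only: expectation_size_biased integrable_measure_pmf_finite[OF finite_sizes], simp)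
  also have "measure_pmf.expectation sb (\<lambda>k. (iexp (x * ln (real k)) - 1) /\<^sub>R real n) =
    (measure_pmf.expectation sb (\<lambda>k. iexp (x * ln (real k))) - 1) /\<^sub>R real n"
    by simp
  also have "measure_pmf.expectation sb (\<lambda>k. iexp (x * ln (real k))) = iexp (x * \<mu>) * cchar x"
  proof -
    have "iexp (x * ln (real k)) = iexp (x * \<mu>) * iexp (x * (ln (real k) - \<mu>))" for k
      by (simp add: algebra_simps flip: exp_add)
    then show ?thesis by (simp add: cchar_def)
  qed
  finally show ?thesis
    by (simp add: q_def scaleR_conv_of_real divide_inverse algebra_simps)
qed

lemma expectation_log_size_iexp:
  "measure_pmf.expectation (log_size_law n p T) (\<lambda>y. iexp (x * y)) = (1 - q + q * iexp (x * \<mu>) * cchar x) ^ T"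
proof (induction T)
  case (Suc T)
  have "measure_pmf.expectation (log_size_law n p (Suc T)) (\<lambda>y. iexp (x * y)) =
    measure_pmf.expectation (log_step_law n p)
      (\<lambda>y. measure_pmf.expectation (map_pmf ((+) y) (log_size_law n p T)) (\<lambda>y. iexp (x * y)))"
    unfolding log_size_law.simps
    by (rule expectation_bind_finite) (auto simp: finite_log_step_law finite_log_size_law)
  also have "\<dots> = measure_pmf.expectation (log_step_law n p)
      (\<lambda>y. iexp (x * y) * measure_pmf.expectation (log_size_law n p T) (\<lambda>y. iexp (x * y)))"
    by (simp add: distrib_left exp_add)
  also have "\<dots> = (1 - q + q * iexp (x * \<mu>) * cchar x) ^ Suc T"
    unfolding Suc integral_mult_left_zero expectation_log_step_iexp by simp
  finally show ?case .
qed simp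

text \<open>The asymptotic standard deviation of the total loss: about \<open>ln n / \<mu>\<close>
  hits, each contributing \<mu> squared through the random number of hits and \<sigma> squared
  through its size.\<close>

definition scale :: real where
  "scale = sqrt (ln (real n) / \<mu>) * sqrt (\<mu>\<^sup>2 + \<sigma>\<^sup>2)"

definition std_law :: "nat \<Rightarrow> real measure" where
  "std_law T = distr (measure_pmf (log_size_law n p T)) borel (\<lambda>x. (x - T * q * \<mu>) / scale)"

lemma real_distribution_std_law: "real_distribution (std_law T)"
  unfolding std_law_def by (rule prob_space.real_distribution_distr[OF measure_pmf.prob_space_axioms]) simp

lemma char_std_law:
  "char (std_law T) s = (1 - q + q * iexp (s / scale * \<mu>) * cchar (s / scale)) ^ T * iexp (- (s / scale * \<mu>) * (T * q))"
proof -
  have "char (std_law T) s = measure_pmf.expectation (log_size_law n p T) (\<lambda>x. iexp (s * ((x - T * q * \<mu>) / scale)))"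
    unfolding char_def std_law_def by (subst integral_distr) simp_all
  also have "\<dots> = measure_pmf.expectation (log_size_law n p T) (\<lambda>x. iexp (s / scale * x) * iexp (- (s / scale * \<mu>) * (T * q)))"
    by (rule arg_cong[where f = "measure_pmf.expectation (log_size_law n p T)"])
       (auto simp: algebra_simps diff_divide_distrib simp flip: exp_add)
  also have "\<dots> = measure_pmf.expectation (log_size_law n p T) (\<lambda>x. iexp (s / scale * x)) * iexp (- (s / scale * \<mu>) * (T * q))"
    by simp
  also note expectation_log_size_iexp
  finally show ?thesis .
qed

lemma scale_pos: "0 < scale"
  using n log_mean_pos by (auto simp: scale_def intro!: mult_pos_pos add_pos_nonneg)

lemma survival_eq_cdf:
  assumes "0 < u"
  shows "survival n p u T 1 = cdf (std_law T) ((- ln u - T * q * \<mu>) / scale)"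
proof -
  have "u \<le> exp (- x) \<longleftrightarrow> x \<le> - ln u" for x
  proof -
    have "u \<le> exp (- x) \<longleftrightarrow> exp (ln u) \<le> exp (- x)" using assms by simp
    also have "\<dots> \<longleftrightarrow> ln u \<le> - x" by (rule exp_le_cancel_iff)
    finally show ?thesis by linarith
  qed
  then have "survival n p u T 1 = measure_pmf.prob (log_size_law n p T) {x. x \<le> - ln u}"
    by (simp add: survival_def)
  also have "{x. x \<le> - ln u} = (\<lambda>x. (x - T * q * \<mu>) / scale) -` {..(- ln u - T * q * \<mu>) / scale}"
    using scale_pos by (simp add: vimage_def divide_le_cancel)
  also have "measure_pmf.prob (log_size_law n p T) \<dots> = cdf (std_law T) ((- ln u - T * q * \<mu>) / scale)"
    unfolding cdf_def std_law_def by (subst measure_distr) simp_all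
  finally show ?thesis .
qed

end

section \<open>Weak convergence at moving points\<close>

text \<open>By compactness, along any subsequence on which \<open>a\<close> stays away from zero the
  bounded parameter converges on a further one. It lets a quantity depending on \<rho> be treated as
  if \<rho> converged.\<close>

lemma tendsto_zero_if_subseq_param:
  fixes a :: "nat \<Rightarrow> 'b::real_normed_vector" and c :: "nat \<Rightarrow> real"
  assumes c: "bounded (range c)"
    and sub: "\<And>r l. strict_mono r \<Longrightarrow> (\<lambda>k. c (r k)) \<longlonglongrightarrow> l \<Longrightarrow> (\<lambda>k. a (r k)) \<longlonglongrightarrow> 0"
  shows "a \<longlonglongrightarrow> 0"
proof (rule ccontr)
  assume "\<not> a \<longlonglongrightarrow> 0"
  then obtain e where e: "e > 0" "\<not> (\<forall>\<^sub>F n in sequentially. norm (a n) < e)"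
    unfolding tendsto_iff by (auto simp: dist_norm)
  have "infinite {n. e \<le> norm (a n)}"
  proof
    assume "finite {n. e \<le> norm (a n)}"
    then have "\<forall>\<^sub>F n in sequentially. n \<notin> {n. e \<le> norm (a n)}"
      unfolding cofinite_eq_sequentially[symmetric] eventually_cofinite by simp
    then show False using e(2) by (simp add: not_le)
  qed
  then obtain r :: "nat \<Rightarrow> nat" where r: "strict_mono r" "\<And>k. r k \<in> {n. e \<le> norm (a n)}"
    using infinite_enumerate by blast
  have "bounded (range (\<lambda>k. c (r k)))" by (rule bounded_subset[OF c]) auto
  then obtain l s where s: "strict_mono s" "((\<lambda>k. c (r k)) \<circ> s) \<longlonglongrightarrow> l"
    using bounded_imp_convergent_subsequence by blast
  have "strict_mono (r \<circ> s)" using r(1) s(1) by (rule strict_mono_o)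
  moreover have "(\<lambda>k. c ((r \<circ> s) k)) \<longlonglongrightarrow> l" using s(2) by (simp add: o_def)
  ultimately have "(\<lambda>k. a ((r \<circ> s) k)) \<longlonglongrightarrow> 0" by (rule sub)
  then have "\<forall>\<^sub>F k in sequentially. norm (a ((r \<circ> s) k)) < e"
    using e(1) unfolding tendsto_iff by (simp add: dist_norm)
  then obtain k where "norm (a ((r \<circ> s) k)) < e" by (metis eventually_happens' sequentially_bot)
  then show False using r(2)[of "s k"] by simp
qed

interpretation std_normal: real_distribution std_normal_distribution
  by (rule real_dist_normal_dist)

lemma measure_std_normal_singleton: "measure std_normal_distribution {x} = 0"
proof -
  have "emeasure std_normal_distribution {x} = 0"
    by (subst emeasure_density) (auto intro!: nn_integral_null_set)
  then show ?thesis by (simp add: measure_def)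
qed

lemma isCont_std_normal_cdf: "isCont std_normal_cdf x"
  unfolding std_normal_cdf_def by (simp add: std_normal.isCont_cdf measure_std_normal_singleton)

lemma std_normal_cdf_bounds: "0 \<le> std_normal_cdf x" "std_normal_cdf x \<le> 1"
  unfolding std_normal_cdf_def by (simp_all add: std_normal.cdf_nonneg std_normal.cdf_bounded_prob)

text \<open>The characteristic function of the Gaussian is even, so the law is symmetric by
  uniqueness; the absence of atoms settles the endpoint.\<close>

lemma std_normal_cdf_uminus: "std_normal_cdf (- x) = 1 - std_normal_cdf x"
proof -
  have "distr std_normal_distribution borel uminus = std_normal_distribution"
  proof (rule Levy_uniqueness)
    show "real_distribution (distr std_normal_distribution borel uminus)"
      by (rule std_normal.real_distribution_distr) simp
    have "char (distr std_normal_distribution borel uminus) t = char std_normal_distribution (- t)" for t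
      unfolding char_def by (subst integral_distr) simp_all
    then show "char (distr std_normal_distribution borel uminus) = char std_normal_distribution"
      by (intro ext) (simp add: char_std_normal_distribution)
  qed (rule real_dist_normal_dist)
  then have "std_normal_cdf (- x) = measure (distr std_normal_distribution borel uminus) {..- x}"
    by (simp add: std_normal_cdf_def cdf_def)
  also have "\<dots> = measure std_normal_distribution {x..}"
    by (subst measure_distr) (auto simp: vimage_def atLeast_def)
  also have "{x..} = UNIV - {..<x}" by auto
  also have "measure std_normal_distribution (UNIV - {..<x}) = 1 - measure std_normal_distribution {..<x}"
    using std_normal.prob_compl[of "{..<x}"] by simp
  also have "measure std_normal_distribution {..<x} = std_normal_cdf x"
  proof -
    have "measure std_normal_distribution ({..<x} \<union> {x}) =
      measure std_normal_distribution {..<x} + measure std_normal_distribution {x}"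
      by (rule std_normal.finite_measure_Union) auto
    also have "{..<x} \<union> {x} = {..x}" by auto
    finally show ?thesis by (simp add: std_normal_cdf_def cdf_def measure_std_normal_singleton)
  qed
  finally show ?thesis .
qed

text \<open>Along a subsequence with \<open>y\<close> tending to \<open>l\<close>, monotonicity
  squeezes the distribution function at \<open>x\<close> between its values at
  \<open>l - d / 2\<close> and \<open>l + d / 2\<close>, where weak convergence to a continuous
  limit applies.\<close>

lemma cdf_tendsto_moving:
  fixes N :: "nat \<Rightarrow> real measure"
  assumes N: "\<And>n. real_distribution (N n)" "weak_conv_m N std_normal_distribution"
    and y: "bounded (range y)" and xy: "(\<lambda>n. x n - y n) \<longlonglongrightarrow> 0"
  shows "(\<lambda>n. cdf (N n) (x n) - std_normal_cdf (y n)) \<longlonglongrightarrow> 0"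
proof (rule tendsto_zero_if_subseq_param[OF y])
  fix r l assume r: "strict_mono (r :: nat \<Rightarrow> nat)" and yl: "(\<lambda>k. y (r k)) \<longlonglongrightarrow> l"
  have cdf: "(\<lambda>k. cdf (N (r k)) z) \<longlonglongrightarrow> std_normal_cdf z" for z
  proof -
    have "(\<lambda>n. cdf (N n) z) \<longlonglongrightarrow> std_normal_cdf z"
      using N(2) isCont_std_normal_cdf[of z] by (simp add: weak_conv_m_def weak_conv_def std_normal_cdf_def)
    from LIMSEQ_subseq_LIMSEQ[OF this r] show ?thesis by (simp add: o_def)
  qed
  have "(\<lambda>k. x (r k) - y (r k)) \<longlonglongrightarrow> 0" using LIMSEQ_subseq_LIMSEQ[OF xy r] by (simp add: o_def)
  from tendsto_add[OF this yl] have xl: "(\<lambda>k. x (r k)) \<longlonglongrightarrow> l" by simp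
  have "(\<lambda>k. cdf (N (r k)) (x (r k))) \<longlonglongrightarrow> std_normal_cdf l"
  proof (rule tendstoI)
    fix e :: real assume e: "e > 0"
    have "\<forall>\<^sub>F z in at l. dist (std_normal_cdf z) (std_normal_cdf l) < e / 2"
      using e by (intro tendstoD[OF isCont_std_normal_cdf[of l, unfolded isCont_def]]) simp
    then obtain d where d: "d > 0" "\<And>z. dist z l < d \<Longrightarrow> dist (std_normal_cdf z) (std_normal_cdf l) < e / 2"
      unfolding eventually_at using e by (metis dist_self half_gt_zero UNIV_I)
    have near: "dist (std_normal_cdf (l + d / 2)) (std_normal_cdf l) < e / 2" "dist (std_normal_cdf (l - d / 2)) (std_normal_cdf l) < e / 2"
      using d by (auto simp: dist_real_def)
    have "\<forall>\<^sub>F k in sequentially. dist (cdf (N (r k)) (l + d / 2)) (std_normal_cdf (l + d / 2)) < e / 2"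
      "\<forall>\<^sub>F k in sequentially. dist (cdf (N (r k)) (l - d / 2)) (std_normal_cdf (l - d / 2)) < e / 2"
      by (rule tendstoD[OF cdf], use e in simp)+
    moreover have "\<forall>\<^sub>F k in sequentially. dist (x (r k)) l < d / 2" by (rule tendstoD[OF xl], use d(1) in simp)
    ultimately show "\<forall>\<^sub>F k in sequentially. dist (cdf (N (r k)) (x (r k))) (std_normal_cdf l) < e"
    proof eventually_elim
      case (elim k)
      interpret N: real_distribution "N (r k)" by (rule N(1))
      have "l - d / 2 \<le> x (r k)" "x (r k) \<le> l + d / 2" using elim(3) unfolding dist_real_def by linarith+
      then have "cdf (N (r k)) (l - d / 2) \<le> cdf (N (r k)) (x (r k))" "cdf (N (r k)) (x (r k)) \<le> cdf (N (r k)) (l + d / 2)"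
        by (simp_all add: N.cdf_nondecreasing)
      then show ?case using elim near unfolding dist_real_def by linarith
    qed
  qed
  moreover have "(\<lambda>k. std_normal_cdf (y (r k))) \<longlonglongrightarrow> std_normal_cdf l"
    by (rule isCont_tendsto_compose[OF isCont_std_normal_cdf yl])
  ultimately show "(\<lambda>k. cdf (N (r k)) (x (r k)) - std_normal_cdf (y (r k))) \<longlonglongrightarrow> 0"
    using tendsto_diff by fastforce
qed

section \<open>Characteristic functions of sums of i.i.d. size-biased terms\<close>

lemma prob_space_iid_size_biased: "prob_space (iid_size_biased p)"
  unfolding iid_size_biased_def by (rule prob_space_PiM) (rule measure_pmf.prob_space_axioms)

lemma measurable_iid_coordinate:
  fixes f :: "nat \<Rightarrow> real"
  assumes "s \<ge> 1"
  shows "(\<lambda>Y. f (Y s)) \<in> borel_measurable (iid_size_biased p)"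
  unfolding iid_size_biased_def
  by (rule measurable_compose[OF measurable_component_singleton[of s "{1..}" "\<lambda>_. measure_pmf (size_biased p)"]])
     (use assms in auto)

lemma char_iid_sum:
  fixes f :: "nat \<Rightarrow> real"
  shows "char (distr (iid_size_biased p) borel (\<lambda>Y. \<Sum>s=1..m. f (Y s))) t =
    (measure_pmf.expectation (size_biased p) (\<lambda>k. iexp (t * f k))) ^ m"
proof -
  let ?M = "iid_size_biased p" and ?S = "measure_pmf (size_biased p)"
  interpret prob_space ?M by (rule prob_space_iid_size_biased)
  have comp: "(\<lambda>Y. Y s) \<in> measurable ?M ?S" if "s \<ge> 1" for s
    unfolding iid_size_biased_def using that by (intro measurable_component_singleton) auto
  have dist: "distr ?M ?S (\<lambda>Y. Y s) = ?S" if "s \<ge> 1" for s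
    unfolding iid_size_biased_def using that by (intro distr_PiM_component) (auto intro: measure_pmf.prob_space_axioms)
  have "indep_vars (\<lambda>_. ?S) (\<lambda>s Y. Y s) {1..}"
  proof (subst indep_vars_iff_distr_eq_PiM')
    have "distr ?M (\<Pi>\<^sub>M s\<in>{1..}. ?S) (\<lambda>Y. \<lambda>s\<in>{1..}. Y s) = distr ?M (\<Pi>\<^sub>M s\<in>{1..}. ?S) (\<lambda>Y. Y)"
      by (rule distr_cong) (auto simp: iid_size_biased_def space_PiM PiE_def extensional_restrict)
    also have "\<dots> = ?M" unfolding iid_size_biased_def by simp
    also have "?M = (\<Pi>\<^sub>M s\<in>{1..}. distr ?M ?S (\<lambda>Y. Y s))"
      unfolding iid_size_biased_def[of p] by (rule PiM_cong) (use dist in \<open>auto simp: iid_size_biased_def\<close>)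
    finally show "distr ?M (\<Pi>\<^sub>M s\<in>{1..}. ?S) (\<lambda>Y. \<lambda>s\<in>{1..}. Y s) = (\<Pi>\<^sub>M s\<in>{1..}. distr ?M ?S (\<lambda>Y. Y s))" .
  qed (use comp in auto)
  then have "indep_vars (\<lambda>_. borel) (\<lambda>s Y. f (Y s)) {1..}"
    by (rule indep_vars_compose2[where N = "\<lambda>_. borel" and Y = "\<lambda>_. f"]) simp
  then have "indep_vars (\<lambda>_. borel) (\<lambda>s Y. f (Y s)) {1..m}" by (rule indep_vars_subset) auto
  then have "char (distr ?M borel (\<lambda>Y. \<Sum>s=1..m. f (Y s))) t = (\<Prod>s=1..m. char (distr ?M borel (\<lambda>Y. f (Y s))) t)"
    by (rule char_distr_sum)
  also have "\<dots> = (\<Prod>s=1..m. measure_pmf.expectation (size_biased p) (\<lambda>k. iexp (t * f k)))"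
  proof (rule prod.cong)
    fix s assume "s \<in> {1..m}"
    then have s: "s \<ge> 1" by simp
    have "distr ?M borel (\<lambda>Y. f (Y s)) = distr (distr ?M ?S (\<lambda>Y. Y s)) borel f"
      using comp[OF s] by (subst distr_distr) (auto simp: o_def)
    also have "\<dots> = distr ?S borel f" using dist[OF s] by simp
    finally show "char (distr ?M borel (\<lambda>Y. f (Y s))) t = measure_pmf.expectation (size_biased p) (\<lambda>k. iexp (t * f k))"
      unfolding char_def by (simp add: integral_distr)
  qed simp
  finally show ?thesis by simp
qed


lemma exp_minus_diff_le:
  fixes x y :: real
  assumes "0 \<le> x" "0 \<le> y"
  shows "\<bar>exp (- x) - exp (- y)\<bar> \<le> \<bar>x - y\<bar>"
proof -
  have "norm (exp (complex_of_real (- x)) - exp (complex_of_real (- y))) \<le> norm (complex_of_real (- x) - complex_of_real (- y))"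
    using assms by (intro norm_exp_diff_le) auto
  then show ?thesis
    unfolding exp_of_real of_real_diff[symmetric] norm_of_real by linarith
qed

lemma half_le: "x \<le> y \<Longrightarrow> 0 \<le> x \<Longrightarrow> x / 2 \<le> y" for x y :: real
  by linarith

lemma norm_add3_le:
  fixes x y z :: "'b::real_normed_vector"
  assumes "norm x \<le> a" "norm y \<le> b" "norm z \<le> c"
  shows "norm (x + (y + z)) \<le> a + (b + c)"
  using norm_triangle_ineq[of x "y + z"] norm_triangle_ineq[of y z] assms by linarith

text \<open>\<open>w\<close> is the share of the limiting variance due to the number of hits,
  \<open>1 - w\<close> that due to the sizes, and \<kappa> compares the expected number of hits with
  \<open>m\<close>. By the choice of \<open>scale\<close>, the phase per hit is at most
  \<open>\<bar>s\<bar> * r\<close> and \<open>\<psi> - 1\<close> at most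
  \<open>s\<^sup>2 * r\<^sup>2\<close>. Since \<open>m * r\<^sup>2 = 1\<close>, the errors of
  \<open>compound_power_approx\<close> vanish with \<open>r\<close>, \<open>q\<close> and
  \<open>\<kappa> - 1\<close>.\<close>

lemma (in block_sizes) norm_char_std_law_le:
  fixes s :: real and T :: nat
  defines "m \<equiv> ln (real n) / \<mu>" and "w \<equiv> \<mu>\<^sup>2 / (\<mu>\<^sup>2 + \<sigma>\<^sup>2)"
  defines "\<kappa> \<equiv> T * q / m" and "r \<equiv> 1 / sqrt m"
  shows "norm (char (std_law T) s - exp (- (s\<^sup>2 / 2))) \<le>
    exp 2 * \<kappa> * q * (\<bar>s\<bar> + s\<^sup>2 * r)\<^sup>2 + 2 * \<kappa> * \<bar>s\<bar> ^ 3 * r + (\<bar>\<kappa> - 1\<bar> + r\<^sup>2) * s\<^sup>2 + exp 2 * s ^ 4 * r\<^sup>2 +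
    norm (cchar (s / scale) ^ nat \<lfloor>m\<rfloor> - exp (- (s\<^sup>2 / 2 * (1 - w)))) + s\<^sup>2 * \<bar>\<kappa> - 1\<bar>"
proof -
  define y where "y = s / scale * \<mu>"
  define M where "M = nat \<lfloor>m\<rfloor>"
  define \<psi> where "\<psi> = cchar (s / scale)"
  have m: "m > 0" using n log_mean_pos by (simp add: m_def)
  have r: "r > 0" "m * r\<^sup>2 = 1" using m by (auto simp: r_def power_divide)
  have \<kappa>: "0 \<le> \<kappa>" "T * q = \<kappa> * m" using m q_bounds by (auto simp: \<kappa>_def)
  have pos: "\<mu>\<^sup>2 + \<sigma>\<^sup>2 > 0" using log_mean_pos by (simp add: add_pos_nonneg)
  have w: "0 \<le> w" "w \<le> 1" using pos by (auto simp: w_def)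
  have scale_sq: "scale\<^sup>2 = m * (\<mu>\<^sup>2 + \<sigma>\<^sup>2)"
    using m pos by (simp add: scale_def power_mult_distrib m_def)
  have y_sq: "y\<^sup>2 = s\<^sup>2 * w * r\<^sup>2"
  proof -
    have "y\<^sup>2 = s\<^sup>2 * \<mu>\<^sup>2 / (m * (\<mu>\<^sup>2 + \<sigma>\<^sup>2))" by (simp add: y_def power_mult_distrib power_divide scale_sq)
    also have "\<dots> = s\<^sup>2 * w * (1 / m)" by (simp add: w_def)
    also have "1 / m = r\<^sup>2" using m by (simp add: r_def power_divide)
    finally show ?thesis .
  qed
  have y: "\<bar>y\<bar> \<le> \<bar>s\<bar> * r"
  proof (rule power2_le_imp_le)
    show "\<bar>y\<bar>\<^sup>2 \<le> (\<bar>s\<bar> * r)\<^sup>2"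
      using w by (simp add: y_sq power_mult_distrib mult_right_mono mult_left_le)
  qed (use r in simp)
  have d: "norm (\<psi> - 1) \<le> s\<^sup>2 * r\<^sup>2"
  proof -
    have "norm (\<psi> - 1) \<le> (s / scale)\<^sup>2 * \<sigma>\<^sup>2 / 2" unfolding \<psi>_def by (rule norm_cchar_minus_1)
    also have "\<dots> = s\<^sup>2 * (\<sigma>\<^sup>2 / (\<mu>\<^sup>2 + \<sigma>\<^sup>2)) * (1 / m) / 2" by (simp add: power_divide scale_sq)
    also have "1 / m = r\<^sup>2" using m by (simp add: r_def power_divide)
    also have "s\<^sup>2 * (\<sigma>\<^sup>2 / (\<mu>\<^sup>2 + \<sigma>\<^sup>2)) * r\<^sup>2 / 2 \<le> s\<^sup>2 * 1 * r\<^sup>2"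
    proof -
      have "s\<^sup>2 * (\<sigma>\<^sup>2 / (\<mu>\<^sup>2 + \<sigma>\<^sup>2)) * r\<^sup>2 \<le> s\<^sup>2 * 1 * r\<^sup>2"
        using pos by (intro mult_right_mono mult_left_mono) auto
      moreover have "0 \<le> s\<^sup>2 * (\<sigma>\<^sup>2 / (\<mu>\<^sup>2 + \<sigma>\<^sup>2)) * r\<^sup>2" using pos by simp
      ultimately show ?thesis by (rule half_le)
    qed
    finally show ?thesis by simp
  qed
  have M: "real M \<le> m" "\<bar>m - real M\<bar> \<le> 1" using m by (auto simp: M_def) linarith+
  let ?e1 = "exp (- (y\<^sup>2 / 2 * (T * q)))" and ?e2 = "exp (- (s\<^sup>2 / 2 * (1 - w)))"
  have e1_eq: "y\<^sup>2 / 2 * (T * q) = s\<^sup>2 / 2 * w * \<kappa>"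
  proof -
    have "y\<^sup>2 / 2 * (T * q) = s\<^sup>2 / 2 * w * \<kappa> * (m * r\<^sup>2)" unfolding y_sq \<kappa>(2) by simp
    then show ?thesis using r(2) by simp
  qed
  have A: "norm (char (std_law T) s - ?e1 * \<psi> ^ M) \<le>
    exp 2 * \<kappa> * q * (\<bar>s\<bar> + s\<^sup>2 * r)\<^sup>2 + 2 * \<kappa> * \<bar>s\<bar> ^ 3 * r + (\<bar>\<kappa> - 1\<bar> + r\<^sup>2) * s\<^sup>2 + exp 2 * s ^ 4 * r\<^sup>2"
  proof -
    let ?d = "s\<^sup>2 * r\<^sup>2"
    have "norm (char (std_law T) s - ?e1 * \<psi> ^ M) \<le>
      exp 2 * (T * q * q) * (\<bar>y\<bar> + ?d)\<^sup>2 + T * q * (\<bar>y\<bar> ^ 3 + \<bar>y\<bar> * ?d) + \<bar>T * q - M\<bar> * ?d + exp 2 * M * ?d\<^sup>2"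
      unfolding char_std_law y_def[symmetric] \<psi>_def[symmetric]
      using q_bounds norm_cchar[of "s / scale"] d by (intro compound_power_approx) (auto simp: \<psi>_def)
    also have "\<dots> \<le> exp 2 * (T * q * q) * (\<bar>s\<bar> * r + ?d)\<^sup>2 + T * q * ((\<bar>s\<bar> * r) ^ 3 + (\<bar>s\<bar> * r) * ?d) +
      (m * \<bar>\<kappa> - 1\<bar> + 1) * ?d + exp 2 * m * ?d\<^sup>2"
    proof -
      have "\<bar>T * q - M\<bar> \<le> m * \<bar>\<kappa> - 1\<bar> + 1"
      proof -
        have "\<bar>T * q - m\<bar> = m * \<bar>\<kappa> - 1\<bar>" using m by (simp add: \<kappa>(2) abs_mult flip: left_diff_distrib[of _ 1 m, simplified])
        then show ?thesis using M by linarith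
      qed
      moreover have "(\<bar>y\<bar> + ?d)\<^sup>2 \<le> (\<bar>s\<bar> * r + ?d)\<^sup>2" "\<bar>y\<bar> ^ 3 \<le> (\<bar>s\<bar> * r) ^ 3" "\<bar>y\<bar> * ?d \<le> (\<bar>s\<bar> * r) * ?d"
        using y by (auto intro!: power_mono mult_right_mono)
      ultimately show ?thesis
        using q_bounds M y by (intro add_mono mult_left_mono mult_right_mono) auto
    qed
    also have "\<dots> = exp 2 * \<kappa> * q * (\<bar>s\<bar> + s\<^sup>2 * r)\<^sup>2 * (m * r\<^sup>2) + 2 * \<kappa> * \<bar>s\<bar> ^ 3 * r * (m * r\<^sup>2) +
      (\<bar>\<kappa> - 1\<bar> * (m * r\<^sup>2) + r\<^sup>2) * s\<^sup>2 + exp 2 * s ^ 4 * r\<^sup>2 * (m * r\<^sup>2)"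
    proof -
      have "e * (\<kappa> * m * q) * (x * r + x\<^sup>2 * r\<^sup>2)\<^sup>2 + \<kappa> * m * ((x * r) ^ 3 + x * r * (x\<^sup>2 * r\<^sup>2)) +
        (m * k + 1) * (x\<^sup>2 * r\<^sup>2) + e * m * (x\<^sup>2 * r\<^sup>2)\<^sup>2 =
        e * \<kappa> * q * (x + x\<^sup>2 * r)\<^sup>2 * (m * r\<^sup>2) + 2 * \<kappa> * x ^ 3 * r * (m * r\<^sup>2) +
        (k * (m * r\<^sup>2) + r\<^sup>2) * x\<^sup>2 + e * x ^ 4 * r\<^sup>2 * (m * r\<^sup>2)"
        for e \<kappa> m q x r k :: real
        by (simp add: power2_eq_square power3_eq_cube power4_eq_xxxx algebra_simps)
      from this[of "exp 2" \<kappa> m q "\<bar>s\<bar>" r "\<bar>\<kappa> - 1\<bar>"] show ?thesis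
        unfolding \<kappa>(2) power2_abs power_even_abs_numeral[OF even_numeral] .
    qed
    finally show ?thesis unfolding r(2) by simp
  qed
  have B: "norm (?e1 * \<psi> ^ M - ?e1 * ?e2) \<le> norm (\<psi> ^ M - ?e2)"
  proof -
    have "norm (?e1 * \<psi> ^ M - ?e1 * ?e2) = norm (complex_of_real ?e1) * norm (\<psi> ^ M - ?e2)"
      by (simp add: norm_mult flip: right_diff_distrib)
    also have "\<dots> \<le> 1 * norm (\<psi> ^ M - ?e2)"
    proof (rule mult_right_mono)
      have "0 \<le> y\<^sup>2 / 2 * (T * q)" using q_bounds by simp
      then show "norm (complex_of_real ?e1) \<le> 1" by simp
    qed simp
    finally show ?thesis by simp
  qed
  \<comment> \<open>At \<open>\<kappa> = 1\<close> the two Gaussian exponents carry the shares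
    \<open>w\<close> and \<open>1 - w\<close> and add up to that of the standard normal law.\<close>
  have C: "norm (complex_of_real (?e1 * ?e2) - exp (- (s\<^sup>2 / 2))) \<le> s\<^sup>2 * \<bar>\<kappa> - 1\<bar>"
  proof -
    have "?e1 * ?e2 - exp (- (s\<^sup>2 / 2)) = (exp (- (s\<^sup>2 / 2 * w * \<kappa>)) - exp (- (s\<^sup>2 / 2 * w))) * ?e2"
      unfolding e1_eq by (simp add: algebra_simps flip: exp_add)
    also have "\<bar>\<dots>\<bar> \<le> \<bar>s\<^sup>2 / 2 * w * \<kappa> - s\<^sup>2 / 2 * w\<bar> * 1"
      unfolding abs_mult using w \<kappa> by (intro mult_mono exp_minus_diff_le) auto
    also have "\<dots> = s\<^sup>2 * w * \<bar>\<kappa> - 1\<bar> / 2"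
    proof -
      have *: "s\<^sup>2 / 2 * w * \<kappa> - s\<^sup>2 / 2 * w = s\<^sup>2 * w / 2 * (\<kappa> - 1)" by (simp add: algebra_simps)
      have "0 \<le> s\<^sup>2 * w / 2" using w by simp
      then have "\<bar>s\<^sup>2 * w / 2 * (\<kappa> - 1)\<bar> = s\<^sup>2 * w / 2 * \<bar>\<kappa> - 1\<bar>"
        by (metis abs_mult abs_of_nonneg)
      then show ?thesis unfolding * by (simp only: mult_1_right times_divide_eq_left)
    qed
    also have "\<dots> \<le> s\<^sup>2 * 1 * \<bar>\<kappa> - 1\<bar>"
    proof -
      have "s\<^sup>2 * w * \<bar>\<kappa> - 1\<bar> \<le> s\<^sup>2 * 1 * \<bar>\<kappa> - 1\<bar>" using w by (intro mult_right_mono mult_left_mono) auto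
      moreover have "0 \<le> s\<^sup>2 * w * \<bar>\<kappa> - 1\<bar>" using w by simp
      ultimately show ?thesis by (rule half_le)
    qed
    finally have "\<bar>?e1 * ?e2 - exp (- (s\<^sup>2 / 2))\<bar> \<le> s\<^sup>2 * \<bar>\<kappa> - 1\<bar>" by simp
    then show ?thesis unfolding of_real_diff[symmetric] norm_of_real .
  qed
  have eq: "char (std_law T) s - exp (- (s\<^sup>2 / 2)) = (char (std_law T) s - ?e1 * \<psi> ^ M) +
    ((?e1 * \<psi> ^ M - ?e1 * ?e2) + (complex_of_real (?e1 * ?e2) - exp (- (s\<^sup>2 / 2))))" by simp
  have "norm (char (std_law T) s - exp (- (s\<^sup>2 / 2))) \<le> (exp 2 * \<kappa> * q * (\<bar>s\<bar> + s\<^sup>2 * r)\<^sup>2 + 2 * \<kappa> * \<bar>s\<bar> ^ 3 * r + (\<bar>\<kappa> - 1\<bar> + r\<^sup>2) * s\<^sup>2 + exp 2 * s ^ 4 * r\<^sup>2) +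
    (norm (\<psi> ^ M - ?e2) + s\<^sup>2 * \<bar>\<kappa> - 1\<bar>)"
    unfolding eq by (rule norm_add3_le[OF A B C])
  then show ?thesis unfolding \<psi>_def M_def by (simp only: add.assoc)
qed

section \<open>Asymptotics along a sequence of block-size laws\<close>

text \<open>The common ground of the two scenarios. The last assumption says that the sizes, in
  units of the total standard deviation, are asymptotically Gaussian with their share of the
  variance; it is stated as a difference because that share need not converge.\<close>

locale averaging_sequence =
  fixes p :: "nat \<Rightarrow> nat pmf"
  assumes range: "\<And>n. n \<ge> 2 \<Longrightarrow> set_pmf (p n) \<subseteq> {2..n}"
    and log_mean_small: "(\<lambda>n. log_mean (p n) / ln (real n)) \<longlonglongrightarrow> 0"
    and log_sd_small: "(\<lambda>n. (log_sd (p n))\<^sup>2 / (log_mean (p n) * ln (real n))) \<longlonglongrightarrow> 0"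
    and cchar_power: "\<And>s. (\<lambda>n. block_sizes.cchar (p n) (s / block_sizes.scale n (p n)) ^ nat \<lfloor>ln (real n) / log_mean (p n)\<rfloor>
      - exp (- (s\<^sup>2 / 2 * (1 - (log_mean (p n))\<^sup>2 / ((log_mean (p n))\<^sup>2 + (log_sd (p n))\<^sup>2))))) \<longlonglongrightarrow> 0"
begin

abbreviation mu :: "nat \<Rightarrow> real" where "mu n \<equiv> log_mean (p n)"
abbreviation sd :: "nat \<Rightarrow> real" where "sd n \<equiv> log_sd (p n)"
abbreviation hit :: "nat \<Rightarrow> real" where "hit n \<equiv> block_sizes.q n (p n)"
definition m :: "nat \<Rightarrow> real" where "m n = ln (real n) / mu n"
abbreviation spread :: "nat \<Rightarrow> real" where "spread n \<equiv> block_sizes.scale n (p n)"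

lemma block_sizes: "n \<ge> 2 \<Longrightarrow> block_sizes n (p n)"
  using range by unfold_locales

lemma ev2: "\<forall>\<^sub>F n in sequentially. n \<ge> (2::nat)"
  by (rule eventually_ge_at_top)

lemma mu_ge: "n \<ge> 2 \<Longrightarrow> ln 2 \<le> mu n"
  using block_sizes.log_mean_ge[OF block_sizes] .

lemma mu_pos: "n \<ge> 2 \<Longrightarrow> 0 < mu n"
  using block_sizes.log_mean_pos[OF block_sizes] .

lemma m_pos: "n \<ge> 2 \<Longrightarrow> 0 < m n"
  using mu_pos by (simp add: m_def)

lemma m_at_top: "filterlim m at_top sequentially"
proof -
  have "\<forall>\<^sub>F n in sequentially. 0 < mu n / ln (real n)"
    using ev2 by eventually_elim (use mu_pos in simp)
  then have "filterlim (\<lambda>n. inverse (mu n / ln (real n))) at_top sequentially"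
    by (rule filterlim_inverse_at_top[OF log_mean_small])
  moreover have "(\<lambda>n. inverse (mu n / ln (real n))) = m" by (simp add: fun_eq_iff m_def)
  ultimately show ?thesis by simp
qed

lemma inverse_sqrt_m: "(\<lambda>n. 1 / sqrt (m n)) \<longlonglongrightarrow> 0"
proof -
  have "filterlim (\<lambda>n. sqrt (m n)) at_top sequentially"
    by (rule filterlim_compose[OF sqrt_at_top m_at_top])
  from tendsto_inverse_0_at_top[OF this] show ?thesis by (simp add: divide_inverse)
qed

text \<open>Once \<open>mu n\<close> is below half of \<open>ln n\<close>, the bound
  \<open>exp (mu n) / n\<close> on the hit probability is at most the inverse square root of
  \<open>n\<close>.\<close>

lemma hit_tendsto_0: "hit \<longlonglongrightarrow> 0"
proof (rule tendsto_sandwich)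
  show "\<forall>\<^sub>F n in sequentially. 0 \<le> hit n"
    using ev2 by eventually_elim (use block_sizes.q_bounds(1)[OF block_sizes] in \<open>auto intro: less_imp_le\<close>)
  have "\<forall>\<^sub>F n in sequentially. mu n / ln (real n) < 1 / 2"
    by (rule order_tendstoD(2)[OF log_mean_small]) simp
  with ev2 show "\<forall>\<^sub>F n in sequentially. hit n \<le> 1 / sqrt (real n)"
  proof eventually_elim
    case (elim n)
    have ln: "ln (real n) > 0" using elim by simp
    have "hit n \<le> exp (mu n) / real n" by (rule block_sizes.q_le[OF block_sizes[OF elim(1)]])
    also have "mu n \<le> ln (sqrt (real n))" using elim ln by (simp add: ln_sqrt field_simps)
    then have "exp (mu n) / real n \<le> exp (ln (sqrt (real n))) / real n" by (intro divide_right_mono) auto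
    also have "\<dots> = 1 / sqrt (real n)" using elim by (simp add: real_sqrt_divide field_simps)
    finally show ?case .
  qed
  show "(\<lambda>n. 1 / sqrt (real n)) \<longlonglongrightarrow> 0"
  proof -
    have "filterlim (\<lambda>n. sqrt (real n)) at_top sequentially"
      by (rule filterlim_compose[OF sqrt_at_top filterlim_real_sequentially])
    from tendsto_inverse_0_at_top[OF this] show ?thesis by (simp add: divide_inverse)
  qed
qed simp

lemma spread_ge: "n \<ge> 2 \<Longrightarrow> sqrt (m n) * mu n \<le> spread n"
  unfolding block_sizes.scale_def[OF block_sizes] m_def
  using mu_pos[of n] by (intro mult_left_mono real_le_rsqrt) auto

lemma spread_pos: "n \<ge> 2 \<Longrightarrow> 0 < spread n"
  using block_sizes.scale_pos[OF block_sizes] .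

text \<open>For \<open>n < 2\<close> the law of the block sizes is unconstrained; the normal law is a placeholder there.\<close>

definition std_laws :: "(nat \<Rightarrow> nat) \<Rightarrow> nat \<Rightarrow> real measure" where
  "std_laws T n = (if n \<ge> 2 then block_sizes.std_law n (p n) (T n) else std_normal_distribution)"

lemma real_distribution_std_laws: "real_distribution (std_laws T n)"
  using block_sizes.real_distribution_std_law[OF block_sizes] real_dist_normal_dist by (simp add: std_laws_def)

lemma std_laws_weak_conv:
  assumes T: "(\<lambda>n. T n * hit n / m n) \<longlonglongrightarrow> 1"
  shows "weak_conv_m (std_laws T) std_normal_distribution"
proof (rule levy_continuity[OF real_distribution_std_laws real_dist_normal_dist])
  fix s :: real
  define \<kappa> where "\<kappa> n = T n * hit n / m n" for n
  define r where "r n = 1 / sqrt (m n)" for n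
  define R where "R n = norm (block_sizes.cchar (p n) (s / spread n) ^ nat \<lfloor>m n\<rfloor>
      - exp (- (s\<^sup>2 / 2 * (1 - (mu n)\<^sup>2 / ((mu n)\<^sup>2 + (sd n)\<^sup>2)))))" for n
  have \<kappa>: "\<kappa> \<longlonglongrightarrow> 1" and r: "r \<longlonglongrightarrow> 0"
    using T inverse_sqrt_m unfolding \<kappa>_def r_def by auto
  have R: "R \<longlonglongrightarrow> 0" unfolding R_def m_def by (rule tendsto_norm_zero[OF cchar_power])
  have lim: "(\<lambda>n. exp 2 * \<kappa> n * hit n * (\<bar>s\<bar> + s\<^sup>2 * r n)\<^sup>2 + 2 * \<kappa> n * \<bar>s\<bar> ^ 3 * r n + (\<bar>\<kappa> n - 1\<bar> + (r n)\<^sup>2) * s\<^sup>2 +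
    exp 2 * s ^ 4 * (r n)\<^sup>2 + R n + s\<^sup>2 * \<bar>\<kappa> n - 1\<bar>) \<longlonglongrightarrow>
    exp 2 * 1 * 0 * (\<bar>s\<bar> + s\<^sup>2 * 0)\<^sup>2 + 2 * 1 * \<bar>s\<bar> ^ 3 * 0 + (\<bar>1 - 1\<bar> + 0\<^sup>2) * s\<^sup>2 +
    exp 2 * s ^ 4 * 0\<^sup>2 + 0 + s\<^sup>2 * \<bar>1 - 1\<bar>"
    by (intro tendsto_intros \<kappa> r R hit_tendsto_0)
  have "(\<lambda>n. char (std_laws T n) s - exp (- (s\<^sup>2 / 2))) \<longlonglongrightarrow> 0"
  proof (rule Lim_null_comparison)
    show "\<forall>\<^sub>F n in sequentially. norm (char (std_laws T n) s - exp (- (s\<^sup>2 / 2))) \<le>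
      exp 2 * \<kappa> n * hit n * (\<bar>s\<bar> + s\<^sup>2 * r n)\<^sup>2 + 2 * \<kappa> n * \<bar>s\<bar> ^ 3 * r n + (\<bar>\<kappa> n - 1\<bar> + (r n)\<^sup>2) * s\<^sup>2 +
      exp 2 * s ^ 4 * (r n)\<^sup>2 + R n + s\<^sup>2 * \<bar>\<kappa> n - 1\<bar>"
      using ev2
    proof eventually_elim
      case (elim n)
      then show ?case
        using block_sizes.norm_char_std_law_le[OF block_sizes[OF elim], of "T n" s]
        by (simp only: std_laws_def if_True \<kappa>_def r_def R_def m_def)
    qed
  qed (use lim in simp)
  then have "(\<lambda>n. char (std_laws T n) s) \<longlonglongrightarrow> exp (- (s\<^sup>2 / 2))"
    by (rule LIM_zero_cancel)
  then show "(\<lambda>n. char (std_laws T n) s) \<longlonglongrightarrow> char std_normal_distribution s"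
    by (simp add: char_std_normal_distribution)
qed

text \<open>The factor \<theta> moves the threshold by \<open>ln \<theta>\<close> only, which is
  negligible against \<open>spread n\<close>. So the heavy masses above \<open>1 / n\<close> and
  above any fixed multiple of it have the same limiting mean.\<close>

lemma survival_tendsto:
  assumes T: "(\<lambda>n. T n * hit n / m n) \<longlonglongrightarrow> 1" and y: "bounded (range y)"
    and Ty: "(\<lambda>n. (m n - T n * hit n) * mu n / spread n - y n) \<longlonglongrightarrow> 0" and \<theta>: "0 < \<theta>"
  shows "(\<lambda>n. survival n (p n) (\<theta> / real n) (T n) 1 - std_normal_cdf (y n)) \<longlonglongrightarrow> 0"
proof -
  define x where "x n = (- ln (\<theta> / real n) - T n * hit n * mu n) / spread n" for n
  have small: "(\<lambda>n. ln \<theta> / spread n) \<longlonglongrightarrow> 0"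
  proof (rule Lim_null_comparison)
    show "\<forall>\<^sub>F n in sequentially. norm (ln \<theta> / spread n) \<le> \<bar>ln \<theta>\<bar> / ln 2 * (1 / sqrt (m n))"
      using ev2
    proof eventually_elim
      case (elim n)
      have "sqrt (m n) * ln 2 \<le> sqrt (m n) * mu n" using mu_ge[OF elim] m_pos[OF elim] by (intro mult_left_mono) auto
      also have "\<dots> \<le> spread n" by (rule spread_ge[OF elim])
      finally have "\<bar>ln \<theta>\<bar> / spread n \<le> \<bar>ln \<theta>\<bar> / (sqrt (m n) * ln 2)"
        using m_pos[OF elim] by (intro divide_left_mono) (auto intro: mult_pos_pos spread_pos[OF elim])
      then show ?case using spread_pos[OF elim] by (simp add: mult.commute)
    qed
    show "(\<lambda>n. \<bar>ln \<theta>\<bar> / ln 2 * (1 / sqrt (m n))) \<longlonglongrightarrow> 0"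
      using tendsto_mult_right_zero[OF inverse_sqrt_m] .
  qed
  have "(\<lambda>n. (m n - T n * hit n) * mu n / spread n - y n - ln \<theta> / spread n) \<longlonglongrightarrow> 0 - 0"
    by (rule tendsto_diff[OF Ty small])
  moreover have "\<forall>\<^sub>F n in sequentially. (m n - T n * hit n) * mu n / spread n - y n - ln \<theta> / spread n = x n - y n"
    using ev2
  proof eventually_elim
    case (elim n)
    have "m n * mu n = ln (real n)" using mu_pos[OF elim] by (simp add: m_def)
    moreover have "ln (\<theta> / real n) = ln \<theta> - ln (real n)" using \<theta> elim by (simp add: ln_div)
    ultimately show ?case by (simp add: x_def left_diff_distrib diff_divide_distrib)
  qed
  ultimately have "(\<lambda>n. x n - y n) \<longlonglongrightarrow> 0" by (simp add: filterlim_cong)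
  from cdf_tendsto_moving[OF real_distribution_std_laws std_laws_weak_conv[OF T] y this]
  have "(\<lambda>n. cdf (std_laws T n) (x n) - std_normal_cdf (y n)) \<longlonglongrightarrow> 0" .
  moreover have "\<forall>\<^sub>F n in sequentially. cdf (std_laws T n) (x n) - std_normal_cdf (y n) =
    survival n (p n) (\<theta> / real n) (T n) 1 - std_normal_cdf (y n)"
    using ev2
  proof eventually_elim
    case (elim n)
    then show ?case using block_sizes.survival_eq_cdf[OF block_sizes[OF elim], of "\<theta> / real n" "T n"] \<theta>
      by (simp add: std_laws_def x_def)
  qed
  ultimately show ?thesis by (simp add: filterlim_cong)
qed

end


section \<open>Deviation bounds at fixed \<open>n\<close>\<close>

context block_process
begin

text \<open>The mean over \<open>s + j\<close> blocks is exact, whereas the second moment is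
  compared with survival over \<open>j\<close> blocks. Both survival probabilities approach the same
  limit when \<open>s\<close> is negligible in the window, and then the square completes.\<close>

lemma EL_heavy_dev_le:
  defines "\<And>K. tail K \<equiv> measure_pmf.expectation p (\<lambda>k. if K < k then real k / real n else 0)"
  shows "EL (s + j) (\<lambda>l. (heavy u l - \<phi>)\<^sup>2) \<le>
    (survival n p u j 1)\<^sup>2 - 2 * \<phi> * survival n p u (s + j) 1 + \<phi>\<^sup>2 +
    real j * (q * (real K + 1) / real n + tail K) + 2 * (1 - a) ^ s"
proof -
  have "EL (s + j) (\<lambda>l. (heavy u l - \<phi>)\<^sup>2) = EL (s + j) (\<lambda>l. (heavy u l)\<^sup>2) - 2 * \<phi> * EL (s + j) (heavy u) + \<phi>\<^sup>2"
    by (simp add: power2_diff mult_ac)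
  then show ?thesis using EL_heavy_sq[of s j u K] unfolding EL_heavy tail_def by linarith
qed

text \<open>A distance below \<phi> forces the heavy mass above \<open>\<theta> / n\<close> to be
  low, up to the error \<open>1 / \<theta> \<le> \<epsilon> / 4\<close> from its carrier. A distance
  above \<phi> forces either the heavy mass above \<open>1 / n\<close>, taken \<open>s\<close>
  blocks earlier, to be high, or the light deviation to be large. Chebyshev's inequality bounds all
  three events.\<close>

lemma prob_tv_dev_le:
  assumes \<epsilon>: "\<epsilon> > 0" and \<theta>: "\<theta> > 0" "4 \<le> \<epsilon> * \<theta>"
  shows "measure_pmf.prob (blocks_law n p (t + s)) {l. \<epsilon> < \<bar>tv_norm n (\<lambda>x. mass x0 l x - 1 / real n) - \<phi>\<bar>} \<le>
    4 / \<epsilon>\<^sup>2 * EL (t + s) (\<lambda>l. (heavy (\<theta> / real n) l - \<phi>)\<^sup>2) + 4 / \<epsilon>\<^sup>2 * EL t (\<lambda>l. (heavy (1 / real n) l - \<phi>)\<^sup>2) +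
    2 * (1 - a) ^ s / \<epsilon>\<^sup>2"
proof -
  let ?S = "{l. \<epsilon> < \<bar>tv_norm n (\<lambda>x. mass x0 l x - 1 / real n) - \<phi>\<bar>}"
  let ?A = "\<lambda>l. (heavy (\<theta> / real n) l - \<phi>)\<^sup>2" and ?B = "\<lambda>l. (heavy (1 / real n) (drop s l) - \<phi>)\<^sup>2"
  let ?E = "\<lambda>l. \<Sum>x\<in>{1..n}. (evolve (light_dev (1 / real n)) s l x)\<^sup>2"
  have "measure_pmf.prob (blocks_law n p (t + s)) ?S = EL (t + s) (indicator ?S)" by simp
  also have "\<dots> \<le> EL (t + s) (\<lambda>l. 4 / \<epsilon>\<^sup>2 * ?A l + 4 / \<epsilon>\<^sup>2 * ?B l + real n / \<epsilon>\<^sup>2 * ?E l)"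
  proof (rule EL_mono)
    fix l :: "nat set list" assume l: "valid l" "length l = t + s"
    let ?tv = "tv_norm n (\<lambda>x. mass x0 l x - 1 / real n)"
    have "0 \<le> ?E l" by (rule sum_nonneg) simp
    then have nonneg: "0 \<le> 4 / \<epsilon>\<^sup>2 * ?A l" "0 \<le> 4 / \<epsilon>\<^sup>2 * ?B l" "0 \<le> real n / \<epsilon>\<^sup>2 * ?E l"
      by (auto simp del: One_nat_def intro: mult_nonneg_nonneg divide_nonneg_nonneg)
    have sq: "1 \<le> 4 / \<epsilon>\<^sup>2 * x\<^sup>2" if "\<epsilon> / 2 \<le> \<bar>x\<bar>" for x :: real
    proof -
      have "(\<epsilon> / 2)\<^sup>2 \<le> x\<^sup>2" using that \<epsilon> by (metis abs_of_nonneg abs_le_square_iff half_gt_zero_iff less_imp_le)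
      then show ?thesis using \<epsilon> by (simp add: power_divide field_simps)
    qed
    have "1 \<le> 4 / \<epsilon>\<^sup>2 * ?A l + 4 / \<epsilon>\<^sup>2 * ?B l + real n / \<epsilon>\<^sup>2 * ?E l" if dev: "\<epsilon> < \<bar>?tv - \<phi>\<bar>"
    proof (cases "?tv < \<phi>")
      case True
      have "heavy (\<theta> / real n) l \<le> ?tv + 1 / \<theta>"
        using heavy_le_tv[OF l(1), of "\<theta> / real n"] \<theta> n_pos by simp
      moreover have "1 / \<theta> \<le> \<epsilon> / 4" using \<theta> by (simp add: field_simps)
      ultimately have "\<epsilon> / 2 \<le> \<bar>heavy (\<theta> / real n) l - \<phi>\<bar>" using dev True \<epsilon> by linarith
      from sq[OF this] show ?thesis using nonneg by linarith
    next
      case False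
      have "?tv \<le> heavy (1 / real n) (drop s l) + (1/2) * sqrt (real n * ?E l)"
        using l by (intro tv_le_heavy) auto
      then consider "\<epsilon> / 2 \<le> \<bar>heavy (1 / real n) (drop s l) - \<phi>\<bar>" | "\<epsilon> \<le> sqrt (real n * ?E l)"
        using dev False by linarith
      then show ?thesis
      proof cases
        case 1
        from sq[OF this] show ?thesis using nonneg by linarith
      next
        case 2
        then have "\<epsilon>\<^sup>2 \<le> (sqrt (real n * ?E l))\<^sup>2" using \<epsilon> by (intro power_mono) auto
        also have "\<dots> = real n * ?E l" by (simp add: sum_nonneg)
        finally have "1 \<le> real n / \<epsilon>\<^sup>2 * ?E l" using \<epsilon> by (simp add: field_simps)
        then show ?thesis using nonneg by linarith
      qed
    qed
    then show "indicator ?S l \<le> 4 / \<epsilon>\<^sup>2 * ?A l + 4 / \<epsilon>\<^sup>2 * ?B l + real n / \<epsilon>\<^sup>2 * ?E l"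
      using nonneg by (auto simp: indicator_def simp del: One_nat_def)
  qed
  also have "\<dots> = 4 / \<epsilon>\<^sup>2 * EL (t + s) ?A + 4 / \<epsilon>\<^sup>2 * EL (t + s) ?B + real n / \<epsilon>\<^sup>2 * EL (t + s) ?E"
    by (simp del: One_nat_def)
  also have "EL (t + s) ?B = EL t (\<lambda>l. (heavy (1 / real n) l - \<phi>)\<^sup>2)"
    by (rule EL_drop)
  also have "real n / \<epsilon>\<^sup>2 * EL (t + s) ?E \<le> real n / \<epsilon>\<^sup>2 * ((1 - a) ^ s * (1 / real n + 1 / real n))"
  proof (rule mult_left_mono)
    have "EL (t + s) ?E \<le> (1 - b) ^ s * (1 / real n + 1 / real n)"
      by (rule EL_evolve_light_dev) simp
    also have "\<dots> \<le> (1 - a) ^ s * (1 / real n + 1 / real n)"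
      using a_bounds by (intro mult_right_mono power_mono) auto
    finally show "EL (t + s) ?E \<le> (1 - a) ^ s * (1 / real n + 1 / real n)" .
  qed simp
  also have "\<dots> = 2 * (1 - a) ^ s / \<epsilon>\<^sup>2" using n_pos by simp
  finally show ?thesis by simp
qed

end

section \<open>Reduction of the two scenarios to a common limit\<close>

lemma divide_self_le_1: "x / x \<le> (1 :: real)"
  by (cases "x = 0") auto

text \<open>With \<sigma> zero the size-biased logarithm is constant, \<open>cchar\<close> is
  identically one and the whole Gaussian fluctuation comes from the number of hits.\<close>

lemma scenario1_averaging_sequence:
  assumes range: "\<And>n. n \<ge> 2 \<Longrightarrow> set_pmf (p n) \<subseteq> {2..n}" and sc: "scenario1 p"
  shows "averaging_sequence p"
proof
  have bs: "block_sizes n (p n)" if "n \<ge> 2" for n using range[OF that] that by unfold_locales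
  have sd0: "log_sd (p n) = 0" if "n \<ge> 2" for n using sc that by (simp add: scenario1_def)
  show "set_pmf (p n) \<subseteq> {2..n}" if "n \<ge> 2" for n by (rule range[OF that])
  show "(\<lambda>n. log_mean (p n) / ln (real n)) \<longlonglongrightarrow> 0" using sc by (simp add: scenario1_def)
  show "(\<lambda>n. (log_sd (p n))\<^sup>2 / (log_mean (p n) * ln (real n))) \<longlonglongrightarrow> 0"
    by (rule tendsto_eventually, rule eventually_mono[OF eventually_ge_at_top[of 2]]) (simp add: sd0)
  fix s
  show "(\<lambda>n. block_sizes.cchar (p n) (s / block_sizes.scale n (p n)) ^ nat \<lfloor>ln (real n) / log_mean (p n)\<rfloor>
      - exp (- (s\<^sup>2 / 2 * (1 - (log_mean (p n))\<^sup>2 / ((log_mean (p n))\<^sup>2 + (log_sd (p n))\<^sup>2))))) \<longlonglongrightarrow> 0"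
  proof (rule tendsto_eventually, rule eventually_mono[OF eventually_ge_at_top[of 2]])
    fix n :: nat assume n: "2 \<le> n"
    have "norm (block_sizes.cchar (p n) x - 1) \<le> x\<^sup>2 * (log_sd (p n))\<^sup>2 / 2" for x
      by (rule block_sizes.norm_cchar_minus_1[OF bs[OF n]])
    then have "block_sizes.cchar (p n) x = 1" for x by (simp add: sd0[OF n])
    then show "block_sizes.cchar (p n) (s / block_sizes.scale n (p n)) ^ nat \<lfloor>ln (real n) / log_mean (p n)\<rfloor>
      - exp (- (s\<^sup>2 / 2 * (1 - (log_mean (p n))\<^sup>2 / ((log_mean (p n))\<^sup>2 + (log_sd (p n))\<^sup>2)))) = 0"
      using block_sizes.log_mean_pos[OF bs[OF n]] by (simp add: sd0[OF n])
  qed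
qed

text \<open>The assumed tail limits amount, by Levy's theorem, to convergence of
  \<open>cchar\<close> powers at each fixed argument \<open>c\<close>. The claim needs the moving
  argument \<open>c n\<close>, bounded by \<open>s\<close>: on a subsequence where it tends to
  \<open>l\<close>, the powers at \<open>c n\<close> and at \<open>l\<close> are compared through
  \<open>cchar_lipschitz\<close>.\<close>

lemma scenario2_averaging_sequence:
  assumes range: "\<And>n. n \<ge> 2 \<Longrightarrow> set_pmf (p n) \<subseteq> {2..n}" and sc: "scenario2 p"
  shows "averaging_sequence p"
proof
  have bs: "block_sizes n (p n)" if "n \<ge> 2" for n using range[OF that] that by unfold_locales
  let ?mu = "\<lambda>n. log_mean (p n)" and ?sd = "\<lambda>n. log_sd (p n)"
  define m where "m n = ln (real n) / ?mu n" for n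
  define M where "M n = nat \<lfloor>m n\<rfloor>" for n
  have sd_pos: "0 < ?sd n" if "n \<ge> 3" for n
    using sc that block_sizes.log_sd_nonneg[OF bs, of n] by (force simp: scenario2_def order_less_le)
  have mu_pos: "0 < ?mu n" if "n \<ge> 2" for n by (rule block_sizes.log_mean_pos[OF bs[OF that]])
  have m_pos: "0 < m n" if "n \<ge> 2" for n using mu_pos that by (simp add: m_def)
  show "set_pmf (p n) \<subseteq> {2..n}" if "n \<ge> 2" for n by (rule range[OF that])
  show "(\<lambda>n. log_mean (p n) / ln (real n)) \<longlonglongrightarrow> 0"
    "(\<lambda>n. (log_sd (p n))\<^sup>2 / (log_mean (p n) * ln (real n))) \<longlonglongrightarrow> 0" using sc by (auto simp: scenario2_def)
  have iid: "(\<lambda>n. block_sizes.cchar (p n) (c / (?sd n * sqrt (m n))) ^ M n) \<longlonglongrightarrow> exp (- (c\<^sup>2 / 2))" for c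
  proof -
    define f where "f n k = sqrt (?mu n / ln (real n)) * ((ln (real k) - ?mu n) / ?sd n)" for n k
    define N where "N n = distr (iid_size_biased (p n)) borel (\<lambda>Y. \<Sum>s=1..M n. f n (Y s))" for n
    have meas: "(\<lambda>Y. \<Sum>s=1..M n. f n (Y s)) \<in> borel_measurable (iid_size_biased (p n))" for n
      by (intro borel_measurable_sum measurable_iid_coordinate) auto
    have N: "real_distribution (N n)" for n
      unfolding N_def by (rule prob_space.real_distribution_distr[OF prob_space_iid_size_biased meas])
    have "(\<lambda>n. cdf (N n) x) \<longlonglongrightarrow> std_normal_cdf x" for x
    proof -
      have "cdf (N n) x = 1 - measure (iid_size_biased (p n))
           {Y \<in> space (iid_size_biased (p n)).
              sqrt (log_mean (p n) / ln (real n)) *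
              (\<Sum>s = 1..nat \<lfloor>ln (real n) / log_mean (p n)\<rfloor>.
                 (ln (real (Y s)) - log_mean (p n)) / log_sd (p n)) > x}" for n
      proof -
        interpret prob_space "iid_size_biased (p n)" by (rule prob_space_iid_size_biased)
        have "cdf (N n) x = prob ((\<lambda>Y. \<Sum>s=1..M n. f n (Y s)) -` {..x} \<inter> space (iid_size_biased (p n)))"
          unfolding cdf_def N_def by (rule measure_distr[OF meas]) simp
        also have "\<dots> = prob (space (iid_size_biased (p n)) - {Y \<in> space (iid_size_biased (p n)). (\<Sum>s=1..M n. f n (Y s)) > x})"
          by (rule arg_cong[where f = prob]) auto
        also have "\<dots> = 1 - prob {Y \<in> space (iid_size_biased (p n)). (\<Sum>s=1..M n. f n (Y s)) > x}"
          using measurable_sets[OF meas, of "{x<..}" n]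
          by (intro prob_compl) (simp add: vimage_def Int_def conj_commute)
        finally show ?thesis by (simp add: f_def M_def m_def sum_distrib_left)
      qed
      moreover have "(\<lambda>n. 1 - measure (iid_size_biased (p n))
           {Y \<in> space (iid_size_biased (p n)).
              sqrt (log_mean (p n) / ln (real n)) *
              (\<Sum>s = 1..nat \<lfloor>ln (real n) / log_mean (p n)\<rfloor>.
                 (ln (real (Y s)) - log_mean (p n)) / log_sd (p n)) > x}) \<longlonglongrightarrow> 1 - std_normal_cdf (- x)"
        using sc unfolding scenario2_def by (intro tendsto_intros) blast
      ultimately show ?thesis by (simp add: std_normal_cdf_uminus)
    qed
    then have "weak_conv_m N std_normal_distribution"
      by (simp add: weak_conv_m_def weak_conv_def std_normal_cdf_def)
    then have "(\<lambda>n. char (N n) c) \<longlonglongrightarrow> char std_normal_distribution c"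
      by (rule levy_continuity1[OF N real_dist_normal_dist])
    moreover have "\<forall>\<^sub>F n in sequentially. char (N n) c = block_sizes.cchar (p n) (c / (?sd n * sqrt (m n))) ^ M n"
      using eventually_ge_at_top[of 2]
    proof eventually_elim
      case (elim n)
      have "c * f n k = c / (?sd n * sqrt (m n)) * (ln (real k) - ?mu n)" for k
        by (simp add: f_def m_def real_sqrt_divide mult_ac)
      then show ?case unfolding N_def char_iid_sum block_sizes.cchar_def[OF bs[OF elim]] by simp
    qed
    ultimately have "(\<lambda>n. block_sizes.cchar (p n) (c / (?sd n * sqrt (m n))) ^ M n) \<longlonglongrightarrow> char std_normal_distribution c"
      using tendsto_cong by force
    then show ?thesis by (simp add: char_std_normal_distribution)
  qed
  fix s :: real
  \<comment> \<open>Chosen so that \<open>c n / (\<sigma> * sqrt m)\<close> equals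
    \<open>s / scale\<close>; its square is the share \<open>1 - w\<close> of \<open>s\<close>
    squared.\<close>
  define c where "c n = s * (?sd n / sqrt ((?mu n)\<^sup>2 + (?sd n)\<^sup>2))" for n
  have c_le: "\<bar>c n\<bar> \<le> \<bar>s\<bar>" for n
  proof -
    have "\<bar>?sd n\<bar> \<le> sqrt ((?mu n)\<^sup>2 + (?sd n)\<^sup>2)" by (rule real_le_rsqrt) simp
    then have "\<bar>?sd n\<bar> / sqrt ((?mu n)\<^sup>2 + (?sd n)\<^sup>2) \<le> sqrt ((?mu n)\<^sup>2 + (?sd n)\<^sup>2) / sqrt ((?mu n)\<^sup>2 + (?sd n)\<^sup>2)"
      by (intro divide_right_mono) auto
    also have "\<dots> \<le> 1" by (rule divide_self_le_1)
    finally have "\<bar>?sd n / sqrt ((?mu n)\<^sup>2 + (?sd n)\<^sup>2)\<bar> \<le> 1" by (simp add: abs_divide)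
    then have "\<bar>s\<bar> * \<bar>?sd n / sqrt ((?mu n)\<^sup>2 + (?sd n)\<^sup>2)\<bar> \<le> \<bar>s\<bar>" by (intro mult_left_le) auto
    then show ?thesis by (simp add: c_def abs_mult)
  qed
  have "(\<lambda>n. block_sizes.cchar (p n) (s / block_sizes.scale n (p n)) ^ M n - exp (- ((c n)\<^sup>2 / 2))) \<longlonglongrightarrow> 0"
  proof (rule tendsto_zero_if_subseq_param)
    show "bounded (range c)" using c_le by (auto simp: bounded_iff)
    fix r l assume r: "strict_mono (r :: nat \<Rightarrow> nat)" and cl: "(\<lambda>k. c (r k)) \<longlonglongrightarrow> l"
    let ?F = "\<lambda>n. block_sizes.cchar (p n) (s / block_sizes.scale n (p n)) ^ M n"
    let ?G = "\<lambda>n. block_sizes.cchar (p n) (l / (?sd n * sqrt (m n))) ^ M n"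
    have diff: "norm (?F n - ?G n) \<le> (c n - l)\<^sup>2 / 2 + \<bar>c n - l\<bar> * \<bar>l\<bar>" if n3: "n \<ge> 3" for n
    proof -
      interpret block_sizes n "p n" using bs n3 by simp
      have pos: "0 < ?sd n" "0 < m n" "0 < ?mu n" using sd_pos[OF n3] m_pos[of n] mu_pos[of n] n3 by auto
      define w where "w = ?sd n * sqrt (m n)"
      have w: "w > 0" "w\<^sup>2 = (?sd n)\<^sup>2 * m n" using pos by (auto simp: w_def power_mult_distrib)
      have eq: "s / block_sizes.scale n (p n) = c n / w"
        using pos by (simp add: scale_def c_def w_def m_def)
      have M: "real (M n) \<le> m n" using pos by (simp add: M_def)
      have "norm (?F n - ?G n) \<le> M n * norm (cchar (c n / w) - cchar (l / w))"
        unfolding eq w_def[symmetric] by (rule norm_power_diff[OF norm_cchar norm_cchar])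
      also have "\<dots> \<le> m n * (((c n / w - l / w)\<^sup>2 / 2 + \<bar>c n / w - l / w\<bar> * \<bar>l / w\<bar>) * (?sd n)\<^sup>2)"
        using M by (intro mult_mono cchar_lipschitz) auto
      also have "\<dots> = (c n - l)\<^sup>2 / 2 + \<bar>c n - l\<bar> * \<bar>l\<bar>"
      proof -
        have "(c n / w - l / w)\<^sup>2 / 2 + \<bar>c n / w - l / w\<bar> * \<bar>l / w\<bar> = ((c n - l)\<^sup>2 / 2 + \<bar>c n - l\<bar> * \<bar>l\<bar>) / w\<^sup>2"
          using w(1) by (simp add: diff_divide_distrib[symmetric] power_divide abs_divide add_divide_distrib power2_eq_square)
        then show ?thesis unfolding w(2) using pos by simp
      qed
      finally show ?thesis .
    qed
    have "(\<lambda>k. (c (r k) - l)\<^sup>2 / 2 + \<bar>c (r k) - l\<bar> * \<bar>l\<bar>) \<longlonglongrightarrow> (l - l)\<^sup>2 / 2 + \<bar>l - l\<bar> * \<bar>l\<bar>"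
      by (intro tendsto_intros cl) simp
    then have lim0: "(\<lambda>k. (c (r k) - l)\<^sup>2 / 2 + \<bar>c (r k) - l\<bar> * \<bar>l\<bar>) \<longlonglongrightarrow> 0" by simp
    have FG: "(\<lambda>k. ?F (r k) - ?G (r k)) \<longlonglongrightarrow> 0"
    proof (rule Lim_null_comparison[OF _ lim0])
      have "r k \<ge> 3" if "k \<ge> 3" for k using seq_suble[OF r, of k] that by linarith
      then show "\<forall>\<^sub>F k in sequentially. norm (?F (r k) - ?G (r k)) \<le> (c (r k) - l)\<^sup>2 / 2 + \<bar>c (r k) - l\<bar> * \<bar>l\<bar>"
        using diff by (intro eventually_mono[OF eventually_ge_at_top[of 3]]) blast
    qed
    have G: "(\<lambda>k. ?G (r k)) \<longlonglongrightarrow> exp (- (l\<^sup>2 / 2))"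
      using LIMSEQ_subseq_LIMSEQ[OF iid r] by (simp add: o_def)
    have E: "(\<lambda>k. complex_of_real (exp (- ((c (r k))\<^sup>2 / 2)))) \<longlonglongrightarrow> complex_of_real (exp (- (l\<^sup>2 / 2)))"
      by (intro tendsto_intros cl) simp
    from tendsto_diff[OF tendsto_add[OF FG G] E]
    show "(\<lambda>k. ?F (r k) - exp (- ((c (r k))\<^sup>2 / 2))) \<longlonglongrightarrow> 0" by simp
  qed
  note lim = this
  have c_sq: "\<forall>\<^sub>F n in sequentially. (c n)\<^sup>2 / 2 = s\<^sup>2 / 2 * (1 - (?mu n)\<^sup>2 / ((?mu n)\<^sup>2 + (?sd n)\<^sup>2))"
    using eventually_ge_at_top[of 2]
  proof eventually_elim
    case (elim n)
    have "(?mu n)\<^sup>2 + (?sd n)\<^sup>2 > 0" using mu_pos[OF elim] by (simp add: add_pos_nonneg)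
    moreover have "1 - u / (u + v) = v / (u + v)" if "u + v > 0" for u v :: real
      using that by (simp add: field_simps)
    ultimately have "1 - (?mu n)\<^sup>2 / ((?mu n)\<^sup>2 + (?sd n)\<^sup>2) = (?sd n)\<^sup>2 / ((?mu n)\<^sup>2 + (?sd n)\<^sup>2)" by blast
    then show ?case by (simp add: c_def power_mult_distrib power_divide)
  qed
  from lim show "(\<lambda>n. block_sizes.cchar (p n) (s / block_sizes.scale n (p n)) ^ nat \<lfloor>ln (real n) / log_mean (p n)\<rfloor>
      - exp (- (s\<^sup>2 / 2 * (1 - (log_mean (p n))\<^sup>2 / ((log_mean (p n))\<^sup>2 + (log_sd (p n))\<^sup>2))))) \<longlonglongrightarrow> 0"
    unfolding M_def m_def
  proof (rule Lim_transform_eventually)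
    show "\<forall>\<^sub>F n in sequentially. block_sizes.cchar (p n) (s / block_sizes.scale n (p n)) ^ nat \<lfloor>ln (real n) / ?mu n\<rfloor> - exp (- ((c n)\<^sup>2 / 2)) =
      block_sizes.cchar (p n) (s / block_sizes.scale n (p n)) ^ nat \<lfloor>ln (real n) / ?mu n\<rfloor>
      - exp (- (s\<^sup>2 / 2 * (1 - (?mu n)\<^sup>2 / ((?mu n)\<^sup>2 + (?sd n)\<^sup>2))))"
      using c_sq by eventually_elim simp
  qed
qed

section \<open>Choice of times and conclusion\<close>

context averaging_sequence
begin

abbreviation rho :: "nat \<Rightarrow> real" where "rho n \<equiv> sd n / mu n"

lemma rho_nonneg: "n \<ge> 2 \<Longrightarrow> 0 \<le> rho n"
  using block_sizes.log_sd_nonneg[OF block_sizes] mu_pos[of n] by simp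

text \<open>The quotient is \<open>t_w / t_ent\<close>, so this says that the window is negligible
  against the cutoff time.\<close>

lemma rho_small: "(\<lambda>n. (1 + rho n) / sqrt (m n)) \<longlonglongrightarrow> 0"
proof -
  have "(\<lambda>n. sqrt ((sd n)\<^sup>2 / (mu n * ln (real n)))) \<longlonglongrightarrow> sqrt 0"
    by (intro tendsto_intros log_sd_small)
  moreover have "\<forall>\<^sub>F n in sequentially. sqrt ((sd n)\<^sup>2 / (mu n * ln (real n))) = rho n / sqrt (m n)"
    using ev2
  proof eventually_elim
    case (elim n)
    have "mu n * ln (real n) = (mu n)\<^sup>2 * m n" using mu_pos[OF elim] by (simp add: m_def power2_eq_square)
    then show ?case using mu_pos[OF elim] block_sizes.log_sd_nonneg[OF block_sizes[OF elim]]
      by (simp add: real_sqrt_divide real_sqrt_mult)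
  qed
  ultimately have "(\<lambda>n. rho n / sqrt (m n)) \<longlonglongrightarrow> 0" by (simp add: filterlim_cong)
  from tendsto_add[OF inverse_sqrt_m this] show ?thesis by (simp add: add_divide_distrib)
qed

text \<open>\<open>relax\<close> is long compared with the relaxation time \<open>1 / hit\<close>, yet negligible in the window \<open>t_w\<close>.\<close>

definition relax :: "nat \<Rightarrow> nat" where "relax n = nat \<lceil>sqrt (sqrt (m n)) / hit n\<rceil>"
text \<open>One relaxation length is spent on flattening the light part and another on the burn-in,
  so \<open>j\<close> up to two occurs. The truncated subtraction is genuine for large
  \<open>n\<close>, by \<open>time_approx\<close>.\<close>

definition time :: "real \<Rightarrow> nat \<Rightarrow> nat \<Rightarrow> nat" where
  "time \<beta> j n = nat \<lfloor>t_ent n (p n) + \<beta> * t_w n (p n)\<rfloor> - j * relax n"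
definition centre :: "real \<Rightarrow> nat \<Rightarrow> real" where
  "centre \<beta> n = - \<beta> * ((1 + rho n) / sqrt (1 + (rho n)\<^sup>2))"

lemma hit_pos: "n \<ge> 2 \<Longrightarrow> 0 < hit n"
  using block_sizes.q_bounds(1)[OF block_sizes] .

lemma relax_bounds: "n \<ge> 2 \<Longrightarrow> sqrt (sqrt (m n)) \<le> relax n * hit n \<and> relax n * hit n \<le> sqrt (sqrt (m n)) + hit n"
proof -
  assume n: "n \<ge> 2"
  have q: "0 < hit n" by (rule hit_pos[OF n])
  have "0 \<le> sqrt (sqrt (m n)) / hit n" using m_pos[OF n] q by simp
  then have "sqrt (sqrt (m n)) / hit n \<le> real (relax n)" "real (relax n) \<le> sqrt (sqrt (m n)) / hit n + 1"
    unfolding relax_def by linarith+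
  then show ?thesis using q by (simp add: field_simps)
qed

lemma sqrt_sqrt_m_at_top: "filterlim (\<lambda>n. sqrt (sqrt (m n))) at_top sequentially"
  by (rule filterlim_compose[OF sqrt_at_top filterlim_compose[OF sqrt_at_top m_at_top]])

lemma sqrt_sqrt_m_small: "(\<lambda>n. sqrt (sqrt (m n)) / sqrt (m n)) \<longlonglongrightarrow> 0"
proof -
  have "sqrt (sqrt (m n)) / sqrt (m n) = sqrt (1 / sqrt (m n))" if "n \<ge> 2" for n
  proof -
    have "0 \<le> sqrt (m n)" using m_pos[OF that] by simp
    then show ?thesis by (simp only: sqrt_divide_self_eq real_sqrt_divide real_sqrt_one inverse_eq_divide)
  qed
  then have "\<forall>\<^sub>F n in sequentially. sqrt (1 / sqrt (m n)) = sqrt (sqrt (m n)) / sqrt (m n)"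
    by (intro eventually_mono[OF ev2]) simp
  moreover have "(\<lambda>n. sqrt (1 / sqrt (m n))) \<longlonglongrightarrow> sqrt 0"
    by (intro tendsto_intros inverse_sqrt_m)
  ultimately show ?thesis by (simp add: filterlim_cong)
qed

text \<open>Measured in expected hits: one term for rounding the time down, and an upper bound for
  each of the \<open>j\<close> relaxation lengths.\<close>

definition slack :: "nat \<Rightarrow> nat \<Rightarrow> real" where
  "slack j n = hit n + j * (sqrt (sqrt (m n)) + hit n)"

lemma slack_nonneg: "n \<ge> 2 \<Longrightarrow> 0 \<le> slack j n"
  using hit_pos[of n] m_pos[of n] by (simp add: slack_def)

lemma slack_small: "(\<lambda>n. slack j n / sqrt (m n)) \<longlonglongrightarrow> 0"
proof -
  have qs: "(\<lambda>n. hit n / sqrt (m n)) \<longlonglongrightarrow> 0"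
    using tendsto_mult[OF hit_tendsto_0 inverse_sqrt_m] by simp
  have "(\<lambda>n. hit n / sqrt (m n) + j * (sqrt (sqrt (m n)) / sqrt (m n) + hit n / sqrt (m n))) \<longlonglongrightarrow> 0 + real j * (0 + 0)"
    by (intro tendsto_intros qs sqrt_sqrt_m_small)
  moreover have "slack j n / sqrt (m n) = hit n / sqrt (m n) + j * (sqrt (sqrt (m n)) / sqrt (m n) + hit n / sqrt (m n))" for n
    by (simp add: slack_def add_divide_distrib distrib_left)
  ultimately show ?thesis by (simp only: add_0_right mult_zero_right)
qed

lemma sqrt_m_sq: "n \<ge> 2 \<Longrightarrow> sqrt (m n) * sqrt (m n) = m n"
  using m_pos[of n] by simp

lemma window_small: "(\<lambda>n. \<beta> * (1 + rho n) * sqrt (m n) / m n) \<longlonglongrightarrow> 0"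
proof (rule Lim_transform_eventually)
  show "(\<lambda>n. \<beta> * ((1 + rho n) / sqrt (m n))) \<longlonglongrightarrow> 0"
    using tendsto_mult_right_zero[OF rho_small] .
  show "\<forall>\<^sub>F n in sequentially. \<beta> * ((1 + rho n) / sqrt (m n)) = \<beta> * (1 + rho n) * sqrt (m n) / m n"
    using ev2
  proof eventually_elim
    case (elim n)
    have "sqrt (m n) \<noteq> 0" using m_pos[OF elim] by simp
    then have "x / sqrt (m n) = x * sqrt (m n) / (sqrt (m n) * sqrt (m n))" for x
      by (rule nonzero_mult_divide_mult_cancel_right[symmetric])
    from this[of "\<beta> * (1 + rho n)"] show ?case unfolding sqrt_m_sq[OF elim] times_divide_eq_right .
  qed
qed

lemma slack_m_small: "(\<lambda>n. slack j n / m n) \<longlonglongrightarrow> 0"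
proof (rule Lim_transform_eventually)
  show "(\<lambda>n. slack j n / sqrt (m n) * (1 / sqrt (m n))) \<longlonglongrightarrow> 0"
    using tendsto_mult[OF slack_small inverse_sqrt_m] by simp
  show "\<forall>\<^sub>F n in sequentially. slack j n / sqrt (m n) * (1 / sqrt (m n)) = slack j n / m n"
    using ev2 by eventually_elim (simp only: times_divide_times_eq mult_1_right sqrt_m_sq)
qed

text \<open>Multiplication by \<open>hit n\<close> turns a number of blocks into the expected number
  of hits of a site: \<open>t_ent\<close> becomes \<open>m n\<close> and \<open>t_w\<close> becomes
  \<open>(1 + rho n) * sqrt (m n)\<close>.\<close>

lemma time_approx:
  "\<forall>\<^sub>F n in sequentially. j * relax n \<le> nat \<lfloor>t_ent n (p n) + \<beta> * t_w n (p n)\<rfloor> \<and>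
    \<bar>time \<beta> j n * hit n - (m n + \<beta> * (1 + rho n) * sqrt (m n))\<bar> \<le> slack j n"
proof -
  have "(\<lambda>n. 1 + \<beta> * (1 + rho n) * sqrt (m n) / m n - slack j n / m n) \<longlonglongrightarrow> 1 + 0 - 0"
    by (intro tendsto_intros window_small slack_m_small)
  then have "\<forall>\<^sub>F n in sequentially. 0 < 1 + \<beta> * (1 + rho n) * sqrt (m n) / m n - slack j n / m n"
    by (rule order_tendstoD(1)) simp
  with ev2 show ?thesis
  proof eventually_elim
    case (elim n)
    define z where "z = m n + \<beta> * (1 + rho n) * sqrt (m n)"
    define x where "x = t_ent n (p n) + \<beta> * t_w n (p n)"
    have m: "m n > 0" and mu: "mu n > 0" and q: "hit n > 0" using elim m_pos mu_pos hit_pos by auto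
    have mean: "measure_pmf.expectation (p n) real > 0"
      using block_sizes.mean_bounds(1)[OF block_sizes[OF elim(1)]] by simp
    have qn: "hit n = measure_pmf.expectation (p n) real / real n"
      by (rule block_sizes.q_def[OF block_sizes[OF elim(1)]])
    have "t_ent n (p n) * hit n = m n"
      using mean elim(1) by (simp add: t_ent_def qn m_def)
    moreover have "t_w n (p n) * hit n = (1 + rho n) * sqrt (m n)"
      using mean elim(1) by (simp add: t_w_def qn m_def real_sqrt_divide)
    ultimately have xq: "x * hit n = z" by (simp add: x_def z_def distrib_right mult.assoc)
    have pos: "0 < (1 + \<beta> * (1 + rho n) * sqrt (m n) / m n - slack j n / m n) * m n"
      using elim(2) m by simp
    have "(1 + B / M - S / M) * M = M + B - S" if "M > 0" for B S M :: real
      using that by (simp add: algebra_simps)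
    then have "(1 + \<beta> * (1 + rho n) * sqrt (m n) / m n - slack j n / m n) * m n = z - slack j n"
      using m unfolding z_def by blast
    with pos have z: "slack j n < x * hit n" unfolding xq by linarith
    have sl: "0 \<le> slack j n" by (rule slack_nonneg[OF elim(1)])
    then have "x > 0" using z q by (metis le_less_trans zero_less_mult_pos2)
    then have fl: "real (nat \<lfloor>x\<rfloor>) \<le> x" "x - 1 \<le> real (nat \<lfloor>x\<rfloor>)" by linarith+
    have flq: "nat \<lfloor>x\<rfloor> * hit n \<le> z" "z - hit n \<le> nat \<lfloor>x\<rfloor> * hit n"
      using mult_right_mono[OF fl(1), of "hit n"] mult_right_mono[OF fl(2), of "hit n"] q
      by (simp_all add: xq left_diff_distrib)
    have rel: "real j * sqrt (sqrt (m n)) \<le> j * (relax n * hit n)" "j * (relax n * hit n) \<le> j * (sqrt (sqrt (m n)) + hit n)"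
      using relax_bounds[OF elim(1)] by (auto intro!: mult_left_mono)
    have "j * (relax n * hit n) \<le> nat \<lfloor>x\<rfloor> * hit n"
      using rel(2) flq(2) z unfolding xq slack_def by linarith
    then have "real (j * relax n) * hit n \<le> nat \<lfloor>x\<rfloor> * hit n" by simp
    then have le: "j * relax n \<le> nat \<lfloor>x\<rfloor>" using q by (metis mult_le_cancel_right_pos of_nat_le_iff)
    have "time \<beta> j n * hit n = nat \<lfloor>x\<rfloor> * hit n - j * (relax n * hit n)"
      using le by (simp add: time_def x_def of_nat_diff left_diff_distrib)
    moreover have "0 \<le> j * (relax n * hit n)" using q by simp
    ultimately have "\<bar>time \<beta> j n * hit n - z\<bar> \<le> slack j n"
      using flq rel(2) sl q unfolding slack_def by linarith
    then show ?case using le by (simp add: x_def z_def)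
  qed
qed

lemma time_ratio: "(\<lambda>n. time \<beta> j n * hit n / m n) \<longlonglongrightarrow> 1"
proof -
  have "(\<lambda>n. time \<beta> j n * hit n / m n - (1 + \<beta> * (1 + rho n) * sqrt (m n) / m n)) \<longlonglongrightarrow> 0"
  proof (rule Lim_null_comparison[OF _ slack_m_small[of j]])
    show "\<forall>\<^sub>F n in sequentially. norm (time \<beta> j n * hit n / m n - (1 + \<beta> * (1 + rho n) * sqrt (m n) / m n)) \<le> slack j n / m n"
      using ev2 time_approx[of j \<beta>]
    proof eventually_elim
      case (elim n)
      have m: "m n > 0" using elim m_pos by auto
      then have "time \<beta> j n * hit n / m n - (1 + \<beta> * (1 + rho n) * sqrt (m n) / m n) =
        (time \<beta> j n * hit n - (m n + \<beta> * (1 + rho n) * sqrt (m n))) / m n"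
        by (simp add: diff_divide_distrib add_divide_distrib)
      then show ?case using elim(2) m by (simp add: divide_right_mono)
    qed
  qed
  from tendsto_add[OF this tendsto_add[OF tendsto_const[of 1] window_small[of \<beta>]]] show ?thesis by simp
qed

text \<open>The factor in the limit appears here: \<open>spread n\<close> is
  \<open>sqrt (m n) * mu n * sqrt (1 + (rho n)\<^sup>2)\<close>, while the window carries
  \<open>(1 + rho n) * sqrt (m n)\<close>.\<close>

lemma time_centre: "(\<lambda>n. (m n - time \<beta> j n * hit n) * mu n / spread n - centre \<beta> n) \<longlonglongrightarrow> 0"
proof (rule Lim_null_comparison[OF _ slack_small[of j]])
  show "\<forall>\<^sub>F n in sequentially. norm ((m n - time \<beta> j n * hit n) * mu n / spread n - centre \<beta> n) \<le> slack j n / sqrt (m n)"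
    using ev2 time_approx[of j \<beta>]
  proof eventually_elim
    case (elim n)
    define e where "e = time \<beta> j n * hit n - (m n + \<beta> * (1 + rho n) * sqrt (m n))"
    have m: "m n > 0" and mu: "mu n > 0" using elim m_pos mu_pos by auto
    have "(mu n)\<^sup>2 + (sd n)\<^sup>2 = (mu n)\<^sup>2 * (1 + (rho n)\<^sup>2)" using mu by (simp add: power_divide distrib_left)
    then have sc: "spread n = sqrt (m n) * mu n * sqrt (1 + (rho n)\<^sup>2)"
      unfolding block_sizes.scale_def[OF block_sizes[OF elim(1)]] m_def using mu by (simp add: real_sqrt_mult)
    have one: "1 \<le> sqrt (1 + (rho n)\<^sup>2)" by simp
    then have root: "0 < sqrt (1 + (rho n)\<^sup>2)" by linarith
    have "(m n - time \<beta> j n * hit n) * mu n / spread n = (- \<beta> * (1 + rho n) * sqrt (m n) - e) / (sqrt (m n) * sqrt (1 + (rho n)\<^sup>2))"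
      unfolding sc e_def using mu by simp
    also have "\<dots> = centre \<beta> n - e / (sqrt (m n) * sqrt (1 + (rho n)\<^sup>2))"
      using m by (simp add: centre_def diff_divide_distrib del: real_sqrt_gt_0_iff)
    finally have "norm ((m n - time \<beta> j n * hit n) * mu n / spread n - centre \<beta> n) = \<bar>e\<bar> / (sqrt (m n) * sqrt (1 + (rho n)\<^sup>2))"
      using m root by (simp add: abs_mult)
    also have "\<dots> \<le> \<bar>e\<bar> / (sqrt (m n) * 1)"
      using m one root by (intro divide_left_mono mult_left_mono mult_pos_pos) auto
    also have "\<dots> \<le> slack j n / sqrt (m n)"
      using elim(2) m unfolding e_def by (simp add: divide_right_mono)
    finally show ?case .
  qed
qed

lemma bounded_centre: "bounded (range (centre \<beta>))"
proof -
  have "\<forall>\<^sub>F n in sequentially. norm (centre \<beta> n) \<le> 2 * \<bar>\<beta>\<bar>"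
    using ev2
  proof eventually_elim
    case (elim n)
    have "rho n \<le> sqrt (1 + (rho n)\<^sup>2)" "1 \<le> sqrt (1 + (rho n)\<^sup>2)" by (auto intro: real_le_rsqrt)
    then have "1 + rho n \<le> 2 * sqrt (1 + (rho n)\<^sup>2)" "0 < sqrt (1 + (rho n)\<^sup>2)" by linarith+
    then have "(1 + rho n) / sqrt (1 + (rho n)\<^sup>2) \<le> 2" by (subst pos_divide_le_eq)
    moreover have "0 \<le> (1 + rho n) / sqrt (1 + (rho n)\<^sup>2)" using rho_nonneg[OF elim] by simp
    ultimately have "\<bar>\<beta>\<bar> * \<bar>(1 + rho n) / sqrt (1 + (rho n)\<^sup>2)\<bar> \<le> \<bar>\<beta>\<bar> * 2" by (intro mult_left_mono) auto
    then show ?case by (simp add: centre_def abs_mult)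
  qed
  then have "Bseq (centre \<beta>)" by (rule BfunI)
  then show ?thesis by (simp add: Bseq_eq_bounded)
qed

lemma survival_time_tendsto:
  assumes "0 < \<theta>"
  shows "(\<lambda>n. survival n (p n) (\<theta> / real n) (time \<beta> j n) 1 - std_normal_cdf (centre \<beta> n)) \<longlonglongrightarrow> 0"
  by (rule survival_tendsto[OF time_ratio bounded_centre time_centre assms])

text \<open>The stationary part of the variance bound \<open>EL_heavy_sq\<close>, accumulated over
  \<open>time \<beta> j n\<close> blocks, with the cut between small and large blocks at the square
  root of \<open>n\<close>.\<close>

definition err :: "real \<Rightarrow> nat \<Rightarrow> nat \<Rightarrow> real" where
  "err \<beta> j n = time \<beta> j n * (hit n * (real (nat \<lfloor>sqrt (real n)\<rfloor>) + 1) / real n +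
     measure_pmf.expectation (p n) (\<lambda>k. if nat \<lfloor>sqrt (real n)\<rfloor> < k then real k / real n else 0))"

text \<open>There are about \<open>m n / hit n\<close> blocks, so the error per block must be
  \<open>hit n / m n\<close> times a vanishing quantity. For small blocks this quantity is of order
  \<open>ln n\<close> over the square root of \<open>n\<close>; for large ones
  \<open>tail_le\<close> supplies it from the two smallness assumptions.\<close>

lemma err_small: "err \<beta> j \<longlonglongrightarrow> 0"
proof (rule Lim_null_comparison)
  let ?b = "\<lambda>n. time \<beta> j n * hit n / m n * (2 / ln 2 * (ln (real n) / real n powr (1/2)) +
     4 * ((sd n)\<^sup>2 / (mu n * ln (real n)) + mu n / ln (real n)))"
  show "\<forall>\<^sub>F n in sequentially. norm (err \<beta> j n) \<le> ?b n"
    using ev2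
  proof eventually_elim
    case (elim n)
    have m: "m n > 0" and mu: "mu n > 0" and q: "hit n > 0" using elim m_pos mu_pos hit_pos by auto
    have ln: "ln (real n) > 0" using elim by simp
    let ?K = "nat \<lfloor>sqrt (real n)\<rfloor>"
    let ?tail = "measure_pmf.expectation (p n) (\<lambda>k. if ?K < k then real k / real n else 0)"
    have tail0: "0 \<le> ?tail" by (rule Bochner_Integration.integral_nonneg) simp
    have tail: "?tail \<le> 4 * hit n * ((sd n)\<^sup>2 + (mu n)\<^sup>2) / (ln (real n))\<^sup>2"
      by (rule block_sizes.tail_le[OF block_sizes[OF elim]])
    have sq: "1 \<le> sqrt (real n)" using elim by simp
    have "(real ?K + 1) / real n \<le> 2 / real n powr (1/2)"
    proof -
      have "real ?K + 1 \<le> 2 * sqrt (real n)" using sq by linarith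
      then have "(real ?K + 1) / real n \<le> 2 * sqrt (real n) / real n" by (intro divide_right_mono) auto
      also have "\<dots> = 2 / sqrt (real n)" using elim by (simp add: real_div_sqrt field_simps)
      finally show ?thesis using elim by (simp add: powr_half_sqrt)
    qed
    then have "hit n * ((real ?K + 1) / real n) \<le> hit n * (2 / real n powr (1/2))" using q by (intro mult_left_mono) auto
    \<comment> \<open>Since \<open>mu n\<close> is at least \<open>ln 2\<close>, the missing factor
      \<open>1 / m n\<close> is bought at the price of a logarithm.\<close>
    moreover have "1 \<le> ln (real n) / (ln 2 * m n)"
    proof -
      have "ln 2 * m n \<le> mu n * m n" using mu_ge[OF elim] m by (intro mult_right_mono) auto
      also have "\<dots> = ln (real n)" using mu by (simp add: m_def)
      finally show ?thesis using m by (simp add: field_simps)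
    qed
    then have "hit n * (2 / real n powr (1/2)) * 1 \<le> hit n * (2 / real n powr (1/2)) * (ln (real n) / (ln 2 * m n))"
      using q by (intro mult_left_mono) auto
    moreover have "4 * hit n * ((sd n)\<^sup>2 + (mu n)\<^sup>2) / (ln (real n))\<^sup>2 =
      hit n / m n * (4 * ((sd n)\<^sup>2 / (mu n * ln (real n)) + mu n / ln (real n)))"
      using mu ln by (simp add: m_def power2_eq_square field_simps)
    ultimately have "hit n * (real ?K + 1) / real n + ?tail \<le>
      hit n / m n * (2 / ln 2 * (ln (real n) / real n powr (1/2)) + 4 * ((sd n)\<^sup>2 / (mu n * ln (real n)) + mu n / ln (real n)))"
      using tail by (simp add: distrib_left mult_ac)
    then have "time \<beta> j n * (hit n * (real ?K + 1) / real n + ?tail) \<le> time \<beta> j n * (hit n / m n * (2 / ln 2 * (ln (real n) / real n powr (1/2)) + 4 * ((sd n)\<^sup>2 / (mu n * ln (real n)) + mu n / ln (real n))))"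
      by (intro mult_left_mono) auto
    moreover have "0 \<le> err \<beta> j n" using tail0 q by (simp add: err_def)
    ultimately show ?case by (simp add: err_def)
  qed
  have "?b \<longlonglongrightarrow> 1 * (2 / ln 2 * 0 + 4 * (0 + 0))"
    by (intro tendsto_intros time_ratio log_sd_small log_mean_small lim_ln_over_power) simp_all
  then show "?b \<longlonglongrightarrow> 0" by simp
qed

lemma relax_decay: "(\<lambda>n. (1 - block_sizes.a n (p n)) ^ relax n) \<longlonglongrightarrow> 0"
proof (rule Lim_null_comparison)
  show "\<forall>\<^sub>F n in sequentially. norm ((1 - block_sizes.a n (p n)) ^ relax n) \<le> exp (- (sqrt (sqrt (m n)) / 2))"
    using ev2
  proof eventually_elim
    case (elim n)
    interpret block_sizes n "p n" by (rule block_sizes[OF elim])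
    have "0 \<le> 1 - a" using a_bounds by simp
    moreover have "1 - a \<le> exp (- a)" using exp_ge_add_one_self[of "- a"] by simp
    ultimately have "(1 - a) ^ relax n \<le> exp (- a) ^ relax n" by (intro power_mono)
    also have "\<dots> = exp (- (relax n * a))" by (metis exp_of_nat_mult mult_minus_right)
    also have "\<dots> \<le> exp (- (sqrt (sqrt (m n)) / 2))"
    proof -
      have "relax n * (q / 2) \<le> relax n * a" using a_bounds by (intro mult_left_mono) auto
      then show ?thesis using relax_bounds[OF elim] by simp
    qed
    finally show ?case using \<open>0 \<le> 1 - a\<close> by simp
  qed
  have "filterlim (\<lambda>n. sqrt (sqrt (m n)) / 2) at_top sequentially"
    using filterlim_tendsto_pos_mult_at_top[OF tendsto_const[of "1/2 :: real"] _ sqrt_sqrt_m_at_top] by simp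
  then have "filterlim (\<lambda>n. - (sqrt (sqrt (m n)) / 2)) at_bot sequentially"
    by (simp add: filterlim_uminus_at_bot)
  then show "(\<lambda>n. exp (- (sqrt (sqrt (m n)) / 2))) \<longlonglongrightarrow> 0"
    by (rule filterlim_compose[OF exp_at_bot])
qed

text \<open>Bounds the mean square of \<open>heavy (\<theta> / n) - std_normal_cdf (centre \<beta> n)\<close> after \<open>time \<beta> j n\<close> blocks.\<close>

definition dev :: "real \<Rightarrow> real \<Rightarrow> nat \<Rightarrow> nat \<Rightarrow> real" where
  "dev \<theta> \<beta> j n = (survival n (p n) (\<theta> / real n) (time \<beta> (Suc j) n) 1)\<^sup>2
     - 2 * std_normal_cdf (centre \<beta> n) * survival n (p n) (\<theta> / real n) (time \<beta> j n) 1 + (std_normal_cdf (centre \<beta> n))\<^sup>2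
     + err \<beta> (Suc j) n + 2 * (1 - block_sizes.a n (p n)) ^ relax n"

lemma dev_small:
  assumes "0 < \<theta>"
  shows "dev \<theta> \<beta> j \<longlonglongrightarrow> 0"
proof -
  let ?g = "\<lambda>j n. survival n (p n) (\<theta> / real n) (time \<beta> j n) 1" and ?c = "\<lambda>n. std_normal_cdf (centre \<beta> n)"
  have lim: "(\<lambda>n. ?g j n - ?c n) \<longlonglongrightarrow> 0" for j by (rule survival_time_tendsto[OF assms])
  \<comment> \<open>The quadratic part of \<open>dev\<close> is rearranged as a difference of
    squares plus a multiple of a difference, each with one vanishing and one bounded factor.\<close>
  have "(\<lambda>n. (?g (Suc j) n - ?c n) * (?g (Suc j) n + ?c n)) \<longlonglongrightarrow> 0"
  proof (rule Lim_null_comparison)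
    have "\<bar>?g (Suc j) n - ?c n\<bar> * \<bar>?g (Suc j) n + ?c n\<bar> \<le> \<bar>?g (Suc j) n - ?c n\<bar> * 2" for n
      using survival_bounds[of n "p n" "\<theta> / real n" "time \<beta> (Suc j) n" 1] std_normal_cdf_bounds[of "centre \<beta> n"]
      by (intro mult_left_mono) auto
    then show "\<forall>\<^sub>F n in sequentially. norm ((?g (Suc j) n - ?c n) * (?g (Suc j) n + ?c n)) \<le> \<bar>?g (Suc j) n - ?c n\<bar> * 2"
      by (simp add: abs_mult)
    show "(\<lambda>n. \<bar>?g (Suc j) n - ?c n\<bar> * 2) \<longlonglongrightarrow> 0"
      by (intro tendsto_mult_left_zero tendsto_rabs_zero lim)
  qed
  moreover have "(\<lambda>n. 2 * ?c n * (?c n - ?g j n)) \<longlonglongrightarrow> 0"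
  proof (rule Lim_null_comparison)
    have "2 * \<bar>?c n\<bar> * \<bar>?c n - ?g j n\<bar> \<le> 2 * \<bar>?g j n - ?c n\<bar>" for n
      unfolding abs_minus_commute[of "?c n"]
      using std_normal_cdf_bounds[of "centre \<beta> n"] by (intro mult_right_mono) auto
    then show "\<forall>\<^sub>F n in sequentially. norm (2 * ?c n * (?c n - ?g j n)) \<le> 2 * \<bar>?g j n - ?c n\<bar>"
      by (simp add: abs_mult)
    show "(\<lambda>n. 2 * \<bar>?g j n - ?c n\<bar>) \<longlonglongrightarrow> 0"
      by (intro tendsto_mult_right_zero tendsto_rabs_zero lim)
  qed
  ultimately have "(\<lambda>n. (?g (Suc j) n - ?c n) * (?g (Suc j) n + ?c n) + 2 * ?c n * (?c n - ?g j n) + err \<beta> (Suc j) n +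
    2 * (1 - block_sizes.a n (p n)) ^ relax n) \<longlonglongrightarrow> 0 + 0 + 0 + 2 * 0"
    by (intro tendsto_add tendsto_mult tendsto_const err_small relax_decay)
  moreover have "(\<lambda>n. (?g (Suc j) n - ?c n) * (?g (Suc j) n + ?c n) + 2 * ?c n * (?c n - ?g j n) + err \<beta> (Suc j) n +
    2 * (1 - block_sizes.a n (p n)) ^ relax n) = dev \<theta> \<beta> j"
    by (simp add: fun_eq_iff dev_def power2_eq_square algebra_simps)
  ultimately show ?thesis by simp
qed

lemma prob_dev_le:
  assumes x0: "\<And>n. n \<ge> 2 \<Longrightarrow> x0 n \<in> {1..n}" and \<epsilon>: "\<epsilon> > 0"
  shows "\<forall>\<^sub>F n in sequentially. measure_pmf.prob (blocks_law n (p n) (time \<beta> 0 n))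
      {l. \<epsilon> < \<bar>tv_norm n (\<lambda>x. mass (x0 n) l x - 1 / real n) - std_normal_cdf (centre \<beta> n)\<bar>} \<le>
    4 / \<epsilon>\<^sup>2 * dev (4 / \<epsilon>) \<beta> 0 n + 4 / \<epsilon>\<^sup>2 * dev 1 \<beta> 1 n + 2 * (1 - block_sizes.a n (p n)) ^ relax n / \<epsilon>\<^sup>2"
  using ev2 time_approx[of 2 \<beta>]
proof eventually_elim
  case (elim n)
  interpret block_process n "p n" "x0 n"
    using block_sizes[OF elim(1)] x0[OF elim(1)] by (intro block_process.intro fragmentation.intro)
  have t: "time \<beta> 0 n = time \<beta> 1 n + relax n" "time \<beta> 0 n = relax n + time \<beta> 1 n" "time \<beta> 1 n = relax n + time \<beta> (Suc 1) n"
    using elim(2) by (auto simp: time_def)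
  let ?c = "std_normal_cdf (centre \<beta> n)"
  have A: "EL (relax n + time \<beta> (Suc j) n) (\<lambda>l. (heavy (\<theta> / real n) l - ?c)\<^sup>2) \<le> dev \<theta> \<beta> j n"
    if "time \<beta> j n = relax n + time \<beta> (Suc j) n" for j \<theta>
    using EL_heavy_dev_le[of "relax n" "time \<beta> (Suc j) n" "\<theta> / real n" ?c "nat \<lfloor>sqrt (real n)\<rfloor>"] that
    by (simp add: dev_def err_def)
  have "measure_pmf.prob (blocks_law n (p n) (time \<beta> 1 n + relax n))
      {l. \<epsilon> < \<bar>tv_norm n (\<lambda>x. mass (x0 n) l x - 1 / real n) - ?c\<bar>} \<le>
    4 / \<epsilon>\<^sup>2 * EL (time \<beta> 1 n + relax n) (\<lambda>l. (heavy (4 / \<epsilon> / real n) l - ?c)\<^sup>2) +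
    4 / \<epsilon>\<^sup>2 * EL (time \<beta> 1 n) (\<lambda>l. (heavy (1 / real n) l - ?c)\<^sup>2) + 2 * (1 - a) ^ relax n / \<epsilon>\<^sup>2"
    using \<epsilon> by (intro prob_tv_dev_le) auto
  also have "\<dots> \<le> 4 / \<epsilon>\<^sup>2 * dev (4 / \<epsilon>) \<beta> 0 n + 4 / \<epsilon>\<^sup>2 * dev 1 \<beta> 1 n + 2 * (1 - a) ^ relax n / \<epsilon>\<^sup>2"
    using A[of 0 "4 / \<epsilon>"] A[of 1 1] t by (intro add_mono mult_left_mono) (auto simp: add.commute)
  finally show ?case using t(1) by simp
qed

end

theorem theorem2p10:
  fixes p :: "nat \<Rightarrow> nat pmf"
    and M :: "nat \<Rightarrow> 'a measure"
    and X :: "nat \<Rightarrow> nat \<Rightarrow> 'a \<Rightarrow> nat"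
    and A :: "nat \<Rightarrow> nat \<Rightarrow> 'a \<Rightarrow> nat set"
    and x0 :: "nat \<Rightarrow> nat"
    and \<beta> :: real
  defines "\<rho> \<equiv> \<lambda>n. log_sd (p n) / log_mean (p n)"
  assumes range: "\<And>n. n \<ge> 2 \<Longrightarrow> set_pmf (p n) \<subseteq> {2..n}"
    and scenarios: "scenario1 p \<or> scenario2 p"
    and blocks: "\<And>n. n \<ge> 2 \<Longrightarrow> random_blocks (M n) n (p n) (X n) (A n)"
    and start: "\<And>n. n \<ge> 2 \<Longrightarrow> x0 n \<in> {1..n}"
  shows "\<forall>\<epsilon>>0.
    (\<lambda>n. measure (M n)
       {\<omega> \<in> space (M n).
          \<bar>d_TV n (x0 n) (\<lambda>t. A n t \<omega>) (nat \<lfloor>t_ent n (p n) + \<beta> * t_w n (p n)\<rfloor>)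
           - std_normal_cdf (- \<beta> * ((1 + \<rho> n) / sqrt (1 + (\<rho> n)\<^sup>2)))\<bar> > \<epsilon>})
    \<longlonglongrightarrow> 0"
proof (intro allI impI)
  fix \<epsilon> :: real assume \<epsilon>: "\<epsilon> > 0"
  interpret averaging_sequence p
    using scenarios scenario1_averaging_sequence[OF range] scenario2_averaging_sequence[OF range] by blast
  let ?b = "\<lambda>n. 4 / \<epsilon>\<^sup>2 * dev (4 / \<epsilon>) \<beta> 0 n + 4 / \<epsilon>\<^sup>2 * dev 1 \<beta> 1 n + 2 * (1 - block_sizes.a n (p n)) ^ relax n / \<epsilon>\<^sup>2"
  let ?P = "\<lambda>n. measure (M n) {\<omega> \<in> space (M n).
          \<bar>d_TV n (x0 n) (\<lambda>t. A n t \<omega>) (nat \<lfloor>t_ent n (p n) + \<beta> * t_w n (p n)\<rfloor>)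
           - std_normal_cdf (- \<beta> * ((1 + \<rho> n) / sqrt (1 + (\<rho> n)\<^sup>2)))\<bar> > \<epsilon>}"
  show "?P \<longlonglongrightarrow> 0"
  proof (rule Lim_null_comparison)
    have "\<forall>\<^sub>F n in sequentially. measure_pmf.prob (blocks_law n (p n) (time \<beta> 0 n))
      {l. \<epsilon> < \<bar>tv_norm n (\<lambda>x. mass (x0 n) l x - 1 / real n) - std_normal_cdf (centre \<beta> n)\<bar>} \<le> ?b n"
      by (rule prob_dev_le[OF start \<epsilon>])
    with ev2 show "\<forall>\<^sub>F n in sequentially. norm (?P n) \<le> ?b n"
    proof eventually_elim
      case (elim n)
      interpret block_process n "p n" "x0 n"
        using block_sizes[OF elim(1)] start[OF elim(1)] by (intro block_process.intro fragmentation.intro)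
      let ?Q = "\<lambda>l. \<epsilon> < \<bar>tv_norm n (\<lambda>x. mass (x0 n) l x - 1 / real n) - std_normal_cdf (centre \<beta> n)\<bar>"
      have "?P n = measure (M n) {\<omega> \<in> space (M n). ?Q (map (\<lambda>s. A n s \<omega>) (rev [1..<Suc (time \<beta> 0 n)]))}"
        unfolding d_TV_def block_average_process_eq_mass centre_def \<rho>_def time_def by simp
      also have "\<dots> \<le> measure_pmf.prob (blocks_law n (p n) (time \<beta> 0 n)) {l. ?Q l}"
        by (rule measure_random_blocks_le[OF blocks[OF elim(1)]])
      finally show ?case using elim(2) by simp
    qed
    have "?b \<longlonglongrightarrow> 4 / \<epsilon>\<^sup>2 * 0 + 4 / \<epsilon>\<^sup>2 * 0 + 2 * 0 / \<epsilon>\<^sup>2"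
      using \<epsilon> by (intro tendsto_intros dev_small relax_decay) auto
    then show "?b \<longlonglongrightarrow> 0" by simp
  qed
qed

end
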